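(* Let $K$ be the attractor of a family of similarity transformations $S_1,\dots,S_k$ in $\mathbb R^D$, where $S_i$ has similarity ratio $0<r_i<1$. Suppose that the Open Set Condition is satisfied and let $\delta=\dim(K)$ be the Hausdorff dimension of $K$; recall that $\delta$ is the unique positive solution of the equation $\sum_{i=1}^kr_i^\delta=1$. Let $(p_1,\dots,p_k)$ be a probability vector and let $m$ be the self-similar probability measure such that $m=\sum_{i=1}^kp_i\,m\circ S_i^{-1}$. Set $$d=\frac{\sum_{i=1}^kp_i\ln p_i}{\sum_{i=1}^kp_i\ln r_i}\quad\text{and}\quad \sigma^2=\frac{\sum_{i=1}^kp_i(\ln p_i-d\,\ln r_i)^2}{-\sum_{i=1}^kp_i\ln r_i}.$$ Suppose that $d\neq\delta$ (which is equivalent to $\sigma>0$), and let $\Theta(t)=e^{\sqrt{2\ln(1/t)\,\ln\ln\ln(1/t)}}$. Then for all $\varepsilon>0$: (1) $m\ll\mathcal H^\Psi$, where $\Psi(t)=t^d\,\Theta(t)^{\sigma+\varepsilon}$; (2) $m\perp\mathcal H^\Psi$, where $\Psi(t)=t^d\,\Theta(t)^{\sigma-\varepsilon}$. In particular, $m\perp\mathcal H^d$.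
   Context: The attractor $K$ is the unique nonempty compact set with $K=\bigcup_{i=1}^kS_i(K)$. Open Set Condition: there exists a nonempty bounded open set $U\subset\mathbb R^D$ with $\bigcup_{i=1}^kS_i(U)\subset U$ and $S_i(U)\cap S_j(U)=\emptyset$ for all $i\neq j$. The number $\sigma$ is the nonnegative square root of $\sigma^2$, and $\Theta(t)$ is considered for small $t>0$. Generalized Hausdorff measure: for a positive function $\Psi$ defined for small $t>0$, $\mathcal H^\Psi(E)=\lim_{\eta\to0}\inf\{\sum_i\Psi(|U_i|):E\subset\bigcup_iU_i,\ 0<|U_i|\le\eta\}$ (countable covers, $|U|$ the diameter of $U$); $\mathcal H^s$ denotes $\mathcal H^\Psi$ with $\Psi(t)=t^s$. $m\ll\mathcal H^\Psi$ means: $\mathcal H^\Psi(E)=0$ implies $m(E)=0$ for every Borel set $E$. $m\perp\mathcal H^\Psi$ means: there is a Borel set $E$ with $m(E)=1$ and $\mathcal H^\Psi(E)=0$.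
   Formalization: All weights p_i are assumed positive: ln p_i is undefined at 0, and with 0·ln 0 = 0 the claim fails for p = (1,0,…,0); if σ > 0, maps of weight zero can simply be dropped. That δ is the unique positive solution is claimed for k ≥ 2 only (for k = 1, δ = 0). *)

theory Defs
  imports "HOL-Probability.Probability"
begin

text \<open>
  Covers are families indexed by an arbitrary \<open>I :: nat set\<close>, so that finite covers are admitted:
  since all diameters have to be positive, a finite cover could not be padded by empty sets.
  Boundedness is explicit because \<^const>\<open>diameter\<close> is an unspecified real for unbounded sets.
\<close>

definition hausdorff_premeasure ::
    "(real \<Rightarrow> real) \<Rightarrow> real \<Rightarrow> 'a::metric_space set \<Rightarrow> ennreal" where
  "hausdorff_premeasure \<Psi> \<eta> E =
     Inf {(\<Sum>\<^sub>\<infinity>i\<in>I. ennreal (\<Psi> (diameter (U i)))) | (I :: nat set) U.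
            E \<subseteq> (\<Union>i\<in>I. U i) \<and>
            (\<forall>i\<in>I. bounded (U i) \<and> 0 < diameter (U i) \<and> diameter (U i) \<le> \<eta>)}"

definition hausdorff_measure :: "(real \<Rightarrow> real) \<Rightarrow> 'a::metric_space set \<Rightarrow> ennreal" where
  "hausdorff_measure \<Psi> E = Lim (at_right 0) (\<lambda>\<eta>. hausdorff_premeasure \<Psi> \<eta> E)"

text \<open>The limit exists for every gauge \<open>\<Psi>\<close>, also one that is positive only near \<open>0\<close>.\<close>

lemma hausdorff_premeasure_antimono:
  assumes "\<eta> \<le> \<eta>'"
  shows "hausdorff_premeasure \<Psi> \<eta>' E \<le> hausdorff_premeasure \<Psi> \<eta> E"
  unfolding hausdorff_premeasure_def
  by (rule Inf_superset_mono) (use assms in \<open>blast intro: order_trans\<close>)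

lemma tendsto_hausdorff_premeasure:
  "((\<lambda>\<eta>. hausdorff_premeasure \<Psi> \<eta> E) \<longlongrightarrow>
     (SUP \<eta>\<in>{0<..}. hausdorff_premeasure \<Psi> \<eta> E)) (at_right 0)"
proof (rule order_tendstoI)
  fix a assume "a < (SUP \<eta>\<in>{0<..}. hausdorff_premeasure \<Psi> \<eta> E)"
  then obtain \<eta>0 where "0 < \<eta>0" "a < hausdorff_premeasure \<Psi> \<eta>0 E"
    by (auto simp: less_SUP_iff)
  then show "\<forall>\<^sub>F \<eta> in at_right 0. a < hausdorff_premeasure \<Psi> \<eta> E"
    unfolding eventually_at_right_field
    by (meson hausdorff_premeasure_antimono less_imp_le less_le_trans)
next
  fix a assume a: "(SUP \<eta>\<in>{0<..}. hausdorff_premeasure \<Psi> \<eta> E) < a"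
  have "hausdorff_premeasure \<Psi> \<eta> E < a" if "0 < \<eta>" for \<eta>
    by (rule le_less_trans[OF SUP_upper a]) (use that in simp)
  then show "\<forall>\<^sub>F \<eta> in at_right 0. hausdorff_premeasure \<Psi> \<eta> E < a"
    by (auto simp: eventually_at_right_field intro: exI[of _ 1])
qed

lemma hausdorff_measure_eq_SUP:
  "hausdorff_measure \<Psi> E = (SUP \<eta>\<in>{0<..}. hausdorff_premeasure \<Psi> \<eta> E)"
  unfolding hausdorff_measure_def
  by (rule tendsto_Lim[OF _ tendsto_hausdorff_premeasure]) simp

text \<open>
  The real-valued infimum is meaningful: in a Euclidean space the \<open>s\<close>-dimensional measure of
  every set vanishes for all \<open>s > DIM('a)\<close>.
\<close>

definition hausdorff_dim :: "'a::euclidean_space set \<Rightarrow> real" where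
  "hausdorff_dim E = Inf {s. 0 \<le> s \<and> hausdorff_measure (\<lambda>t. t powr s) E = 0}"

definition similarity :: "real \<Rightarrow> ('a::metric_space \<Rightarrow> 'a) \<Rightarrow> bool" where
  "similarity r f \<longleftrightarrow> (\<forall>x y. dist (f x) (f y) = r * dist x y)"

definition attractor :: "nat \<Rightarrow> (nat \<Rightarrow> 'a::metric_space \<Rightarrow> 'a) \<Rightarrow> 'a set \<Rightarrow> bool" where
  "attractor k S K \<longleftrightarrow> compact K \<and> K \<noteq> {} \<and> K = (\<Union>i\<in>{1..k}. S i ` K)"

definition open_set_condition :: "nat \<Rightarrow> (nat \<Rightarrow> 'a::metric_space \<Rightarrow> 'a) \<Rightarrow> bool" where
  "open_set_condition k S \<longleftrightarrow>
     (\<exists>U. U \<noteq> {} \<and> bounded U \<and> open U \<and> (\<Union>i\<in>{1..k}. S i ` U) \<subseteq> U \<and>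
          (\<forall>i\<in>{1..k}. \<forall>j\<in>{1..k}. i \<noteq> j \<longrightarrow> S i ` U \<inter> S j ` U = {}))"

definition self_similar_measure ::
    "nat \<Rightarrow> (nat \<Rightarrow> real) \<Rightarrow> (nat \<Rightarrow> 'a::metric_space \<Rightarrow> 'a) \<Rightarrow> 'a measure \<Rightarrow> bool" where
  "self_similar_measure k p S m \<longleftrightarrow>
     prob_space m \<and> sets m = sets borel \<and>
     (\<forall>A\<in>sets borel. measure m A = (\<Sum>i=1..k. p i * measure m (S i -` A)))"

text \<open>
  The Hausdorff set functions are not of type \<^typ>\<open>'a measure\<close>, so \<^const>\<open>absolutely_continuous\<close>
  is not applicable to them.
\<close>

definition abs_cont_hausdorff :: "'a::metric_space measure \<Rightarrow> (real \<Rightarrow> real) \<Rightarrow> bool" where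
  "abs_cont_hausdorff m \<Psi> \<longleftrightarrow>
     (\<forall>E\<in>sets borel. hausdorff_measure \<Psi> E = 0 \<longrightarrow> measure m E = 0)"

definition singular_hausdorff :: "'a::metric_space measure \<Rightarrow> (real \<Rightarrow> real) \<Rightarrow> bool" where
  "singular_hausdorff m \<Psi> \<longleftrightarrow>
     (\<exists>E\<in>sets borel. measure m E = 1 \<and> hausdorff_measure \<Psi> E = 0)"

text \<open>Only the values for \<open>0 < t < exp (- exp 1)\<close>, where the radicand is positive, are relevant.\<close>

definition Theta :: "real \<Rightarrow> real" where
  "Theta t = exp (sqrt (2 * ln (1 / t) * ln (ln (ln (1 / t)))))"

end

theory Submission
  imports Defs "HOL-Real_Asymp.Real_Asymp" "HOL-Library.Sublist"
begin

text \<open>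
  Write \<open>S\<^sub>w\<close>, \<open>r\<^sub>w\<close>, \<open>p\<^sub>w\<close> for the composition of the maps and the products of the ratios and of the
  probabilities along a word \<open>w\<close>. Infinite words code the points of \<open>K\<close>, and \<open>m\<close> is the image of the
  Bernoulli measure with weights \<open>p\<close> under the coding map (\<open>self_similar_coding\<close>,
  \<open>self_similar_measure_unique\<close>). So a word \<open>w\<close> stands for a piece of \<open>K\<close> of size about \<open>r\<^sub>w\<close> and a cylinder
  of mass \<open>p\<^sub>w\<close>.

  Along a random infinite word, \<open>ln p\<^sub>w - d * ln r\<^sub>w\<close> is a random walk with bounded steps, and \<open>d\<close> is the
  number that makes it centred. The length of the word is asymptotically proportional to \<open>ln (1 / r\<^sub>w)\<close> by the strong law of
  large numbers. In this time scale the walk has variance \<open>\<sigma>\<^sup>2\<close> per unit, and the law of the iterated logarithm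
  becomes a statement on \<open>Theta\<close>: almost surely \<open>p\<^sub>w \<le> r\<^sub>w powr d * Theta r\<^sub>w powr c\<close> for all long
  prefixes \<open>w\<close> if \<open>c > \<sigma>\<close> (\<open>lil_upper_clock\<close>), while the opposite inequality holds for infinitely many
  prefixes if \<open>c < \<sigma>\<close> (\<open>lil_lower_clock\<close>).

  The second fact gives singularity: stopping each word when its cylinder is heavy produces disjoint cylinders of
  total mass at most \<open>1\<close>, so that almost every point is covered with a small sum of gauges
  (\<open>economic_cover\<close>). The first fact gives absolute continuity: under the open set condition a set of diameter
  \<open>\<rho>\<close> meets a bounded number of pieces of size about \<open>\<rho>\<close> (\<open>bounded_overlap\<close>), so its mass is bounded by its
  gauge (\<open>mass_distribution\<close>). With the weights \<open>r i powr \<delta>\<close>, for which \<open>p\<^sub>w = r\<^sub>w powr \<delta>\<close>, the same two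
  principles compute the dimension of \<open>K\<close>. Finally \<open>\<sigma> = 0\<close> means \<open>p i = r i powr d\<close> for all \<open>i\<close>, and this is
  equivalent to \<open>d = \<delta>\<close> by the equality case of Gibbs' inequality.

  The two halves of the law of the iterated logarithm are proved for walks driven by finitely many letters. The
  upper half comes from an exponential maximal inequality along geometric times, the lower half from the central
  limit theorem on the pieces of long independent blocks.
\<close>

section \<open>Bernoulli measures on sequences of letters\<close>

abbreviation Bern :: "nat pmf \<Rightarrow> nat stream measure" where
  "Bern Q \<equiv> stream_space (measure_pmf Q)"

lemma space_Bern [simp]: "space (Bern Q) = UNIV"
  by (simp add: space_stream_space)

lemma prob_space_Bern: "prob_space (Bern Q)"
  by (rule prob_space.prob_space_stream_space) (rule measure_pmf.prob_space_axioms)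

lemma measurable_stake_Bern [measurable]: "stake n \<in> measurable (Bern Q) (count_space UNIV)"
proof -
  have "sets (Bern Q) = sets (stream_space (count_space (UNIV :: nat set)))"
    by (rule sets_stream_space_cong) simp
  then show ?thesis
    using measurable_stake[of n] by (simp cong: measurable_cong_sets)
qed

text \<open>
  Every condition on the first \<open>n\<close> letters is measurable, because there are only countably many
  words.
\<close>

lemma sets_Bern_stake [measurable]: "{\<omega>. R (stake n \<omega>)} \<in> sets (Bern Q)"
  using measurable_sets[OF measurable_stake_Bern[of n Q], of "Collect R"] by (simp add: vimage_def)

lemma emeasure_Bern_Cons:
  assumes "A \<in> sets (Bern Q)"
  shows "emeasure (Bern Q) A = (\<integral>\<^sup>+i. emeasure (Bern Q) {\<omega>. i ## \<omega> \<in> A} \<partial>measure_pmf Q)"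
  using prob_space.emeasure_stream_space[OF measure_pmf.prob_space_axioms assms] by simp

text \<open>
  Independence of past and future. Peeling off one letter at a time reduces it to the recursion
  \<open>emeasure_Bern_Cons\<close>.
\<close>

lemma emeasure_Bern_split:
  assumes [measurable]: "{\<omega>. T \<omega>} \<in> sets (Bern Q)"
  shows "emeasure (Bern Q) {\<omega>. R (stake n \<omega>) \<and> T (sdrop n \<omega>)} =
    emeasure (Bern Q) {\<omega>. R (stake n \<omega>)} * emeasure (Bern Q) {\<omega>. T \<omega>}"
proof (induction n arbitrary: R)
  case 0
  interpret prob_space "Bern Q" by (rule prob_space_Bern)
  show ?case by (cases "R []") (use emeasure_space_1 in simp_all)
next
  case (Suc n)
  have m: "{\<omega>. R (stake k \<omega>) \<and> T (sdrop k \<omega>)} \<in> sets (Bern Q)" for R k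
  proof -
    have "{\<omega> \<in> space (Bern Q). T (sdrop k \<omega>)} \<in> sets (Bern Q)"
      using measurable_sets[OF measurable_sdrop[of k "measure_pmf Q"] assms]
      by (simp add: vimage_def)
    then have "{\<omega>. R (stake k \<omega>)} \<inter> {\<omega>. T (sdrop k \<omega>)} \<in> sets (Bern Q)"
      by (intro sets.Int sets_Bern_stake) simp
    then show ?thesis by (simp add: Collect_conj_eq)
  qed
  have "emeasure (Bern Q) {\<omega>. R (stake (Suc n) \<omega>) \<and> T (sdrop (Suc n) \<omega>)} =
     (\<integral>\<^sup>+i. emeasure (Bern Q) {\<omega>. R (i # stake n \<omega>) \<and> T (sdrop n \<omega>)} \<partial>measure_pmf Q)"
    by (subst emeasure_Bern_Cons[OF m]) simp
  also have "\<dots> = (\<integral>\<^sup>+i. emeasure (Bern Q) {\<omega>. R (i # stake n \<omega>)} * emeasure (Bern Q) {\<omega>. T \<omega>} \<partial>measure_pmf Q)"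
    by (subst Suc) simp
  also have "\<dots> = (\<integral>\<^sup>+i. emeasure (Bern Q) {\<omega>. R (i # stake n \<omega>)} \<partial>measure_pmf Q) * emeasure (Bern Q) {\<omega>. T \<omega>}"
    by (rule nn_integral_multc) simp
  also have "(\<integral>\<^sup>+i. emeasure (Bern Q) {\<omega>. R (i # stake n \<omega>)} \<partial>measure_pmf Q) =
      emeasure (Bern Q) {\<omega>. R (stake (Suc n) \<omega>)}"
    by (subst emeasure_Bern_Cons[OF sets_Bern_stake[of R "Suc n"]]) simp
  finally show ?case .
qed

lemma measure_Bern_split:
  assumes "{\<omega>. T \<omega>} \<in> sets (Bern Q)"
  shows "measure (Bern Q) {\<omega>. R (stake n \<omega>) \<and> T (sdrop n \<omega>)} =
    measure (Bern Q) {\<omega>. R (stake n \<omega>)} * measure (Bern Q) {\<omega>. T \<omega>}"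
  using emeasure_Bern_split[OF assms, of R n] by (simp add: measure_def enn2real_mult)

lemma prod_list_pmf_nonneg: "0 \<le> prod_list (map (pmf Q) w)"
  by (induction w) auto

lemma emeasure_Bern_cylinder:
  "emeasure (Bern Q) {\<omega>. stake (length w) \<omega> = w} = ennreal (prod_list (map (pmf Q) w))"
proof (induction w)
  case Nil
  interpret prob_space "Bern Q" by (rule prob_space_Bern)
  show ?case using emeasure_space_1 by simp
next
  case (Cons a w)
  have "emeasure (Bern Q) {\<omega>. stake (length (a # w)) \<omega> = a # w} =
     (\<integral>\<^sup>+i. emeasure (Bern Q) {\<omega>. i = a \<and> stake (length w) \<omega> = w} \<partial>measure_pmf Q)"
    by (subst emeasure_Bern_Cons[OF sets_Bern_stake[of "\<lambda>v. v = a # w"]]) simp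
  also have "\<dots> = (\<integral>\<^sup>+i. ennreal (prod_list (map (pmf Q) w)) * indicator {a} i \<partial>measure_pmf Q)"
    by (intro nn_integral_cong) (auto simp: Cons split: split_indicator)
  also have "\<dots> = ennreal (prod_list (map (pmf Q) w)) * ennreal (pmf Q a)"
    by (subst nn_integral_cmult_indicator) (simp_all add: emeasure_pmf_single)
  finally show ?case
    using prod_list_pmf_nonneg[of Q w] by (simp add: ennreal_mult mult.commute)
qed

definition walk :: "(nat \<Rightarrow> real) \<Rightarrow> nat \<Rightarrow> nat stream \<Rightarrow> real" where
  "walk X n \<omega> = (\<Sum>j<n. X (\<omega> !! j))"

lemma walk_0 [simp]: "walk X 0 \<omega> = 0"
  by (simp add: walk_def)

lemma walk_Cons [simp]: "walk X (Suc n) (i ## \<omega>) = X i + walk X n \<omega>"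
  unfolding walk_def by (subst sum.lessThan_Suc_shift) simp

lemma walk_stake: "walk X n \<omega> = sum_list (map X (stake n \<omega>))"
proof (induction n arbitrary: \<omega>)
  case (Suc n)
  then show ?case by (cases \<omega>) simp
qed simp

lemma walk_add: "walk X (m + n) \<omega> = walk X m \<omega> + walk X n (sdrop m \<omega>)"
proof -
  have "{..<m + n} = {..<m} \<union> {m..<m+n}" by auto
  then have "walk X (m + n) \<omega> = walk X m \<omega> + (\<Sum>j=m..<m+n. X (\<omega> !! j))"
    unfolding walk_def by (simp add: sum.union_disjoint ivl_disj_int)
  also have "(\<Sum>j=m..<m+n. X (\<omega> !! j)) = (\<Sum>j<n. X (\<omega> !! (j + m)))"
    using sum.shift_bounds_nat_ivl[of "\<lambda>j. X (\<omega> !! j)" 0 m n]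
    by (simp add: lessThan_atLeast0 add.commute)
  also have "\<dots> = walk X n (sdrop m \<omega>)"
    by (simp add: walk_def sdrop_snth add.commute)
  finally show ?thesis .
qed

lemma walk_uminus: "walk (\<lambda>i. - X i) n \<omega> = - walk X n \<omega>"
  by (simp add: walk_def sum_negf)

lemma measurable_walk [measurable]: "walk X n \<in> borel_measurable (Bern Q)"
proof -
  have "walk X n = sum_list \<circ> map X \<circ> stake n" by (auto simp: walk_stake)
  then show ?thesis
    by (metis measurable_comp measurable_stake_Bern borel_measurable_count_space)
qed

section \<open>The upper half of the law of the iterated logarithm\<close>

text \<open>
  Conditioning on the first letter \<open>i\<close> lowers the level from \<open>x\<close> to \<open>x - X i\<close> and the number of steps by
  one, and averaging \<open>exp (- t * (x - X i))\<close> over \<open>i\<close> costs exactly one factor \<open>\<phi>\<close>. So the exponential bound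
  reproduces itself, and it holds for the maximum of the walk, not only for its end point, because a
  level \<open>x \<le> 0\<close> is reached at time \<open>0\<close> while the bound is then at least \<open>1\<close>.
\<close>

lemma maximal_exponential_inequality:
  fixes X :: "nat \<Rightarrow> real"
  assumes fin: "finite (set_pmf Q)" and t: "0 \<le> t"
    and phi: "measure_pmf.expectation Q (\<lambda>i. exp (t * X i)) \<le> \<phi>" and "1 \<le> \<phi>"
  shows "measure (Bern Q) {\<omega>. \<exists>j\<le>n. x \<le> walk X j \<omega>} \<le> exp (- t * x) * \<phi> ^ n"
proof -
  interpret prob_space "Bern Q" by (rule prob_space_Bern)
  have triv: "emeasure (Bern Q) A \<le> ennreal (exp (- t * x) * \<phi> ^ n)" if "x \<le> 0" for A x n
  proof -
    have "1 * 1 \<le> exp (- t * x) * \<phi> ^ n"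
      using that t \<open>1 \<le> \<phi>\<close> by (intro mult_mono one_le_power) (auto simp: mult_nonneg_nonpos)
    then have "1 \<le> ennreal (exp (- t * x) * \<phi> ^ n)"
      by (simp add: ennreal_leI flip: ennreal_1)
    with emeasure_le_1[of A] show ?thesis by (rule order_trans)
  qed
  have "emeasure (Bern Q) {\<omega>. \<exists>j\<le>n. x \<le> walk X j \<omega>} \<le> ennreal (exp (- t * x) * \<phi> ^ n)"
  proof (induction n arbitrary: x)
    case 0
    show ?case
      using triv[of x _ 0] by (cases "x \<le> 0") auto
  next
    case (Suc n)
    show ?case
    proof (cases "x \<le> 0")
      case True
      then show ?thesis by (rule triv)
    next
      case False
      have meas: "{\<omega>. \<exists>j\<le>Suc n. x \<le> walk X j \<omega>} \<in> sets (Bern Q)"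
      proof -
        have "{\<omega> \<in> space (Bern Q). \<exists>j\<in>{..Suc n}. x \<le> walk X j \<omega>} \<in> sets (Bern Q)"
          by measurable
        then show ?thesis by (simp add: Bex_def)
      qed
      have eq: "(\<exists>j\<le>Suc n. x \<le> walk X j (i ## \<omega>)) \<longleftrightarrow> (\<exists>j\<le>n. x - X i \<le> walk X j \<omega>)" for i \<omega>
      proof
        assume "\<exists>j\<le>Suc n. x \<le> walk X j (i ## \<omega>)"
        then obtain j where j: "j \<le> Suc n" "x \<le> walk X j (i ## \<omega>)" by auto
        then obtain l where "j = Suc l" using False by (cases j) auto
        with j show "\<exists>j\<le>n. x - X i \<le> walk X j \<omega>" by (auto intro!: exI[of _ l])
      next
        assume "\<exists>j\<le>n. x - X i \<le> walk X j \<omega>"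
        then obtain j where "j \<le> n" "x - X i \<le> walk X j \<omega>" by auto
        then show "\<exists>j\<le>Suc n. x \<le> walk X j (i ## \<omega>)" by (intro exI[of _ "Suc j"]) auto
      qed
      have int: "integrable (measure_pmf Q) f" for f :: "nat \<Rightarrow> real"
        by (rule integrable_measure_pmf_finite[OF fin])
      have "emeasure (Bern Q) {\<omega>. \<exists>j\<le>Suc n. x \<le> walk X j \<omega>} =
        (\<integral>\<^sup>+i. emeasure (Bern Q) {\<omega>. \<exists>j\<le>n. x - X i \<le> walk X j \<omega>} \<partial>measure_pmf Q)"
        by (subst emeasure_Bern_Cons[OF meas]) (simp add: eq)
      also have "\<dots> \<le> (\<integral>\<^sup>+i. ennreal (exp (- t * (x - X i)) * \<phi> ^ n) \<partial>measure_pmf Q)"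
        by (intro nn_integral_mono Suc)
      also have "\<dots> = ennreal (measure_pmf.expectation Q (\<lambda>i. exp (- t * (x - X i)) * \<phi> ^ n))"
        using \<open>1 \<le> \<phi>\<close> by (intro nn_integral_eq_integral int) auto
      also have "measure_pmf.expectation Q (\<lambda>i. exp (- t * (x - X i)) * \<phi> ^ n)
          = measure_pmf.expectation Q (\<lambda>i. (exp (- t * x) * \<phi> ^ n) * exp (t * X i))"
        by (intro Bochner_Integration.integral_cong refl)
           (simp add: algebra_simps flip: exp_add)
      also have "\<dots> = (exp (- t * x) * \<phi> ^ n) * measure_pmf.expectation Q (\<lambda>i. exp (t * X i))"
        by simp
      also have "\<dots> \<le> (exp (- t * x) * \<phi> ^ n) * \<phi>"
        using phi \<open>1 \<le> \<phi>\<close> by (intro mult_left_mono) auto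
      finally show ?thesis using \<open>1 \<le> \<phi>\<close>
        by (simp add: mult_ac ennreal_leI)
    qed
  qed
  then show ?thesis
    using \<open>1 \<le> \<phi>\<close> by (simp add: emeasure_eq_measure)
qed

lemma expectation_pmf_finite:
  fixes f :: "'i \<Rightarrow> real"
  assumes "finite (set_pmf Q)"
  shows "measure_pmf.expectation Q f = (\<Sum>i\<in>set_pmf Q. pmf Q i * f i)"
  using integral_measure_pmf[OF assms, of Q f] by simp

text \<open>
  The second order expansion of the moment generating function at \<open>0\<close>: a centred variable with variance
  below \<open>b\<^sup>2\<close> is sub-Gaussian with parameter \<open>b\<close> for small \<open>t\<close>.
\<close>

lemma exponential_moment_bound:
  fixes X :: "nat \<Rightarrow> real"
  assumes fin: "finite (set_pmf Q)"
    and mean: "measure_pmf.expectation Q X = 0"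
    and var: "measure_pmf.expectation Q (\<lambda>i. (X i)\<^sup>2) < b\<^sup>2"
  shows "\<forall>\<^sub>F t in at_right 0. measure_pmf.expectation Q (\<lambda>i. exp (t * X i)) \<le> exp (t\<^sup>2 * b\<^sup>2 / 2)"
proof -
  note E = expectation_pmf_finite[OF fin]
  have "((\<lambda>t. (exp (t * x) - 1 - t * x) / t\<^sup>2) \<longlongrightarrow> x\<^sup>2 / 2) (at_right 0)" for x :: real
  proof (cases x "0::real" rule: linorder_cases)
    case less
    then show ?thesis by real_asymp (simp add: power2_eq_square)
  next
    case greater
    then show ?thesis by real_asymp (simp add: power2_eq_square)
  qed auto
  then have "((\<lambda>t. \<Sum>i\<in>set_pmf Q. pmf Q i * ((exp (t * X i) - 1 - t * X i) / t\<^sup>2)) \<longlongrightarrow>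
      (\<Sum>i\<in>set_pmf Q. pmf Q i * ((X i)\<^sup>2 / 2))) (at_right 0)"
    by (intro tendsto_sum tendsto_mult tendsto_const)
  moreover have "(\<Sum>i\<in>set_pmf Q. pmf Q i * ((X i)\<^sup>2 / 2)) < b\<^sup>2 / 2"
    using var by (simp add: E sum_divide_distrib[symmetric])
  ultimately have "\<forall>\<^sub>F t in at_right 0. (\<Sum>i\<in>set_pmf Q. pmf Q i * ((exp (t * X i) - 1 - t * X i) / t\<^sup>2)) < b\<^sup>2 / 2"
    by (rule order_tendstoD(2))
  moreover have "\<forall>\<^sub>F t::real in at_right 0. t > 0"
    by (simp add: eventually_at_right_less)
  ultimately show ?thesis
  proof eventually_elim
    case (elim t)
    have *: "(\<Sum>i\<in>set_pmf Q. pmf Q i * ((exp (t * X i) - 1 - t * X i) / t\<^sup>2)) =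
        (\<Sum>i\<in>set_pmf Q. pmf Q i * (exp (t * X i) - 1 - t * X i)) / t\<^sup>2"
      by (simp add: sum_divide_distrib)
    have "(\<Sum>i\<in>set_pmf Q. pmf Q i * (exp (t * X i) - 1 - t * X i)) / t\<^sup>2 < b\<^sup>2 / 2"
      using elim unfolding * by simp
    then have "(\<Sum>i\<in>set_pmf Q. pmf Q i * (exp (t * X i) - 1 - t * X i)) < t\<^sup>2 * b\<^sup>2 / 2"
      using \<open>t > 0\<close> by (simp add: field_simps)
    also have "(\<Sum>i\<in>set_pmf Q. pmf Q i * (exp (t * X i) - 1 - t * X i)) =
       measure_pmf.expectation Q (\<lambda>i. exp (t * X i)) - (\<Sum>i\<in>set_pmf Q. pmf Q i) - t * measure_pmf.expectation Q X"
      by (simp add: E algebra_simps sum_subtractf sum.distrib sum_distrib_left)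
    also have "(\<Sum>i\<in>set_pmf Q. pmf Q i) = 1"
      using fin by (intro sum_pmf_eq_1) auto
    finally have "measure_pmf.expectation Q (\<lambda>i. exp (t * X i)) \<le> 1 + t\<^sup>2 * b\<^sup>2 / 2"
      by (simp add: mean)
    also have "\<dots> \<le> exp (t\<^sup>2 * b\<^sup>2 / 2)"
      by (rule exp_ge_add_one_self)
    finally show ?case .
  qed
qed

lemma ln_ln_mono:
  fixes x y :: real
  assumes "exp 1 \<le> x" "x \<le> y"
  shows "ln (ln x) \<le> ln (ln y)"
proof -
  have "0 < x" using assms(1) by (meson exp_gt_zero less_le_trans)
  then have "1 \<le> ln x" "ln x \<le> ln y" using assms by (simp_all add: ln_ge_iff)
  then show ?thesis by (subst ln_le_cancel_iff) auto
qed

definition lil_scale :: "real \<Rightarrow> real" where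
  "lil_scale x = sqrt (2 * x * ln (ln x))"

lemma lil_scale_mono:
  assumes "exp 1 \<le> x" "x \<le> y"
  shows "lil_scale x \<le> lil_scale y"
proof -
  have "0 < x" using assms(1) by (meson exp_gt_zero less_le_trans)
  then have "1 \<le> ln x" using assms(1) by (simp add: ln_ge_iff)
  then have "x * ln (ln x) \<le> y * ln (ln y)"
    using \<open>0 < x\<close> assms ln_ln_mono[OF assms] by (intro mult_mono) auto
  then show ?thesis by (simp add: lil_scale_def)
qed

text \<open>
  Since \<open>ln (ln x)\<close> varies slowly, dilating the argument by \<open>a\<close> multiplies the scale by \<open>sqrt a\<close>
  asymptotically; the strict inequality absorbs the error.
\<close>

lemma lil_scale_dilate:
  assumes "0 < a" "0 \<le> c1" "0 < c" "c1\<^sup>2 * a < c\<^sup>2"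
  shows "\<forall>\<^sub>F x in at_top. c1 * lil_scale (a * x) \<le> c * lil_scale x"
proof -
  have "((\<lambda>x. (c1\<^sup>2 * (2 * (a * x) * ln (ln (a * x)))) / (c\<^sup>2 * (2 * x * ln (ln x)))) \<longlongrightarrow> c1\<^sup>2 * a / c\<^sup>2) at_top"
    using assms(1,3) by real_asymp (auto simp: field_simps)
  moreover have "c1\<^sup>2 * a / c\<^sup>2 < 1" using assms by (simp add: divide_simps)
  ultimately have "\<forall>\<^sub>F x in at_top. (c1\<^sup>2 * (2 * (a * x) * ln (ln (a * x)))) / (c\<^sup>2 * (2 * x * ln (ln x))) < 1"
    by (rule order_tendstoD(2))
  moreover have "\<forall>\<^sub>F x in at_top. 0 < 2 * x * ln (ln (x::real))" by real_asymp
  ultimately show ?thesis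
  proof eventually_elim
    case (elim x)
    have "0 < c\<^sup>2 * (2 * x * ln (ln x))"
      by (rule mult_pos_pos) (use elim(2) assms(3) in simp_all)
    with elim(1) have "(c1\<^sup>2 * (2 * (a * x) * ln (ln (a * x)))) \<le> (c\<^sup>2 * (2 * x * ln (ln x)))"
      by (subst (asm) pos_divide_less_eq) simp_all
    then have "sqrt (c1\<^sup>2 * (2 * (a * x) * ln (ln (a * x)))) \<le> sqrt (c\<^sup>2 * (2 * x * ln (ln x)))"
      by (rule real_sqrt_le_mono)
    then show ?case using assms(2,3)
      by (simp add: real_sqrt_mult lil_scale_def)
  qed
qed

lemma geometric_block:
  fixes a :: real and n :: nat
  assumes "1 < a" "1 \<le> n"
  obtains k where "real n < a ^ k" "a ^ k \<le> a * real n"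
proof -
  define k where "k = nat \<lfloor>log a n\<rfloor>"
  have "0 \<le> log a n" using assms by simp
  then have k: "real k \<le> log a n" "log a n < real k + 1"
    unfolding k_def by linarith+
  then have "a powr real k \<le> n" "n < a powr (real k + 1)"
    using assms by (simp_all add: le_log_iff log_less_iff)
  then have "a ^ k \<le> real n" "real n < a ^ Suc k"
    using assms by (simp_all add: powr_realpow powr_add mult.commute)
  with assms show ?thesis by (intro that[of "Suc k"]) auto
qed

text \<open>
  Only the times \<open>a ^ k\<close> matter for \<open>a > 1\<close> close to \<open>1\<close>: by the maximal inequality the walk exceeds
  \<open>c1 * lil_scale (a ^ k)\<close> before time \<open>a ^ k\<close> with probability at most \<open>(k * ln a) powr - (c1 / b)\<^sup>2\<close>, which is
  summable as soon as \<open>c1 > b\<close>, and between consecutive such times the scale changes by a factor close to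
  \<open>sqrt a\<close> only.
\<close>

theorem lil_upper:
  fixes X :: "nat \<Rightarrow> real"
  assumes fin: "finite (set_pmf Q)"
    and mean: "measure_pmf.expectation Q X = 0"
    and var: "measure_pmf.expectation Q (\<lambda>i. (X i)\<^sup>2) < c\<^sup>2" and "0 < c"
  shows "AE \<omega> in Bern Q. \<forall>\<^sub>F n in sequentially. walk X n \<omega> \<le> c * lil_scale (real n)"
proof -
  interpret prob_space "Bern Q" by (rule prob_space_Bern)
  define v where "v = measure_pmf.expectation Q (\<lambda>i. (X i)\<^sup>2)"
  have "0 \<le> v" unfolding v_def by simp
  have "sqrt v < c" using var \<open>0 < c\<close> unfolding v_def[symmetric]
    by (metis real_sqrt_less_iff real_sqrt_unique order_less_imp_le)
  then obtain b where b: "sqrt v < b" "b < c" using dense by blast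
  then obtain c1 where c1: "b < c1" "c1 < c" using dense by blast
  have "0 < b" using b(1) \<open>0 \<le> v\<close> real_sqrt_ge_zero[of v] by linarith
  have "v < b\<^sup>2" using b(1) \<open>0 \<le> v\<close> \<open>0 < b\<close>
    by (metis real_sqrt_less_iff real_sqrt_unique order_less_imp_le)
  have "c1\<^sup>2 < c\<^sup>2" using c1 \<open>0 < b\<close> by (intro power_strict_mono) auto
  have "0 < c1\<^sup>2" using c1 \<open>0 < b\<close> by simp
  obtain a where a: "1 < a" "c1\<^sup>2 * a < c\<^sup>2"
  proof -
    have "1 < c\<^sup>2 / c1\<^sup>2" using \<open>c1\<^sup>2 < c\<^sup>2\<close> \<open>0 < c1\<^sup>2\<close> by simp
    then obtain a where "1 < a" "a < c\<^sup>2 / c1\<^sup>2" using dense by blast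
    then show ?thesis using \<open>0 < c1\<^sup>2\<close> by (intro that[of a]) (auto simp: field_simps)
  qed
  define x where "x k = c1 * lil_scale (a ^ k)" for k :: nat
  \<comment> \<open>this \<open>t\<close> minimises the exponent \<open>- t * x k + a ^ k * t\<^sup>2 * b\<^sup>2 / 2\<close>\<close>
  define t where "t k = x k / (a ^ k * b\<^sup>2)" for k :: nat
  define A where "A k = {\<omega>. \<exists>j\<le>nat \<lfloor>a ^ k\<rfloor>. x k \<le> walk X j \<omega>}" for k :: nat
  have A_sets: "A k \<in> sets (Bern Q)" for k
  proof -
    have "{\<omega> \<in> space (Bern Q). \<exists>j\<in>{..nat \<lfloor>a ^ k\<rfloor>}. x k \<le> walk X j \<omega>} \<in> sets (Bern Q)"
      by measurable
    then show ?thesis by (simp add: Bex_def A_def)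
  qed
  have a_pow: "filterlim (\<lambda>k. a ^ k) at_top sequentially"
    using \<open>1 < a\<close> by real_asymp
  have t_lim: "filterlim t (at_right 0) sequentially"
  proof -
    have "filterlim (\<lambda>z. c1 * sqrt (2 * z * ln (ln z)) / (z * b\<^sup>2)) (at_right 0) at_top"
      using \<open>0 < b\<close> c1 by real_asymp
    from filterlim_compose[OF this a_pow] show ?thesis
      by (simp add: t_def[abs_def] x_def lil_scale_def)
  qed
  have ev1: "\<forall>\<^sub>F k in sequentially. measure_pmf.expectation Q (\<lambda>i. exp (t k * X i)) \<le> exp ((t k)\<^sup>2 * b\<^sup>2 / 2)"
    using exponential_moment_bound[OF fin mean \<open>v < b\<^sup>2\<close>[unfolded v_def]] t_lim
    by (rule eventually_compose_filterlim)
  have ev2: "\<forall>\<^sub>F k in sequentially. 0 < t k"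
    using t_lim eventually_at_right_less by (metis eventually_compose_filterlim)
  have ev3: "\<forall>\<^sub>F k in sequentially. 0 < ln (ln (a ^ k))"
  proof -
    have "\<forall>\<^sub>F z in at_top. 0 < ln (ln (z::real))" by real_asymp
    then show ?thesis using a_pow by (rule eventually_compose_filterlim)
  qed
  have bound: "\<forall>\<^sub>F k in sequentially. measure (Bern Q) (A k) \<le> (real k * ln a) powr (- (c1\<^sup>2 / b\<^sup>2))"
    using ev1 ev2 ev3 eventually_gt_at_top[of 0]
  proof eventually_elim
    case (elim k)
    let ?\<phi> = "exp ((t k)\<^sup>2 * b\<^sup>2 / 2)"
    have "measure (Bern Q) (A k) \<le> exp (- t k * x k) * ?\<phi> ^ nat \<lfloor>a ^ k\<rfloor>"
      unfolding A_def using elim by (intro maximal_exponential_inequality fin) auto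
    also have "?\<phi> ^ nat \<lfloor>a ^ k\<rfloor> = exp (real (nat \<lfloor>a ^ k\<rfloor>) * ((t k)\<^sup>2 * b\<^sup>2 / 2))"
      by (rule exp_of_nat_mult[symmetric])
    also have "\<dots> \<le> exp (a ^ k * ((t k)\<^sup>2 * b\<^sup>2 / 2))"
    proof -
      have "real (nat \<lfloor>a ^ k\<rfloor>) \<le> a ^ k" using a(1) by (intro of_nat_floor) auto
      then show ?thesis by (intro iffD2[OF exp_le_cancel_iff] mult_right_mono) auto
    qed
    finally have "measure (Bern Q) (A k) \<le> exp (- t k * x k) * exp (a ^ k * ((t k)\<^sup>2 * b\<^sup>2 / 2))"
      by simp
    also have "\<dots> = exp (- (c1\<^sup>2 / b\<^sup>2) * ln (ln (a ^ k)))"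
    proof -
      have pos: "0 < a ^ k" using a(1) by simp
      have x2: "(x k)\<^sup>2 = c1\<^sup>2 * (2 * a ^ k * ln (ln (a ^ k)))"
        unfolding x_def lil_scale_def using elim pos by (simp add: power_mult_distrib)
      have "- t k * x k + a ^ k * ((t k)\<^sup>2 * b\<^sup>2 / 2) = - (x k)\<^sup>2 / (2 * a ^ k * b\<^sup>2)"
        unfolding t_def using pos \<open>0 < b\<close> by (simp add: field_simps power2_eq_square)
      also have "\<dots> = - (c1\<^sup>2 / b\<^sup>2) * ln (ln (a ^ k))"
        unfolding x2 using a(1) \<open>0 < b\<close> by (simp add: field_simps)
      finally show ?thesis by (simp flip: exp_add)
    qed
    also have "\<dots> = (real k * ln a) powr (- (c1\<^sup>2 / b\<^sup>2))"
      using a(1) elim by (simp add: powr_def ln_realpow)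
    finally show ?case .
  qed
  have "summable (\<lambda>k. (real k * ln a) powr (- (c1\<^sup>2 / b\<^sup>2)))"
  proof -
    have "b\<^sup>2 < c1\<^sup>2" using \<open>0 < b\<close> c1 by (intro power_strict_mono) auto
    then have "- (c1\<^sup>2 / b\<^sup>2) < -1" using \<open>0 < b\<close> by (simp add: field_simps)
    then have "summable (\<lambda>k. real k powr (- (c1\<^sup>2 / b\<^sup>2)))" by (simp add: summable_real_powr_iff)
    then have "summable (\<lambda>k. real k powr (- (c1\<^sup>2 / b\<^sup>2)) * ln a powr (- (c1\<^sup>2 / b\<^sup>2)))"
      by (rule summable_mult2)
    then show ?thesis using a(1) by (simp add: powr_mult)
  qed
  then have "summable (\<lambda>k. measure (Bern Q) (A k))"
    by (rule summable_comparison_test_ev[rotated]) (use bound in simp)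
  then have "AE \<omega> in Bern Q. \<forall>\<^sub>F k in sequentially. \<omega> \<in> space (Bern Q) - A k"
    by (intro borel_cantelli_AE1 A_sets) (auto simp: emeasure_eq_measure)
  moreover have "\<forall>\<^sub>F n in sequentially. walk X n \<omega> \<le> c * lil_scale (real n)"
    if ev: "\<forall>\<^sub>F k in sequentially. \<omega> \<in> space (Bern Q) - A k" for \<omega>
  proof -
    obtain k0 where k0: "\<And>k. k \<ge> k0 \<Longrightarrow> \<omega> \<notin> A k"
      using ev by (auto simp: eventually_sequentially)
    have "\<forall>\<^sub>F z in at_top. c1 * lil_scale (a * z) \<le> c * lil_scale z"
      using a c1 \<open>0 < b\<close> \<open>0 < c\<close> by (intro lil_scale_dilate) auto
    then have "\<forall>\<^sub>F n in sequentially. c1 * lil_scale (a * real n) \<le> c * lil_scale (real n)"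
      using filterlim_real_sequentially by (rule eventually_compose_filterlim)
    moreover have "\<forall>\<^sub>F n in sequentially. exp 1 \<le> real n \<and> a ^ k0 \<le> real n"
      by (intro eventually_conj) (use filterlim_real_sequentially in \<open>auto simp: filterlim_at_top\<close>)
    ultimately show ?thesis
      using eventually_ge_at_top[of 1]
    proof eventually_elim
      case (elim n)
      obtain k where k: "real n < a ^ k" "a ^ k \<le> a * real n"
        using geometric_block[OF a(1) elim(3)] .
      have "a ^ k0 < a ^ k" using elim k by linarith
      then have "k0 \<le> k" using a(1) by (simp add: power_strict_increasing_iff)
      have "n \<le> nat \<lfloor>a ^ k\<rfloor>" using k(1) by linarith
      then have "walk X n \<omega> < x k" using k0[OF \<open>k0 \<le> k\<close>] unfolding A_def
        by (metis (mono_tags, lifting) mem_Collect_eq not_le)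
      also have "x k \<le> c1 * lil_scale (a * real n)"
        unfolding x_def using c1 \<open>0 < b\<close> k elim by (intro mult_left_mono lil_scale_mono) auto
      also have "\<dots> \<le> c * lil_scale (real n)" using elim by simp
      finally show ?case by simp
    qed
  qed
  ultimately show ?thesis by (rule eventually_mono)
qed

text \<open>
  The iterated logarithm bound, applied to \<open>X - \<mu>\<close> and to its negative, is of smaller order than \<open>n\<close>.
\<close>

corollary strong_law:
  fixes X :: "nat \<Rightarrow> real"
  assumes fin: "finite (set_pmf Q)"
  shows "AE \<omega> in Bern Q. (\<lambda>n. walk X n \<omega> / n) \<longlonglongrightarrow> measure_pmf.expectation Q X"
proof -
  define \<mu> where "\<mu> = measure_pmf.expectation Q X"
  define c where "c = sqrt (measure_pmf.expectation Q (\<lambda>i. (X i - \<mu>)\<^sup>2) + 1)"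
  have "0 \<le> measure_pmf.expectation Q (\<lambda>i. (X i - \<mu>)\<^sup>2)" by simp
  then have c: "0 < c" "measure_pmf.expectation Q (\<lambda>i. (X i - \<mu>)\<^sup>2) < c\<^sup>2"
    unfolding c_def by (simp_all add: add_nonneg_pos add_nonneg_nonneg)
  have int: "integrable (measure_pmf Q) f" for f :: "nat \<Rightarrow> real"
    by (rule integrable_measure_pmf_finite[OF fin])
  have mean: "measure_pmf.expectation Q (\<lambda>i. X i - \<mu>) = 0"
    using int by (simp add: \<mu>_def measure_pmf.prob_space)
  have mean': "measure_pmf.expectation Q (\<lambda>i. - (X i - \<mu>)) = 0"
    using mean by (metis integral_minus neg_equal_0_iff_equal)
  have eq: "walk (\<lambda>i. X i - \<mu>) n \<omega> = walk X n \<omega> - n * \<mu>" for n \<omega>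
    by (simp add: walk_def sum_subtractf)
  have "AE \<omega> in Bern Q. \<forall>\<^sub>F n in sequentially. walk (\<lambda>i. X i - \<mu>) n \<omega> \<le> c * lil_scale (real n)"
    using c by (intro lil_upper fin mean)
  moreover have "AE \<omega> in Bern Q. \<forall>\<^sub>F n in sequentially. walk (\<lambda>i. - (X i - \<mu>)) n \<omega> \<le> c * lil_scale (real n)"
    using c by (intro lil_upper fin mean') (simp_all only: power2_minus)
  ultimately show ?thesis
  proof eventually_elim
    case (elim \<omega>)
    have "\<forall>\<^sub>F n in sequentially. norm (walk X n \<omega> / n - \<mu>) \<le> c * lil_scale (real n) / n"
      using elim eventually_gt_at_top[of 0]
    proof eventually_elim
      case (elim n)
      then have "\<bar>walk X n \<omega> - n * \<mu>\<bar> \<le> c * lil_scale (real n)"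
        unfolding walk_uminus eq by simp
      moreover have "walk X n \<omega> / n - \<mu> = (walk X n \<omega> - n * \<mu>) / n"
        using \<open>0 < n\<close> by (simp add: field_simps)
      ultimately show ?case by (simp add: divide_right_mono)
    qed
    moreover have "(\<lambda>n. c * lil_scale (real n) / n) \<longlonglongrightarrow> 0"
      unfolding lil_scale_def using c(1) by real_asymp
    ultimately have "(\<lambda>n. walk X n \<omega> / n - \<mu>) \<longlonglongrightarrow> 0"
      by (rule Lim_null_comparison)
    then show ?case unfolding \<mu>_def[symmetric] by (simp add: LIM_zero_iff)
  qed
qed

section \<open>The lower half of the law of the iterated logarithm\<close>

text \<open>
  The coordinates of the product measure are independent copies of a letter, so the central limit theorem
  applies there; the distribution of the walk is then transported to streams.
\<close>

lemma weak_conv_walk: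
  fixes X :: "nat \<Rightarrow> real" and s :: real
  assumes fin: "finite (set_pmf Q)"
    and mean: "measure_pmf.expectation Q X = 0"
    and var: "measure_pmf.expectation Q (\<lambda>i. (X i)\<^sup>2) = s\<^sup>2" and "0 < s"
  shows "weak_conv_m (\<lambda>n. distr (Bern Q) borel (\<lambda>\<omega>. walk X n \<omega> / sqrt (n * s\<^sup>2))) std_normal_distribution"
proof -
  let ?P = "Pi\<^sub>M UNIV (\<lambda>_::nat. measure_pmf Q)"
  interpret product_prob_space "\<lambda>_::nat. measure_pmf Q" UNIV ..
  interpret P: prob_space ?P by (rule prob_space_PiM) (rule measure_pmf.prob_space_axioms)
  have comp: "distr ?P (measure_pmf Q) (\<lambda>f. f i) = measure_pmf Q" for i
    by (rule PiM_component) simp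
  have meas [measurable]: "(\<lambda>f. X (f i)) \<in> borel_measurable ?P" for i
    by (rule measurable_compose[OF measurable_component_singleton[of i]]) simp_all
  have int: "(\<integral>f. g (f i) \<partial>?P) = measure_pmf.expectation Q g" for g :: "nat \<Rightarrow> real" and i
  proof -
    have "(\<integral>f. g (f i) \<partial>?P) = (\<integral>x. g x \<partial>distr ?P (measure_pmf Q) (\<lambda>f. f i))"
      by (rule integral_distr[symmetric]) auto
    then show ?thesis by (simp add: comp)
  qed
  have "P.indep_vars (\<lambda>_. measure_pmf Q) (\<lambda>i f. f i) UNIV"
    by (subst P.indep_vars_iff_distr_eq_PiM) (simp_all add: comp restrict_def distr_id[unfolded id_def])
  then have indep: "P.indep_vars (\<lambda>_. borel) (\<lambda>i f. X (f i)) UNIV"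
    by (rule P.indep_vars_compose2) simp
  have distr: "distr ?P borel (\<lambda>f. X (f i)) = distr (measure_pmf Q) borel X" for i
  proof -
    have "distr (measure_pmf Q) borel X = distr (distr ?P (measure_pmf Q) (\<lambda>f. f i)) borel X"
      by (simp add: comp)
    also have "\<dots> = distr ?P borel (\<lambda>f. X (f i))"
      by (subst distr_distr) (auto simp: comp_def)
    finally show ?thesis by simp
  qed
  have integ: "integrable ?P (\<lambda>f. g (f i))" for g :: "nat \<Rightarrow> real" and i
  proof -
    have "integrable (distr ?P (measure_pmf Q) (\<lambda>f. f i)) g"
      by (simp add: comp integrable_measure_pmf_finite[OF fin])
    then show ?thesis by (subst (asm) integrable_distr_eq) auto
  qed
  have "weak_conv_m (\<lambda>n. distr ?P borel (\<lambda>f. (\<Sum>i<n. X (f i)) / sqrt (n * s\<^sup>2))) std_normal_distribution"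
  proof (rule P.central_limit_theorem_zero_mean[OF indep _ \<open>0 < s\<close> _ _ distr])
    show "P.expectation (\<lambda>f. X (f n)) = 0" for n using int[of X n] mean by simp
    show "integrable ?P (\<lambda>f. (X (f n))\<^sup>2)" for n using integ[of "\<lambda>i. (X i)\<^sup>2" n] .
    show "P.variance (\<lambda>f. X (f n)) = s\<^sup>2" for n
      using int[of X n] int[of "\<lambda>i. (X i)\<^sup>2" n] mean var by simp
  qed
  moreover have "distr ?P borel (\<lambda>f. (\<Sum>i<n. X (f i)) / sqrt (n * s\<^sup>2)) =
      distr (Bern Q) borel (\<lambda>\<omega>. walk X n \<omega> / sqrt (n * s\<^sup>2))" for n
  proof -
    have "distr (Bern Q) borel (\<lambda>\<omega>. walk X n \<omega> / sqrt (n * s\<^sup>2)) =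
      distr (distr ?P (Bern Q) to_stream) borel (\<lambda>\<omega>. walk X n \<omega> / sqrt (n * s\<^sup>2))"
      by (subst stream_space_eq_distr[symmetric]) simp
    also have "\<dots> = distr ?P borel ((\<lambda>\<omega>. walk X n \<omega> / sqrt (n * s\<^sup>2)) \<circ> to_stream)"
      by (rule distr_distr) measurable
    also have "((\<lambda>\<omega>. walk X n \<omega> / sqrt (n * s\<^sup>2)) \<circ> to_stream) = (\<lambda>f. (\<Sum>i<n. X (f i)) / sqrt (n * s\<^sup>2))"
      by (auto simp: walk_def to_stream_def)
    finally show ?thesis by simp
  qed
  ultimately show ?thesis by simp
qed

text \<open>
  On \<open>{y<..y + 1}\<close> the density is at least its value at \<open>y + 1\<close>. For large \<open>y\<close> the exponent
  \<open>(y + 1)\<^sup>2 / 2\<close> is as good as the sharp \<open>y\<^sup>2 / 2\<close>.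
\<close>

lemma std_normal_tail:
  assumes "0 \<le> y"
  shows "exp (- (y + 1)\<^sup>2 / 2) / 3 \<le> measure std_normal_distribution {y<..}"
proof -
  interpret real_distribution std_normal_distribution by (rule real_dist_normal_dist)
  have "2 * pi < 9" using pi_less_4 by simp
  then have "sqrt (2 * pi) < sqrt 9" by (rule real_sqrt_less_mono)
  then have s: "sqrt (2 * pi) \<le> 3" by simp
  have "ennreal (exp (- (y + 1)\<^sup>2 / 2) / 3) = (\<integral>\<^sup>+x. ennreal (exp (- (y + 1)\<^sup>2 / 2) / 3) * indicator {y<..y+1} x \<partial>lborel)"
    by (subst nn_integral_cmult_indicator) auto
  also have "\<dots> \<le> (\<integral>\<^sup>+x. ennreal (std_normal_density x) * indicator {y<..} x \<partial>lborel)"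
  proof (intro nn_integral_mono)
    fix x :: real
    have "exp (- (y + 1)\<^sup>2 / 2) / 3 \<le> std_normal_density x" if "y < x" "x \<le> y + 1"
    proof -
      have "x\<^sup>2 \<le> (y + 1)\<^sup>2" using that assms by (intro power_mono) auto
      then have "exp (- (y + 1)\<^sup>2 / 2) \<le> exp (- x\<^sup>2 / 2)" by simp
      moreover have "1 / 3 \<le> 1 / sqrt (2 * pi)" using s by (intro divide_left_mono) auto
      ultimately have "1 / 3 * exp (- (y + 1)\<^sup>2 / 2) \<le> 1 / sqrt (2 * pi) * exp (- x\<^sup>2 / 2)"
        by (intro mult_mono) auto
      then show ?thesis by (simp add: std_normal_density_def)
    qed
    then show "ennreal (exp (- (y + 1)\<^sup>2 / 2) / 3) * indicator {y<..y+1} x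
        \<le> ennreal (std_normal_density x) * indicator {y<..} x"
      by (auto split: split_indicator intro: ennreal_leI)
  qed
  also have "\<dots> = emeasure std_normal_distribution {y<..}"
    by (rule emeasure_density[symmetric]) auto
  finally show ?thesis by (simp add: emeasure_eq_measure)
qed

text \<open>
  The constant drops from \<open>1 / 3\<close> to \<open>1 / 4\<close> to leave room for the passage to the limit.
\<close>

lemma walk_tail_clt:
  fixes X :: "nat \<Rightarrow> real"
  assumes fin: "finite (set_pmf Q)"
    and mean: "measure_pmf.expectation Q X = 0"
    and var: "measure_pmf.expectation Q (\<lambda>i. (X i)\<^sup>2) = s\<^sup>2" and "0 < s" and "0 \<le> y"
  shows "\<forall>\<^sub>F n in sequentially.
    exp (- (y + 1)\<^sup>2 / 2) / 4 \<le> measure (Bern Q) {\<omega>. y * s * sqrt n \<le> walk X n \<omega>}"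
proof -
  interpret N: real_distribution std_normal_distribution by (rule real_dist_normal_dist)
  interpret prob_space "Bern Q" by (rule prob_space_Bern)
  let ?D = "\<lambda>n. distr (Bern Q) borel (\<lambda>\<omega>. walk X n \<omega> / sqrt (n * s\<^sup>2))"
  have meas: "(\<lambda>\<omega>. walk X n \<omega> / sqrt (n * s\<^sup>2)) \<in> borel_measurable (Bern Q)" for n by measurable
  have "N.prob {y} = 0"
    by (simp add: measure_def emeasure_density nn_integral_indicator_singleton')
  then have "isCont (cdf std_normal_distribution) y" by (simp add: N.isCont_cdf)
  then have "(\<lambda>n. cdf (?D n) y) \<longlonglongrightarrow> cdf std_normal_distribution y"
    using weak_conv_walk[OF fin mean var \<open>0 < s\<close>] by (simp add: weak_conv_m_def weak_conv_def)
  moreover have "cdf std_normal_distribution y < 1 - exp (- (y + 1)\<^sup>2 / 2) / 4"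
  proof -
    have "N.prob {y<..} = 1 - cdf std_normal_distribution y"
      using N.prob_compl[of "{..y}"] by (simp add: cdf_def Compl_eq_Diff_UNIV[symmetric])
    moreover have "exp (- (y + 1)\<^sup>2 / 2) / 4 < exp (- (y + 1)\<^sup>2 / 2) / 3" by (simp add: field_simps)
    ultimately show ?thesis using std_normal_tail[OF \<open>0 \<le> y\<close>] by linarith
  qed
  ultimately have "\<forall>\<^sub>F n in sequentially. cdf (?D n) y < 1 - exp (- (y + 1)\<^sup>2 / 2) / 4"
    by (rule order_tendstoD(2))
  then show ?thesis using eventually_gt_at_top[of 0]
  proof eventually_elim
    case (elim n)
    have "cdf (?D n) y = prob ((\<lambda>\<omega>. walk X n \<omega> / sqrt (n * s\<^sup>2)) -` {..y} \<inter> space (Bern Q))"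
      unfolding cdf_def by (intro measure_distr meas) auto
    also have "(\<lambda>\<omega>. walk X n \<omega> / sqrt (n * s\<^sup>2)) -` {..y} \<inter> space (Bern Q) = {\<omega>. walk X n \<omega> \<le> y * s * sqrt n}"
      using elim \<open>0 < s\<close> by (auto simp: real_sqrt_mult field_simps)
    finally have "prob {\<omega>. walk X n \<omega> \<le> y * s * sqrt n} < 1 - exp (- (y + 1)\<^sup>2 / 2) / 4"
      using elim by simp
    moreover have "{\<omega> \<in> space (Bern Q). walk X n \<omega> \<le> y * s * sqrt n} \<in> events"
       "{\<omega> \<in> space (Bern Q). y * s * sqrt n \<le> walk X n \<omega>} \<in> events" by measurable
    then have s: "{\<omega>. walk X n \<omega> \<le> y * s * sqrt n} \<in> events" "{\<omega>. y * s * sqrt n \<le> walk X n \<omega>} \<in> events"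
      by simp_all
    have "prob (space (Bern Q) - {\<omega>. walk X n \<omega> \<le> y * s * sqrt n}) \<le> prob {\<omega>. y * s * sqrt n \<le> walk X n \<omega>}"
      using s by (intro finite_measure_mono) auto
    ultimately show ?case using prob_compl[OF s(1)] by linarith
  qed
qed

text \<open>
  If each of \<open>j\<close> consecutive independent pieces of length \<open>m\<close> gains \<open>x\<close>, the whole walk gains \<open>j * x\<close>.
\<close>

lemma walk_tail_power:
  "measure (Bern Q) {\<omega>. x \<le> walk X m \<omega>} ^ j \<le> measure (Bern Q) {\<omega>. real j * x \<le> walk X (j * m) \<omega>}"
proof (induction j)
  case 0
  interpret prob_space "Bern Q" by (rule prob_space_Bern)
  show ?case using prob_space by simp
next
  case (Suc j)
  interpret prob_space "Bern Q" by (rule prob_space_Bern)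
  have s: "{\<omega>. y \<le> walk X n \<omega>} \<in> events" for y n
    using sets_Bern_stake[of "\<lambda>v. y \<le> sum_list (map X v)" n Q] by (simp add: walk_stake)
  have "prob {\<omega>. x \<le> walk X m \<omega>} ^ Suc j \<le> prob {\<omega>. x \<le> walk X m \<omega>} * prob {\<omega>. real j * x \<le> walk X (j * m) \<omega>}"
    using Suc by (simp add: mult_left_mono)
  also have "\<dots> = prob {\<omega>. x \<le> walk X m \<omega> \<and> real j * x \<le> walk X (j * m) (sdrop m \<omega>)}"
    using measure_Bern_split[OF s, of "\<lambda>v. x \<le> sum_list (map X v)" m] by (simp add: walk_stake)
  also have "\<dots> \<le> prob {\<omega>. real (Suc j) * x \<le> walk X (Suc j * m) \<omega>}"
    by (intro finite_measure_mono s) (auto simp: walk_add algebra_simps)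
  finally show ?case .
qed

text \<open>
  The second Borel--Cantelli lemma for events \<open>R k\<close> depending on disjoint blocks of letters: the \<open>k\<close>-th
  block starts at time \<open>T k\<close> and has length \<open>N k\<close>. By independence, none of the events with index in
  \<open>{K..<L}\<close> occurs with probability at most \<open>exp (- (\<Sum>k\<in>{K..<L}. p k))\<close>.
\<close>

lemma borel_cantelli_blocks:
  fixes R :: "nat \<Rightarrow> nat list \<Rightarrow> bool" and N :: "nat \<Rightarrow> nat"
  defines "T \<equiv> \<lambda>k. \<Sum>i<k. N i"
  assumes div: "\<not> summable (\<lambda>k. measure (Bern Q) {\<omega>. R k (stake (N k) \<omega>)})"
  shows "AE \<omega> in Bern Q. \<exists>\<^sub>F k in sequentially. R k (stake (N k) (sdrop (T k) \<omega>))"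
proof -
  interpret prob_space "Bern Q" by (rule prob_space_Bern)
  define p where "p k = prob {\<omega>. R k (stake (N k) \<omega>)}" for k
  define F where "F K L = {\<omega>. \<forall>k\<in>{K..<L}. \<not> R k (stake (N k) (sdrop (T k) \<omega>))}" for K L
  have T_mono: "T i \<le> T j" if "i \<le> j" for i j
    unfolding T_def using that by (intro sum_mono2) auto
  have F_stake: "F K L = {\<omega>. \<forall>k\<in>{K..<L}. \<not> R k (take (N k) (drop (T k) (stake (T L) \<omega>)))}" for K L
  proof -
    have "stake (N k) (sdrop (T k) \<omega>) = take (N k) (drop (T k) (stake (T L) \<omega>))" if "k < L" for k and \<omega> :: "nat stream"
    proof -
      have "T (Suc k) \<le> T L" using that by (intro T_mono) simp
      then have "N k \<le> T L - T k" by (simp add: T_def)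
      then show ?thesis by (simp add: drop_stake take_stake min_def)
    qed
    then show ?thesis unfolding F_def by (intro Collect_cong ball_cong refl) simp
  qed
  have F_sets: "F K L \<in> events" for K L
    unfolding F_stake by (rule sets_Bern_stake)
  have p: "0 \<le> p k" "p k \<le> 1" for k unfolding p_def by simp_all
  have F_prob: "prob (F K L) \<le> exp (- (\<Sum>k\<in>{K..<L}. p k))" if "K \<le> L" for K L
    using that
  proof (induction L rule: dec_induct)
    case base
    show ?case by simp
  next
    case (step L)
    let ?R = "\<lambda>v. \<forall>k\<in>{K..<L}. \<not> R k (take (N k) (drop (T k) v))"
    have "F K (Suc L) = F K L \<inter> {\<omega>. \<not> R L (stake (N L) (sdrop (T L) \<omega>))}"
      using step(1) unfolding F_def by (auto simp: less_Suc_eq)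
    also have "\<dots> = {\<omega>. ?R (stake (T L) \<omega>) \<and> \<not> R L (stake (N L) (sdrop (T L) \<omega>))}"
      unfolding F_stake by auto
    finally have "prob (F K (Suc L)) = prob (F K L) * prob {\<omega>. \<not> R L (stake (N L) \<omega>)}"
      using measure_Bern_split[OF sets_Bern_stake[of "\<lambda>v. \<not> R L v" "N L"], where R = ?R and n = "T L"]
      unfolding F_stake[of K L] by simp
    also have "prob {\<omega>. \<not> R L (stake (N L) \<omega>)} = 1 - p L"
      using prob_compl[OF sets_Bern_stake[of "R L" "N L"]] unfolding p_def
      by (simp add: set_diff_eq)
    also have "prob (F K L) * (1 - p L) \<le> exp (- (\<Sum>k\<in>{K..<L}. p k)) * exp (- p L)"
      using step(3) p(2)[of L] exp_ge_add_one_self[of "- p L"] by (intro mult_mono) auto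
    finally have "prob (F K (Suc L)) \<le> exp (- (\<Sum>k\<in>{K..<L}. p k)) * exp (- p L)" .
    then show ?case using step(1) by (simp flip: exp_add add: add.commute)
  qed
  have "prob (\<Inter>L. F K (K + L)) = 0" for K
  proof (rule ccontr)
    let ?c = "prob (\<Inter>L. F K (K + L))"
    assume "?c \<noteq> 0"
    then have c: "0 < ?c" using measure_nonneg[of "Bern Q" "\<Inter>L. F K (K + L)"] by linarith
    have bound: "(\<Sum>k<L. p (k + K)) \<le> - ln ?c" for L
    proof -
      have "?c \<le> prob (F K (K + L))" by (intro finite_measure_mono F_sets) auto
      also have "\<dots> \<le> exp (- (\<Sum>k\<in>{K..<K+L}. p k))" by (rule F_prob) simp
      finally have "ln ?c \<le> - (\<Sum>k\<in>{K..<K+L}. p k)" using c by (metis ln_exp ln_mono)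
      moreover have "(\<Sum>k\<in>{K..<K+L}. p k) = (\<Sum>k<L. p (k + K))"
        using sum.shift_bounds_nat_ivl[of p 0 K L] by (simp add: lessThan_atLeast0 add.commute)
      ultimately show ?thesis by simp
    qed
    have "summable (\<lambda>k. p (k + K))"
      by (rule summableI_nonneg_bounded[of _ "- ln ?c"]) (use p bound in auto)
    then have "summable p" by (subst (asm) summable_iff_shift)
    with div show False unfolding p_def by simp
  qed
  then have "AE \<omega> in Bern Q. \<omega> \<notin> (\<Inter>L. F K (K + L))" for K
    using F_sets by (intro AE_not_in) (auto simp: null_sets_def emeasure_eq_measure)
  then have "AE \<omega> in Bern Q. \<forall>K. \<omega> \<notin> (\<Inter>L. F K (K + L))"
    by (simp add: AE_all_countable)
  then show ?thesis
  proof eventually_elim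
    case (elim \<omega>)
    show ?case unfolding frequently_sequentially
    proof
      fix K
      from elim obtain L where "\<omega> \<notin> F K (K + L)" by blast
      then show "\<exists>k\<ge>K. R k (stake (N k) (sdrop (T k) \<omega>))" unfolding F_def by auto
    qed
  qed
qed

text \<open>
  The blocks have length \<open>N k = j k * a ^ k\<close> with \<open>j k\<close> of order \<open>ln k / L\<close>, so that \<open>ln (ln (N k))\<close> is about
  \<open>ln k\<close>. On each of the \<open>j k\<close> pieces of length \<open>a ^ k\<close> the central limit theorem makes a gain of \<open>y\<close>
  standard deviations have probability at least \<open>exp (- L)\<close>, where \<open>L = (y + 1)\<^sup>2 / 2 + ln 4\<close>. All pieces of
  block \<open>k\<close> gain that much with probability at least of order \<open>1 / k\<close>, whence this happens for infinitely many
  blocks. The total gain is then \<open>y / sqrt (2 * L)\<close> times the expected scale, a factor that tends to \<open>1\<close> for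
  \<open>y \<longlongrightarrow> \<infinity>\<close>. If \<open>a\<close> is large, the time \<open>T k\<close> before the block is small compared to \<open>N k\<close>, and by
  \<open>lil_upper\<close> for \<open>- X\<close> the walk cannot have lost too much by then.
\<close>

theorem lil_lower:
  fixes X :: "nat \<Rightarrow> real"
  assumes fin: "finite (set_pmf Q)"
    and mean: "measure_pmf.expectation Q X = 0"
    and var: "measure_pmf.expectation Q (\<lambda>i. (X i)\<^sup>2) = s\<^sup>2" and "0 < s"
    and c: "0 \<le> c" "c < s"
  shows "AE \<omega> in Bern Q. \<exists>\<^sub>F n in sequentially. c * lil_scale (real n) \<le> walk X n \<omega>"
proof -
  interpret prob_space "Bern Q" by (rule prob_space_Bern)
  define \<kappa> where "\<kappa> = c / s"
  have \<kappa>: "0 \<le> \<kappa>" "\<kappa> < 1" "c = \<kappa> * s" using c \<open>0 < s\<close> by (auto simp: \<kappa>_def)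
  obtain \<kappa>' where \<kappa>': "\<kappa> < \<kappa>'" "\<kappa>' < 1" using \<kappa>(2) dense by blast
  define Lf where "Lf y = (y + 1)\<^sup>2 / 2 + ln 4" for y :: real
  obtain y where y: "0 < y" "sqrt 2 * \<kappa>' < y / sqrt (Lf y)"
  proof -
    have "((\<lambda>y::real. y / sqrt ((y + 1)\<^sup>2 / 2 + ln 4)) \<longlongrightarrow> sqrt 2) at_top"
      by real_asymp (simp add: powr_half_sqrt real_sqrt_divide)
    moreover have "sqrt 2 * \<kappa>' < sqrt 2" using \<kappa>'(2) by simp
    ultimately have "\<forall>\<^sub>F y in at_top. sqrt 2 * \<kappa>' < y / sqrt ((y + 1)\<^sup>2 / 2 + ln 4)"
      by (rule order_tendstoD(1))
    then have "\<forall>\<^sub>F y in at_top. 0 < y \<and> sqrt 2 * \<kappa>' < y / sqrt (Lf y)"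
      unfolding Lf_def using eventually_gt_at_top[of 0] by (rule eventually_conj[rotated])
    from eventually_happens'[OF trivial_limit_at_top_linorder this] show ?thesis using that by blast
  qed
  define L where "L = Lf y"
  have "0 < L" unfolding L_def Lf_def by (intro add_nonneg_pos) auto
  have q: "exp (- (y + 1)\<^sup>2 / 2) / 4 = exp (- L)"
  proof -
    have "- L = - (y + 1)\<^sup>2 / 2 - ln 4" by (simp add: L_def Lf_def)
    then show ?thesis by (simp only: exp_diff) simp
  qed
  obtain a :: nat where a: "2 \<le> a"
    "2 * sqrt (2 * (1 / (real a - 1)) * (1 + 1 / (real a - 1))) + \<kappa> * (sqrt 2 * (1 + 1 / (real a - 1))) < sqrt 2 * \<kappa>'"
  proof -
    have "((\<lambda>a::nat. 2 * sqrt (2 * (1 / (real a - 1)) * (1 + 1 / (real a - 1))) + \<kappa> * (sqrt 2 * (1 + 1 / (real a - 1)))) \<longlongrightarrow> \<kappa> * sqrt 2) at_top"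
      by real_asymp (simp add: sqrt_def)
    moreover have "\<kappa> * sqrt 2 < sqrt 2 * \<kappa>'" using \<kappa>' by simp
    ultimately have "\<forall>\<^sub>F a in sequentially. 2 * sqrt (2 * (1 / (real a - 1)) * (1 + 1 / (real a - 1))) + \<kappa> * (sqrt 2 * (1 + 1 / (real a - 1))) < sqrt 2 * \<kappa>'"
      by (rule order_tendstoD(2))
    then have "\<forall>\<^sub>F a in sequentially. 2 \<le> a \<and> 2 * sqrt (2 * (1 / (real a - 1)) * (1 + 1 / (real a - 1))) + \<kappa> * (sqrt 2 * (1 + 1 / (real a - 1))) < sqrt 2 * \<kappa>'"
      using eventually_ge_at_top[of 2] by (rule eventually_conj[rotated])
    from eventually_happens'[OF trivial_limit_sequentially this] show ?thesis using that by blast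
  qed
  \<comment> \<open>bounds the ratio of the time before a block to its length\<close>
  define \<theta> where "\<theta> = 1 / (real a - 1)"
  have "0 < \<theta>" using a(1) by (simp add: \<theta>_def)
  have opt: "2 * sqrt (2 * \<theta> * (1 + \<theta>)) + \<kappa> * (sqrt 2 * (1 + \<theta>)) \<le> y / sqrt L"
    using a(2) y(2) unfolding \<theta>_def L_def by linarith
  define j where "j k = Suc (nat \<lfloor>ln (real k + 1) / L\<rfloor>)" for k
  define N where "N k = j k * a ^ k" for k
  define T where "T k = (\<Sum>i<k. N i)" for k
  have j_bounds: "ln (real k + 1) / L \<le> real (j k)" "real (j k) \<le> ln (real k + 1) / L + 1" for k
  proof -
    have "0 \<le> ln (real k + 1) / L" using \<open>0 < L\<close> by simp
    then show "ln (real k + 1) / L \<le> real (j k)" "real (j k) \<le> ln (real k + 1) / L + 1"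
      unfolding j_def by linarith+
  qed
  have j_mono: "j i \<le> j k" if "i \<le> k" for i k
    unfolding j_def using that \<open>0 < L\<close>
    by (intro Suc_le_mono[THEN iffD2] nat_mono floor_mono divide_right_mono) auto

  \<comment> \<open>all pieces of the block gain, with probability at least of order \<open>1 / k\<close>\<close>
  define R where "R k v \<longleftrightarrow> real (j k) * (y * s * sqrt (real (a ^ k))) \<le> sum_list (map X v)" for k v
  have "\<not> summable (\<lambda>k. prob {\<omega>. R k (stake (N k) \<omega>)})"
  proof
    assume "summable (\<lambda>k. prob {\<omega>. R k (stake (N k) \<omega>)})"
    moreover have "\<forall>\<^sub>F k in sequentially. norm (exp (- L) * inverse (real (Suc k))) \<le> prob {\<omega>. R k (stake (N k) \<omega>)}"
    proof -
      have "filterlim (\<lambda>k. a ^ k) at_top sequentially"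
        using a(1) by (intro filterlim_subseq strict_monoI) simp
      from eventually_compose_filterlim[OF walk_tail_clt[OF fin mean var \<open>0 < s\<close>, of y] this]
      have "\<forall>\<^sub>F k in sequentially. exp (- L) \<le> prob {\<omega>. y * s * sqrt (real (a ^ k)) \<le> walk X (a ^ k) \<omega>}"
        using y(1) unfolding q by simp
      then show ?thesis
      proof eventually_elim
        case (elim k)
        have "exp (- L) * inverse (real (Suc k)) = exp (- L * (ln (real k + 1) / L + 1))"
        proof -
          have "- L * (ln (real k + 1) / L + 1) = - L - ln (real k + 1)"
            using \<open>0 < L\<close> by (simp add: field_simps)
          then show ?thesis by (simp only: exp_diff) (simp add: field_simps)
        qed
        also have "\<dots> \<le> exp (- L * real (j k))"
          using j_bounds(2)[of k] \<open>0 < L\<close> by simp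
        also have "\<dots> = exp (- L) ^ j k"
          by (simp add: exp_of_nat_mult[symmetric] mult.commute)
        also have "\<dots> \<le> prob {\<omega>. y * s * sqrt (real (a ^ k)) \<le> walk X (a ^ k) \<omega>} ^ j k"
          using elim by (intro power_mono) auto
        also have "\<dots> \<le> prob {\<omega>. real (j k) * (y * s * sqrt (real (a ^ k))) \<le> walk X (j k * a ^ k) \<omega>}"
          by (rule walk_tail_power)
        also have "\<dots> = prob {\<omega>. R k (stake (N k) \<omega>)}"
          unfolding R_def N_def by (simp add: walk_stake)
        finally show ?case by simp
      qed
    qed
    ultimately have "summable (\<lambda>k. exp (- L) * inverse (real (Suc k)))"
      by (rule summable_comparison_test_ev[rotated])
    then have "summable (\<lambda>k. exp L * (exp (- L) * inverse (real (Suc k))))"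
      by (rule summable_mult)
    then have "summable (\<lambda>k. inverse (real (Suc k)))"
      by (simp add: exp_minus)
    then have "summable (\<lambda>k. inverse (real k))"
      by (subst (asm) summable_Suc_iff)
    then show False using not_summable_harmonic[where 'a=real] by simp
  qed
  from borel_cantelli_blocks[OF this]
  have "AE \<omega> in Bern Q. \<exists>\<^sub>F k in sequentially. R k (stake (N k) (sdrop (T k) \<omega>))"
    unfolding T_def .
  moreover
  \<comment> \<open>a crude bound suffices for the loss before the block, as the block starts early\<close>
  have "AE \<omega> in Bern Q. \<forall>\<^sub>F n in sequentially. walk (\<lambda>i. - X i) n \<omega> \<le> (2 * s) * lil_scale (real n)"
  proof (intro lil_upper fin)
    show "measure_pmf.expectation Q (\<lambda>i. - X i) = 0" using mean by simp
    show "measure_pmf.expectation Q (\<lambda>i. (- X i)\<^sup>2) < (2 * s)\<^sup>2"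
      using var \<open>0 < s\<close> by (simp add: power_mult_distrib)
  qed (use \<open>0 < s\<close> in simp)
  ultimately show ?thesis
  proof eventually_elim
    case (elim \<omega>)
    have N_pos: "1 \<le> N k" for k
    proof -
      have "1 * 1 \<le> j k * a ^ k" using a(1) by (intro mult_le_mono) (auto simp: j_def)
      then show ?thesis by (simp add: N_def)
    qed
    have T_ge: "k \<le> T k" for k
      using sum_mono[of "{..<k}" "\<lambda>_. 1" N] N_pos by (simp add: T_def)
    have T_lim: "filterlim T at_top sequentially"
      using T_ge by (intro filterlim_at_top_mono[OF filterlim_ident]) auto
    have T_le: "real (T k) \<le> \<theta> * real (N k)" for k
    proof -
      have "real (T k) = (\<Sum>i<k. real (j i) * real a ^ i)" by (simp add: T_def N_def)
      also have "\<dots> \<le> (\<Sum>i<k. real (j k) * real a ^ i)"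
        by (intro sum_mono mult_right_mono) (auto intro: j_mono)
      also have "\<dots> = real (j k) * ((real a ^ k - 1) / (real a - 1))"
        using a(1) by (simp add: sum_distrib_left[symmetric] geometric_sum)
      also have "\<dots> \<le> real (j k) * (real a ^ k / (real a - 1))"
        using a(1) by (intro mult_left_mono divide_right_mono) auto
      finally show ?thesis by (simp add: \<theta>_def N_def)
    qed
    have T_Suc: "T (Suc k) = T k + N k" for k by (simp add: T_def)
    have loglog: "\<forall>\<^sub>F k in sequentially. ln (ln ((1 + \<theta>) * real (N k))) \<le> (1 + \<theta>) * ln (real k + 1)"
    proof -
      have "1 < real a" using a(1) by simp
      then have "((\<lambda>k::nat. ln (ln ((1 + \<theta>) * ((ln (real k + 1) / L + 1) * real a ^ k))) / ln (real k + 1)) \<longlongrightarrow> 1) sequentially"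
        using \<open>0 < \<theta>\<close> \<open>0 < L\<close> by real_asymp
      then have "\<forall>\<^sub>F k in sequentially. ln (ln ((1 + \<theta>) * ((ln (real k + 1) / L + 1) * real a ^ k))) / ln (real k + 1) < 1 + \<theta>"
        using \<open>0 < \<theta>\<close> by (intro order_tendstoD(2)) auto
      moreover have "\<forall>\<^sub>F k in sequentially. exp 1 \<le> real k"
        using filterlim_real_sequentially by (auto simp: filterlim_at_top)
      ultimately show ?thesis using eventually_gt_at_top[of 0]
      proof eventually_elim
        case (elim k)
        have "1 * real k \<le> (1 + \<theta>) * real (N k)"
          using \<open>0 < \<theta>\<close> T_ge[of "Suc k"] T_Suc[of k] T_le[of k] by (simp add: algebra_simps)
        then have W: "exp 1 \<le> (1 + \<theta>) * real (N k)" using elim(2) by simp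
        have "real (N k) \<le> (ln (real k + 1) / L + 1) * real a ^ k"
          using j_bounds(2)[of k] by (simp add: N_def mult_right_mono)
        then have W2: "(1 + \<theta>) * real (N k) \<le> (1 + \<theta>) * ((ln (real k + 1) / L + 1) * real a ^ k)"
          using \<open>0 < \<theta>\<close> by (intro mult_left_mono) auto
        have "ln (ln ((1 + \<theta>) * real (N k))) \<le> ln (ln ((1 + \<theta>) * ((ln (real k + 1) / L + 1) * real a ^ k)))"
          using W W2 by (rule ln_ln_mono)
        also have "\<dots> \<le> (1 + \<theta>) * ln (real k + 1)"
          using elim(1,3) by (simp add: divide_less_eq)
        finally show ?case .
      qed
    qed
    have "\<forall>\<^sub>F k in sequentially. walk (\<lambda>i. - X i) (T k) \<omega> \<le> (2 * s) * lil_scale (real (T k))"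
      using elim(2) T_lim by (rule eventually_compose_filterlim)
    moreover have "\<forall>\<^sub>F k in sequentially. exp 1 \<le> real k"
      using filterlim_real_sequentially by (auto simp: filterlim_at_top)
    ultimately have ev: "\<forall>\<^sub>F k in sequentially. R k (stake (N k) (sdrop (T k) \<omega>)) \<longrightarrow>
        c * lil_scale (real (T (Suc k))) \<le> walk X (T (Suc k)) \<omega>"
      using loglog
    proof eventually_elim
      case (elim k)
      show ?case
      proof
        assume R: "R k (stake (N k) (sdrop (T k) \<omega>))"
        define G where "G = sqrt (real (N k) * ln (real k + 1))"
        let ?u = "(1 + \<theta>) * ln (real k + 1)"
        have e: "exp 1 \<le> real (T k)" using elim(2) T_ge[of k] by linarith
        have TS: "real (T k) \<le> real (T (Suc k))" "real (T (Suc k)) \<le> (1 + \<theta>) * real (N k)"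
          using T_le[of k] by (simp_all add: T_Suc algebra_simps)
        have ll: "ln (ln (real (T i))) \<le> ?u" if "exp 1 \<le> real (T i)" "real (T i) \<le> (1 + \<theta>) * real (N k)" for i
        proof -
          have "ln (ln (real (T i))) \<le> ln (ln ((1 + \<theta>) * real (N k)))"
            using that by (rule ln_ln_mono)
          with elim(3) show ?thesis by simp
        qed
        have u: "0 \<le> ?u" using \<open>0 < \<theta>\<close> by simp
        have l1: "lil_scale (real (T k)) \<le> sqrt (2 * \<theta> * (1 + \<theta>)) * G"
        proof -
          have "real (T k) * ln (ln (real (T k))) \<le> real (T k) * ?u"
            using e TS ll[of k] by (intro mult_left_mono) auto
          also have "\<dots> \<le> \<theta> * real (N k) * ?u" using T_le u by (intro mult_right_mono) auto
          finally have "2 * real (T k) * ln (ln (real (T k))) \<le> 2 * \<theta> * (1 + \<theta>) * (real (N k) * ln (real k + 1))"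
            by (simp add: algebra_simps)
          then show ?thesis unfolding lil_scale_def G_def real_sqrt_mult[symmetric]
            by (rule real_sqrt_le_mono)
        qed
        have l2: "lil_scale (real (T (Suc k))) \<le> (sqrt 2 * (1 + \<theta>)) * G"
        proof -
          have "real (T (Suc k)) * ln (ln (real (T (Suc k)))) \<le> real (T (Suc k)) * ?u"
            using e TS ll[of "Suc k"] by (intro mult_left_mono) auto
          also have "\<dots> \<le> (1 + \<theta>) * real (N k) * ?u" using TS u by (intro mult_right_mono) auto
          finally have "2 * real (T (Suc k)) * ln (ln (real (T (Suc k)))) \<le> 2 * (1 + \<theta>)\<^sup>2 * (real (N k) * ln (real k + 1))"
            by (simp add: algebra_simps power2_eq_square)
          then have "lil_scale (real (T (Suc k))) \<le> sqrt (2 * (1 + \<theta>)\<^sup>2 * (real (N k) * ln (real k + 1)))"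
            unfolding lil_scale_def by (rule real_sqrt_le_mono)
          then show ?thesis using \<open>0 < \<theta>\<close> by (simp add: real_sqrt_mult G_def)
        qed
        have G: "y / sqrt L * G \<le> real (j k) * (y * sqrt (real (a ^ k)))"
        proof -
          have "sqrt (ln (real k + 1) / L) \<le> sqrt (real (j k))"
            using j_bounds(1) by (rule real_sqrt_le_mono)
          then have "y * sqrt (real (N k)) * sqrt (ln (real k + 1) / L) \<le> y * sqrt (real (N k)) * sqrt (real (j k))"
            using y(1) by (intro mult_left_mono) auto
          moreover have "sqrt (real (N k)) * sqrt (real (j k)) = real (j k) * sqrt (real (a ^ k))"
            by (simp add: N_def real_sqrt_mult mult_ac)
          ultimately show ?thesis
            by (simp add: G_def real_sqrt_mult real_sqrt_divide mult_ac)
        qed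
        have "0 \<le> G" unfolding G_def by simp
        have "c * lil_scale (real (T (Suc k))) + 2 * s * lil_scale (real (T k))
            \<le> c * ((sqrt 2 * (1 + \<theta>)) * G) + 2 * s * (sqrt (2 * \<theta> * (1 + \<theta>)) * G)"
          using l1 l2 c(1) \<open>0 < s\<close> by (intro add_mono mult_left_mono) auto
        also have "\<dots> = s * G * (2 * sqrt (2 * \<theta> * (1 + \<theta>)) + \<kappa> * (sqrt 2 * (1 + \<theta>)))"
          unfolding \<kappa>(3) by (simp add: algebra_simps)
        also have "\<dots> \<le> s * G * (y / sqrt L)"
          using opt \<open>0 < s\<close> \<open>0 \<le> G\<close> by (intro mult_left_mono) auto
        also have "\<dots> = s * (y / sqrt L * G)" by simp
        also have "\<dots> \<le> s * (real (j k) * (y * sqrt (real (a ^ k))))"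
          using G \<open>0 < s\<close> by (intro mult_left_mono) auto
        also have "\<dots> \<le> walk X (N k) (sdrop (T k) \<omega>)"
          using R unfolding R_def walk_stake by (simp add: mult_ac)
        finally show "c * lil_scale (real (T (Suc k))) \<le> walk X (T (Suc k)) \<omega>"
          using elim(1) unfolding walk_uminus T_Suc walk_add by simp
      qed
    qed
    have "\<exists>\<^sub>F k in sequentially. c * lil_scale (real (T (Suc k))) \<le> walk X (T (Suc k)) \<omega>"
      using elim(1) ev by (rule frequently_mp[rotated])
    then show ?case
      unfolding frequently_sequentially
      by (meson T_ge le_trans le_SucI)
  qed
qed

section \<open>Similarities and words\<close>

text \<open>
  Up to a translation a similarity is linear and injective, hence onto in finite dimension.
\<close>

lemma similarity_ball_image:
  fixes f :: "'a::euclidean_space \<Rightarrow> 'a"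
  assumes "similarity c f" "0 < c"
  shows "ball (f x) (c * a) \<subseteq> f ` ball x a"
proof -
  define h where "h y = f y - f 0" for y
  have d: "dist (f x) (f y) = c * dist x y" for x y using assms(1) by (simp add: similarity_def)
  have "linear h"
    by (rule scaling_linear[of _ c]) (auto simp: h_def d[unfolded dist_norm] dist_norm)
  moreover have "inj h"
  proof (rule injI)
    fix x y assume "h x = h y"
    then have "dist (f x) (f y) = 0" by (simp add: h_def)
    then show "x = y" using d[of x y] \<open>0 < c\<close> by simp
  qed
  ultimately have "surj h" by (rule linear_inj_imp_surj)
  show ?thesis
  proof
    fix z assume z: "z \<in> ball (f x) (c * a)"
    obtain y where "z - f 0 = h y" using \<open>surj h\<close> by (metis surjD)
    then have "z = f y" by (simp add: h_def)
    then show "z \<in> f ` ball x a" using z d[of x y] \<open>0 < c\<close> by auto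
  qed
qed

definition word_map :: "(nat \<Rightarrow> 'a \<Rightarrow> 'a) \<Rightarrow> nat list \<Rightarrow> 'a \<Rightarrow> 'a" where
  "word_map S w = foldr (\<lambda>i g. S i \<circ> g) w id"

lemma word_map_simps [simp]:
  "word_map S [] = id" "word_map S (i # w) = S i \<circ> word_map S w"
  by (simp_all add: word_map_def)

lemma word_map_append: "word_map S (v @ w) = word_map S v \<circ> word_map S w"
  by (induction v) (simp_all add: comp_assoc)

definition word_weight :: "(nat \<Rightarrow> real) \<Rightarrow> nat list \<Rightarrow> real" where
  "word_weight c w = prod_list (map c w)"

lemma word_weight_simps [simp]:
  "word_weight c [] = 1" "word_weight c (i # w) = c i * word_weight c w"
  "word_weight c (v @ w) = word_weight c v * word_weight c w"
  by (simp_all add: word_weight_def)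

lemma prob_large_cball:
  fixes \<mu> :: "'a::euclidean_space measure"
  assumes "prob_space \<mu>" "sets \<mu> = sets borel" "0 < e"
  shows "\<forall>\<^sub>F n in sequentially. 1 - e \<le> measure \<mu> (cball 0 (real n))"
proof -
  interpret prob_space \<mu> by fact
  have sp: "space \<mu> = UNIV" using sets_eq_imp_space_eq[OF assms(2)] by simp
  have "(\<lambda>n. prob (cball 0 (real n))) \<longlonglongrightarrow> prob (\<Union>n. cball 0 (real n))"
    by (intro finite_Lim_measure_incseq) (auto simp: assms(2) incseq_def)
  moreover have "(\<Union>n. cball (0::'a) (real n)) = UNIV" using real_arch_simple by fastforce
  ultimately have "(\<lambda>n. prob (cball 0 (real n))) \<longlonglongrightarrow> 1" using prob_space sp by simp
  then have "\<forall>\<^sub>F n in sequentially. 1 - e < prob (cball 0 (real n))"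
    using \<open>0 < e\<close> by (intro order_tendstoD(1)) auto
  then show ?thesis by eventually_elim simp
qed

text \<open>
  The letters \<open>1..k\<close> are those of the iterated function system. The other natural numbers carry maps of
  the same kind as well, so that every sequence of letters has a code and no case distinctions arise.
\<close>

locale ifs =
  fixes k :: nat and S :: "nat \<Rightarrow> 'a::euclidean_space \<Rightarrow> 'a" and r :: "nat \<Rightarrow> real"
    and K :: "'a set" and rmin rmax :: real
  assumes sim: "\<And>i. similarity (r i) (S i)"
    and rmin: "0 < rmin" and r_bounds: "\<And>i. rmin \<le> r i" "\<And>i. r i \<le> rmax" and rmax: "rmax < 1"
    and attr: "attractor k S K"
    and S_K: "\<And>i. S i ` K \<subseteq> K"
begin

abbreviation Sw where "Sw \<equiv> word_map S"
abbreviation rw where "rw \<equiv> word_weight r"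

lemma r_pos: "0 < r i" using rmin r_bounds(1)[of i] by linarith

lemma rmax_pos: "0 < rmax" using r_pos[of 0] r_bounds(2)[of 0] by linarith

lemma rmin_less_1: "rmin < 1" using r_bounds[of 0] rmax by linarith

lemma rw_pos: "0 < rw w"
  by (induction w) (simp_all add: r_pos)

lemma rw_le: "rw w \<le> rmax ^ length w"
  by (induction w) (use r_pos r_bounds rmax_pos rw_pos in \<open>auto intro!: mult_mono simp: less_imp_le\<close>)

lemma rw_ge: "rmin ^ length w \<le> rw w"
  by (induction w) (use rmin r_pos r_bounds in \<open>auto intro!: mult_mono simp: less_imp_le\<close>)

lemma rw_le_1: "rw w \<le> 1"
  using rw_le[of w] power_le_one[of rmax "length w"] rmax rmax_pos by linarith

lemma similarity_Sw: "similarity (rw w) (Sw w)"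
  using sim by (induction w) (auto simp: similarity_def mult_ac)

lemma dist_Sw: "dist (Sw w x) (Sw w y) = rw w * dist x y"
  using similarity_Sw[of w] by (simp add: similarity_def)

lemma inj_Sw: "Sw w x = Sw w y \<longleftrightarrow> x = y"
proof -
  have "dist (Sw w x) (Sw w y) = 0 \<longleftrightarrow> dist x y = 0"
    using rw_pos[of w] by (simp only: dist_Sw mult_eq_0_iff) auto
  then show ?thesis by simp
qed

lemma continuous_S: "continuous_on A (S i)"
proof -
  have "(r i)-lipschitz_on A (S i)"
    using sim[of i] r_pos[of i] by (auto simp: lipschitz_on_def similarity_def)
  then show ?thesis by (rule lipschitz_on_continuous_on)
qed

lemma continuous_Sw: "continuous_on A (Sw w)"
proof -
  have "(rw w)-lipschitz_on A (Sw w)"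
    using rw_pos[of w] by (auto simp: lipschitz_on_def dist_Sw)
  then show ?thesis by (rule lipschitz_on_continuous_on)
qed

lemma Sw_K: "x \<in> K \<Longrightarrow> Sw w x \<in> K"
  using S_K by (induction w) auto

lemma compact_K: "compact K" and K_nonempty: "K \<noteq> {}" and K_eq: "K = (\<Union>i\<in>{1..k}. S i ` K)"
  using attr unfolding attractor_def by blast+

definition x0 where "x0 = (SOME x. x \<in> K)"

lemma x0_K: "x0 \<in> K"
  unfolding x0_def using K_nonempty by (simp add: some_in_eq)

definition Rad where "Rad = (SOME R. 0 < R \<and> K \<subseteq> cball x0 R)"

lemma Rad: "0 < Rad" and K_Rad: "x \<in> K \<Longrightarrow> dist x0 x \<le> Rad"
proof -
  obtain R where R: "\<forall>x\<in>K. dist x0 x \<le> R"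
    using compact_imp_bounded[OF compact_K] by (auto simp: bounded_any_center[where a=x0])
  then have "0 < max 1 R \<and> K \<subseteq> cball x0 (max 1 R)" by auto
  then have *: "0 < Rad \<and> K \<subseteq> cball x0 Rad" unfolding Rad_def by (rule someI)
  then show "0 < Rad" by simp
  show "x \<in> K \<Longrightarrow> dist x0 x \<le> Rad" using * by auto
qed

section \<open>The coding map\<close>

text \<open>
  The point with address \<open>\<omega>\<close>. The base point \<open>x0\<close> does not matter, as the maps \<open>Sw (stake n \<omega>)\<close> contract
  \<open>K\<close> to a point.
\<close>

definition coding :: "nat stream \<Rightarrow> 'a" where
  "coding \<omega> = lim (\<lambda>n. Sw (stake n \<omega>) x0)"

lemma rw_stake_lim: "(\<lambda>n. rw (stake n \<omega>)) \<longlonglongrightarrow> 0"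
proof (rule Lim_null_comparison)
  show "\<forall>\<^sub>F n in sequentially. norm (rw (stake n \<omega>)) \<le> rmax ^ n"
    using rw_le[of "stake _ \<omega>"] rw_pos[of "stake _ \<omega>"] by (auto simp: less_imp_le)
  show "(\<lambda>n. rmax ^ n) \<longlonglongrightarrow> 0" using rmax rmax_pos by (intro LIMSEQ_power_zero) auto
qed

lemma Sw_stake_add: "Sw (stake (n + m) \<omega>) x = Sw (stake n \<omega>) (Sw (stake m (sdrop n \<omega>)) x)"
  by (subst stake_add[symmetric]) (simp only: word_map_append comp_apply)

lemma tendsto_coding: "(\<lambda>n. Sw (stake n \<omega>) x0) \<longlonglongrightarrow> coding \<omega>"
proof -
  have "Cauchy (\<lambda>n. Sw (stake n \<omega>) x0)"
  proof (rule CauchyI')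
    fix e :: real assume "0 < e"
    have "(\<lambda>n. rw (stake n \<omega>) * Rad) \<longlonglongrightarrow> 0 * Rad" by (intro tendsto_mult rw_stake_lim tendsto_const)
    then have "\<forall>\<^sub>F n in sequentially. rw (stake n \<omega>) * Rad < e"
      using \<open>0 < e\<close> by (intro order_tendstoD(2)) auto
    then obtain N where N: "\<And>n. n \<ge> N \<Longrightarrow> rw (stake n \<omega>) * Rad < e" by (auto simp: eventually_sequentially)
    have "dist (Sw (stake m \<omega>) x0) (Sw (stake n \<omega>) x0) < e" if "N \<le> m" "m < n" for m n
    proof -
      have "n = m + (n - m)" using that by simp
      then have "Sw (stake n \<omega>) x0 = Sw (stake m \<omega>) (Sw (stake (n - m) (sdrop m \<omega>)) x0)"
        using Sw_stake_add[of m "n - m" \<omega> x0] by simp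
      then have "dist (Sw (stake m \<omega>) x0) (Sw (stake n \<omega>) x0) \<le> rw (stake m \<omega>) * Rad"
        using K_Rad[OF Sw_K[OF x0_K]] rw_pos[of "stake m \<omega>"] by (simp add: dist_Sw)
      with N[OF that(1)] show ?thesis by simp
    qed
    then show "\<exists>M. \<forall>m\<ge>M. \<forall>n>m. dist (Sw (stake m \<omega>) x0) (Sw (stake n \<omega>) x0) < e" by blast
  qed
  then have "convergent (\<lambda>n. Sw (stake n \<omega>) x0)" by (rule Cauchy_convergent)
  then show ?thesis unfolding coding_def by (simp add: convergent_LIMSEQ_iff)
qed

lemma coding_K: "coding \<omega> \<in> K"
  by (rule closed_sequentially[OF compact_imp_closed[OF compact_K] _ tendsto_coding]) (simp add: Sw_K x0_K)

text \<open>
  Hence the cylinder of a word \<open>w\<close> is coded into the piece \<open>Sw w ` K\<close>.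
\<close>

lemma coding_sdrop: "coding \<omega> = Sw (stake n \<omega>) (coding (sdrop n \<omega>))"
proof -
  have "(\<lambda>m. Sw (stake n \<omega>) (Sw (stake m (sdrop n \<omega>)) x0)) \<longlonglongrightarrow> Sw (stake n \<omega>) (coding (sdrop n \<omega>))"
    using continuous_on_tendsto_compose[OF continuous_Sw[of UNIV] tendsto_coding[of "sdrop n \<omega>"]] by simp
  moreover have "(\<lambda>m. Sw (stake n \<omega>) (Sw (stake m (sdrop n \<omega>)) x0)) \<longlonglongrightarrow> coding \<omega>"
    using LIMSEQ_ignore_initial_segment[OF tendsto_coding[of \<omega>], of n]
    by (simp add: Sw_stake_add add.commute[of _ n])
  ultimately show ?thesis using LIMSEQ_unique by blast
qed

lemma coding_Cons: "coding (i ## \<omega>) = S i (coding \<omega>)"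
proof -
  have "coding (i ## \<omega>) = Sw (stake (Suc 0) (i ## \<omega>)) (coding (sdrop (Suc 0) (i ## \<omega>)))"
    by (rule coding_sdrop)
  also have "\<dots> = S i (coding \<omega>)" by simp
  finally show ?thesis .
qed

lemma measurable_coding [measurable]: "coding \<in> borel_measurable (Bern Q)"
proof (rule borel_measurable_LIMSEQ_metric)
  show "(\<lambda>\<omega>. Sw (stake n \<omega>) x0) \<in> borel_measurable (Bern Q)" for n
    using measurable_compose[OF measurable_stake_Bern[of n Q], of "\<lambda>w. Sw w x0" borel] by simp
qed (rule tendsto_coding)

text \<open>
  Choose for each point of \<open>K\<close> a piece \<open>S i ` K\<close> that contains it, and a preimage in \<open>K\<close>; iterating the choice
  reads off an address.
\<close>

lemma coding_surj: "K \<subseteq> coding ` streams {1..k}"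
proof
  fix x assume "x \<in> K"
  have "\<forall>y\<in>K. \<exists>i z. i \<in> {1..k} \<and> z \<in> K \<and> y = S i z" using K_eq by blast
  then obtain i z where iz: "\<And>y. y \<in> K \<Longrightarrow> i y \<in> {1..k} \<and> z y \<in> K \<and> S (i y) (z y) = y" by metis
  define \<omega> where "\<omega> y = smap i (siterate z y)" for y
  have \<omega>_eq: "\<omega> y = i y ## \<omega> (z y)" for y
    unfolding \<omega>_def by (subst siterate.code) simp
  have it: "\<exists>y'\<in>K. y = Sw (stake n (\<omega> y)) y'" if "y \<in> K" for n y
    using that
  proof (induction n arbitrary: y)
    case (Suc n)
    have "z y \<in> K" using iz[OF Suc.prems] by simp
    from Suc.IH[OF this] obtain y' where "y' \<in> K" "z y = Sw (stake n (\<omega> (z y))) y'" by auto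
    then have "y = Sw (stake (Suc n) (\<omega> y)) y'"
      using iz[OF Suc.prems] by (subst \<omega>_eq) simp
    with \<open>y' \<in> K\<close> show ?case by blast
  qed auto
  have "(\<lambda>n. Sw (stake n (\<omega> x)) x0) \<longlonglongrightarrow> x"
  proof (rule metric_tendsto_imp_tendsto[OF tendsto_mult_left_zero[OF rw_stake_lim[of "\<omega> x"], of Rad]], rule always_eventually, rule allI)
    fix n
    obtain y where "y \<in> K" "x = Sw (stake n (\<omega> x)) y" using it[OF \<open>x \<in> K\<close>, of n] by auto
    then have "dist (Sw (stake n (\<omega> x)) x0) x = rw (stake n (\<omega> x)) * dist x0 y"
      by (metis dist_Sw)
    also have "\<dots> \<le> rw (stake n (\<omega> x)) * Rad"
      using K_Rad[OF \<open>y \<in> K\<close>] rw_pos by (intro mult_left_mono) (auto simp: less_imp_le)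
    finally show "dist (Sw (stake n (\<omega> x)) x0) x \<le> dist (rw (stake n (\<omega> x)) * Rad) 0"
      using rw_pos[of "stake n (\<omega> x)"] Rad by simp
  qed
  then have "coding (\<omega> x) = x" using tendsto_coding LIMSEQ_unique by blast
  moreover have "\<omega> x \<in> streams {1..k}"
  proof -
    have "(z ^^ n) x \<in> K" for n using \<open>x \<in> K\<close> iz by (induction n) auto
    then have "\<omega> x !! n \<in> {1..k}" for n using iz unfolding \<omega>_def by (simp add: snth_siterate)
    then show ?thesis by (simp add: streams_iff_snth)
  qed
  ultimately show "x \<in> coding ` streams {1..k}" by (metis imageI)
qed

section \<open>Uniqueness of the self-similar measure\<close>

text \<open>
  After \<open>n\<close> applications of self-similarity both measures are mixtures, with the same weights, of their
  images under the maps \<open>Sw w\<close> with \<open>length w = n\<close>. Up to \<open>e\<close>, such an image lives on \<open>Sw w ` B\<close>, so it charges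
  \<open>A\<close> only if it charges \<open>A'\<close> fully.
\<close>

lemma self_similar_compare:
  assumes p: "\<And>i. i \<in> {1..k} \<Longrightarrow> 0 \<le> p i" "(\<Sum>i=1..k. p i) = 1"
    and \<mu>: "self_similar_measure k p S \<mu>" and \<nu>: "self_similar_measure k p S \<nu>"
    and B: "B \<in> sets borel" "1 - e \<le> measure \<mu> B" "1 - e \<le> measure \<nu> B"
    and A: "A \<in> sets borel" "A' \<in> sets borel"
    and n: "\<And>w. length w = n \<Longrightarrow> Sw w ` B \<inter> A \<noteq> {} \<Longrightarrow> Sw w ` B \<subseteq> A'"
  shows "measure \<mu> A \<le> measure \<nu> A' + e"
  using A n
proof (induction n arbitrary: A A')
  case 0
  interpret \<mu>: prob_space \<mu> using \<mu> by (simp add: self_similar_measure_def)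
  interpret \<nu>: prob_space \<nu> using \<nu> by (simp add: self_similar_measure_def)
  have sets: "sets \<mu> = sets borel" "sets \<nu> = sets borel"
    using \<mu> \<nu> by (simp_all add: self_similar_measure_def)
  show ?case
  proof (cases "B \<inter> A = {}")
    case True
    have "\<mu>.prob (A \<union> B) = \<mu>.prob A + \<mu>.prob B"
      using True 0 B sets by (intro \<mu>.finite_measure_Union) auto
    with B(2) show ?thesis using \<mu>.prob_le_1[of "A \<union> B"] measure_nonneg[of \<nu> A'] by linarith
  next
    case False
    then have "B \<subseteq> A'" using 0(3)[of "[]"] by simp
    then have "\<nu>.prob B \<le> \<nu>.prob A'" using 0 sets by (intro \<nu>.finite_measure_mono) auto
    with B(3) show ?thesis using \<mu>.prob_le_1[of A] by linarith
  qed
next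
  case (Suc n)
  have meas: "S i -` C \<in> sets borel" if "C \<in> sets borel" for i and C :: "'a set"
    using measurable_sets[OF borel_measurable_continuous_onI[OF continuous_S] that] by simp
  have "measure \<mu> A = (\<Sum>i=1..k. p i * measure \<mu> (S i -` A))"
    using \<mu> Suc.prems(1) by (simp add: self_similar_measure_def)
  also have "\<dots> \<le> (\<Sum>i=1..k. p i * (measure \<nu> (S i -` A') + e))"
  proof (intro sum_mono mult_left_mono Suc.IH meas Suc.prems p)
    fix i w assume "length (w::nat list) = n" "Sw w ` B \<inter> S i -` A \<noteq> {}"
    then have "Sw (i # w) ` B \<subseteq> A'" by (intro Suc.prems(3)) auto
    then show "Sw w ` B \<subseteq> S i -` A'" by auto
  qed auto
  also have "\<dots> = measure \<nu> A' + e"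
    using \<nu> Suc.prems(2) p(2)
    by (simp add: self_similar_measure_def algebra_simps sum.distrib sum_distrib_left[symmetric])
  finally show ?case .
qed

text \<open>
  For large \<open>n\<close> the sets \<open>Sw w ` B\<close> are so small that those meeting \<open>C\<close> lie in a given neighbourhood \<open>D\<close>
  of \<open>C\<close>. The closed neighbourhoods shrink to \<open>C\<close>.
\<close>

lemma self_similar_closed_le:
  assumes p: "\<And>i. i \<in> {1..k} \<Longrightarrow> 0 \<le> p i" "(\<Sum>i=1..k. p i) = 1"
    and \<mu>: "self_similar_measure k p S \<mu>" and \<nu>: "self_similar_measure k p S \<nu>"
    and "closed C"
  shows "measure \<mu> C \<le> measure \<nu> C"
proof (cases "C = {}")
  case False
  interpret \<mu>: prob_space \<mu> using \<mu> by (simp add: self_similar_measure_def)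
  interpret \<nu>: prob_space \<nu> using \<nu> by (simp add: self_similar_measure_def)
  have sets: "sets \<mu> = sets borel" "sets \<nu> = sets borel"
    using \<mu> \<nu> by (simp_all add: self_similar_measure_def)
  define D where "D n = {x. infdist x C \<le> inverse (real (Suc n))}" for n
  have D_closed: "closed (D n)" for n
    unfolding D_def by (intro closed_Collect_le continuous_intros)
  have le: "measure \<mu> C \<le> measure \<nu> (D n) + e" if "0 < e" for n e
  proof -
    have "\<forall>\<^sub>F N in sequentially. 1 - e \<le> measure \<mu> (cball 0 (real N)) \<and> 1 - e \<le> measure \<nu> (cball 0 (real N))"
      using sets \<open>0 < e\<close> by (intro eventually_conj prob_large_cball) unfold_locales
    then obtain N where N: "1 - e \<le> measure \<mu> (cball 0 (real N))" "1 - e \<le> measure \<nu> (cball 0 (real N))"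
      by (auto simp: eventually_sequentially)
    have "(\<lambda>l. rmax ^ l * (2 * real N)) \<longlonglongrightarrow> 0 * (2 * real N)"
      using rmax rmax_pos by (intro tendsto_mult LIMSEQ_power_zero tendsto_const) auto
    then have "\<forall>\<^sub>F l in sequentially. rmax ^ l * (2 * real N) < inverse (real (Suc n))"
      by (intro order_tendstoD(2)) auto
    then obtain l where l: "rmax ^ l * (2 * real N) < inverse (real (Suc n))"
      by (auto simp: eventually_sequentially)
    show ?thesis
    proof (rule self_similar_compare[OF p \<mu> \<nu> _ N, where n = l])
      fix w :: "nat list" assume w: "length w = l" "Sw w ` cball 0 (real N) \<inter> C \<noteq> {}"
      then obtain x where x: "x \<in> cball 0 (real N)" "Sw w x \<in> C" by auto
      show "Sw w ` cball 0 (real N) \<subseteq> D n"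
      proof
        fix z assume "z \<in> Sw w ` cball 0 (real N)"
        then obtain y where y: "y \<in> cball 0 (real N)" "z = Sw w y" by auto
        have "infdist z C \<le> dist z (Sw w x)" using x by (intro infdist_le)
        also have "\<dots> = rw w * dist y x" by (simp add: y dist_Sw)
        also have "\<dots> \<le> rmax ^ l * (2 * real N)"
          using x y rw_le[of w] rw_pos[of w] w dist_triangle[of y x 0]
          by (intro mult_mono) (auto simp: dist_commute less_imp_le)
        finally show "z \<in> D n" using l by (simp add: D_def)
      qed
    qed (use D_closed \<open>closed C\<close> in auto)
  qed
  have "(\<lambda>n. measure \<nu> (D n)) \<longlonglongrightarrow> measure \<nu> (\<Inter>n. D n)"
  proof (intro \<nu>.finite_Lim_measure_decseq)
    show "range D \<subseteq> sets \<nu>" using D_closed sets by auto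
    show "decseq D" unfolding D_def decseq_def
      by (auto intro: order_trans simp: inverse_le_iff_le simp del: of_nat_Suc)
  qed
  moreover have "(\<Inter>n. D n) = C"
  proof
    show "C \<subseteq> (\<Inter>n. D n)" by (auto simp: D_def)
    show "(\<Inter>n. D n) \<subseteq> C"
    proof
      fix x assume "x \<in> (\<Inter>n. D n)"
      then have "infdist x C \<le> inverse (real (Suc n))" for n by (auto simp: D_def)
      then have "infdist x C \<le> 0"
        using LIMSEQ_le_const[OF LIMSEQ_inverse_real_of_nat, of "infdist x C"] by auto
      then have "infdist x C = 0" using infdist_nonneg[of x C] by linarith
      then show "x \<in> C" using \<open>closed C\<close> False by (simp add: in_closed_iff_infdist_zero)
    qed
  qed
  ultimately have lim: "(\<lambda>n. measure \<nu> (D n)) \<longlonglongrightarrow> measure \<nu> C" by simp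
  have "measure \<mu> C \<le> measure \<nu> C + e" if "0 < e" for e
    using LIMSEQ_le_const[OF tendsto_add[OF lim tendsto_const[of e]], of "measure \<mu> C"] le[OF that] by auto
  then show ?thesis by (rule field_le_epsilon)
qed simp

lemma self_similar_measure_unique:
  assumes p: "\<And>i. i \<in> {1..k} \<Longrightarrow> 0 \<le> p i" "(\<Sum>i=1..k. p i) = 1"
    and \<mu>: "self_similar_measure k p S \<mu>" and \<nu>: "self_similar_measure k p S \<nu>"
  shows "\<mu> = \<nu>"
proof (rule measure_eqI_generator_eq[where E = "Collect closed" and \<Omega> = UNIV and A = "\<lambda>_. UNIV"])
  interpret \<mu>: prob_space \<mu> using \<mu> by (simp add: self_similar_measure_def)
  interpret \<nu>: prob_space \<nu> using \<nu> by (simp add: self_similar_measure_def)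
  have sets: "sets \<mu> = sets borel" "sets \<nu> = sets borel"
    using \<mu> \<nu> by (simp_all add: self_similar_measure_def)
  show "Int_stable (Collect closed :: 'a set set)" by (auto simp: Int_stable_def)
  show "emeasure \<mu> X = emeasure \<nu> X" if "X \<in> Collect closed" for X
    using that self_similar_closed_le[OF p \<mu> \<nu>, of X] self_similar_closed_le[OF p \<nu> \<mu>, of X]
    by (simp add: \<mu>.emeasure_eq_measure \<nu>.emeasure_eq_measure antisym)
  show "sets \<mu> = sigma_sets UNIV (Collect closed)" "sets \<nu> = sigma_sets UNIV (Collect closed)"
    unfolding sets by (simp_all add: borel_eq_closed)
  show "emeasure \<mu> UNIV \<noteq> \<infinity>" by (rule \<mu>.emeasure_finite[unfolded infinity_ennreal_def[symmetric]])
qed auto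

text \<open>
  Shifting the address by one letter \<open>i\<close> applies \<open>S i\<close> to the point.
\<close>

lemma self_similar_coding:
  assumes Q: "set_pmf Q \<subseteq> {1..k}"
  shows "self_similar_measure k (pmf Q) S (distr (Bern Q) borel coding)"
proof -
  interpret prob_space "Bern Q" by (rule prob_space_Bern)
  have fin: "finite (set_pmf Q)" using Q finite_subset by blast
  have "measure (distr (Bern Q) borel coding) A =
      (\<Sum>i=1..k. pmf Q i * measure (distr (Bern Q) borel coding) (S i -` A))" if A: "A \<in> sets borel" for A
  proof -
    have meas: "S i -` A \<in> sets borel" for i
      using measurable_sets[OF borel_measurable_continuous_onI[OF continuous_S] A] by simp
    have pre: "coding -` B \<in> events" if "B \<in> sets borel" for B
      using measurable_sets[OF measurable_coding that, of Q] by simp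
    have D: "measure (distr (Bern Q) borel coding) B = prob (coding -` B)" if "B \<in> sets borel" for B
      using measure_distr[OF measurable_coding that, of Q] by simp
    have "emeasure (Bern Q) (coding -` A) = (\<integral>\<^sup>+i. emeasure (Bern Q) (coding -` (S i -` A)) \<partial>measure_pmf Q)"
      by (subst emeasure_Bern_Cons[OF pre[OF A]]) (simp add: coding_Cons vimage_def)
    also have "\<dots> = (\<integral>\<^sup>+i. ennreal (prob (coding -` (S i -` A))) \<partial>measure_pmf Q)"
      by (simp add: emeasure_eq_measure)
    also have "\<dots> = ennreal (measure_pmf.expectation Q (\<lambda>i. prob (coding -` (S i -` A))))"
      by (intro nn_integral_eq_integral integrable_measure_pmf_finite fin) auto
    also have "measure_pmf.expectation Q (\<lambda>i. prob (coding -` (S i -` A))) =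
       (\<Sum>i=1..k. pmf Q i *\<^sub>R prob (coding -` (S i -` A)))"
      using Q by (intro integral_measure_pmf) auto
    finally have "prob (coding -` A) = (\<Sum>i=1..k. pmf Q i *\<^sub>R prob (coding -` (S i -` A)))"
      by (simp add: emeasure_eq_measure sum_nonneg)
    then show ?thesis using A meas by (simp add: D)
  qed
  then show ?thesis
    unfolding self_similar_measure_def by (auto intro!: prob_space_distr)
qed

end

section \<open>Economical covers by cylinder sets\<close>

lemma sum_le_infsum_ennreal:
  fixes f :: "'b \<Rightarrow> ennreal"
  assumes "finite F" "F \<subseteq> A"
  shows "sum f F \<le> infsum f A"
proof -
  have "infsum f A = (SUP F\<in>{F. finite F \<and> F \<subseteq> A}. sum f F)"
    by (rule nonneg_infsum_complete) simp
  moreover have "sum f F \<le> (SUP F\<in>{F. finite F \<and> F \<subseteq> A}. sum f F)"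
    using assms by (intro SUP_upper) simp
  ultimately show ?thesis by simp
qed

lemma hausdorff_premeasure_eq_0:
  assumes "hausdorff_measure \<Psi> E = 0" "0 < \<eta>"
  shows "hausdorff_premeasure \<Psi> \<eta> E = 0"
proof -
  have "hausdorff_premeasure \<Psi> \<eta> E \<le> hausdorff_measure \<Psi> E"
    unfolding hausdorff_measure_eq_SUP using assms(2) by (intro SUP_upper) simp
  with assms(1) show ?thesis by simp
qed

lemma hausdorff_measure_mono:
  assumes "E \<subseteq> F"
  shows "hausdorff_measure \<Psi> E \<le> hausdorff_measure \<Psi> F"
proof -
  have "hausdorff_premeasure \<Psi> \<eta> E \<le> hausdorff_premeasure \<Psi> \<eta> F" for \<eta>
    unfolding hausdorff_premeasure_def
    by (rule Inf_superset_mono) (use assms in \<open>blast intro: order_trans\<close>)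
  then show ?thesis
    unfolding hausdorff_measure_eq_SUP by (intro SUP_subset_mono order_refl)
qed

text \<open>
  The cylinders of words none of which is a prefix of another one are disjoint.
\<close>

lemma prefix_free_weights:
  assumes "finite F"
    and antichain: "\<And>v w. v \<in> F \<Longrightarrow> w \<in> F \<Longrightarrow> prefix v w \<Longrightarrow> v = w"
  shows "(\<Sum>w\<in>F. word_weight (pmf Q) w) \<le> 1"
proof -
  interpret prob_space "Bern Q" by (rule prob_space_Bern)
  let ?C = "\<lambda>w. {\<omega>. stake (length w) \<omega> = w}"
  have "disjoint_family_on ?C F"
  proof (unfold disjoint_family_on_def, intro ballI impI)
    fix v w assume vw: "v \<in> F" "w \<in> F" "v \<noteq> w"
    show "?C v \<inter> ?C w = {}"
    proof (rule ccontr)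
      assume "?C v \<inter> ?C w \<noteq> {}"
      then obtain \<omega> where \<omega>: "stake (length v) \<omega> = v" "stake (length w) \<omega> = w" by auto
      then have "take (length v) w = v \<or> take (length w) v = w"
        by (metis min.cobounded1 min.commute min_def take_stake nat_le_linear)
      then have "prefix v w \<or> prefix w v" by (metis take_is_prefix)
      with antichain vw show False by blast
    qed
  qed
  then have "prob (\<Union>w\<in>F. ?C w) = (\<Sum>w\<in>F. prob (?C w))"
    using assms(1) by (intro finite_measure_finite_Union) (auto intro: sets_Bern_stake)
  also have "\<dots> = (\<Sum>w\<in>F. word_weight (pmf Q) w)"
    using emeasure_Bern_cylinder[of Q] prod_list_pmf_nonneg[of Q]
    by (simp add: measure_def word_weight_def)
  finally show ?thesis using prob_le_1[of "\<Union>w\<in>F. ?C w"] by linarith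
qed

context ifs
begin

abbreviation cover_ball :: "nat list \<Rightarrow> 'a set" where
  "cover_ball w \<equiv> cball (Sw w x0) (rw w * Rad)"

lemma coding_cover_ball: "coding \<omega> \<in> cover_ball (stake n \<omega>)"
proof -
  have "dist (Sw (stake n \<omega>) x0) (coding \<omega>) = rw (stake n \<omega>) * dist x0 (coding (sdrop n \<omega>))"
    by (subst coding_sdrop[of \<omega> n]) (rule dist_Sw)
  also have "\<dots> \<le> rw (stake n \<omega>) * Rad"
    using rw_pos[of "stake n \<omega>"] by (intro mult_left_mono K_Rad coding_K) simp
  finally show ?thesis by simp
qed

text \<open>
  Stop each \<open>\<omega> \<in> A\<close> at the first time after \<open>N\<close> at which its cylinder has mass at least \<open>g (rw w)\<close>. The words
  \<open>W N\<close> obtained in this way are prefix-free, so the sum of \<open>g (rw w)\<close> over them is at most \<open>1\<close>. The corresponding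
  balls cover \<open>coding ` A\<close>, and as \<open>\<Psi>\<close> is negligible compared to \<open>g\<close>, even at a dilated argument, their \<open>\<Psi>\<close>-sum
  is small. Balls are used rather than pieces of \<open>K\<close> since a cover must consist of sets of positive diameter.
\<close>

theorem economic_cover:
  fixes g \<Psi> :: "real \<Rightarrow> real"
  assumes freq: "\<And>\<omega>. \<omega> \<in> A \<Longrightarrow> \<exists>\<^sub>F n in sequentially. g (rw (stake n \<omega>)) \<le> word_weight (pmf Q) (stake n \<omega>)"
    and small: "\<And>c e. 0 < c \<Longrightarrow> 0 < e \<Longrightarrow> \<forall>\<^sub>F t in at_right 0. \<Psi> (c * t) \<le> e * g t"
  shows "\<exists>E\<in>sets borel. coding ` A \<subseteq> E \<and> hausdorff_measure \<Psi> E = 0"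
proof -
  define good where "good w \<longleftrightarrow> g (rw w) \<le> word_weight (pmf Q) w" for w
  define W where "W N = {w. N \<le> length w \<and> good w \<and> (\<forall>n. N \<le> n \<and> n < length w \<longrightarrow> \<not> good (take n w))}" for N
  define E where "E = (\<Inter>N. \<Union>w\<in>W N. cover_ball w)"
  have "E \<in> sets borel"
    unfolding E_def by (intro sets.countable_INT'' sets.countable_UN') auto
  moreover have "coding ` A \<subseteq> E"
  proof (clarsimp simp: E_def)
    fix \<omega> N assume "\<omega> \<in> A"
    then obtain n where "N \<le> n" "good (stake n \<omega>)"
      using freq[OF \<open>\<omega> \<in> A\<close>] by (auto simp: frequently_sequentially good_def)
    then have ex: "\<exists>n. N \<le> n \<and> good (stake n \<omega>)" by blast
    define n0 where "n0 = (LEAST n. N \<le> n \<and> good (stake n \<omega>))"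
    have n0: "N \<le> n0" "good (stake n0 \<omega>)" using LeastI_ex[OF ex] by (simp_all add: n0_def)
    have "\<not> good (stake n \<omega>)" if "N \<le> n" "n < n0" for n
      using not_less_Least[of n "\<lambda>n. N \<le> n \<and> good (stake n \<omega>)"] that by (simp add: n0_def)
    then have "stake n0 \<omega> \<in> W N" using n0 by (simp add: W_def take_stake min_def)
    then show "\<exists>w\<in>W N. dist (Sw w x0) (coding \<omega>) \<le> rw w * Rad"
      using coding_cover_ball[of \<omega> n0] by (intro bexI[of _ "stake n0 \<omega>"]) auto
  qed
  moreover
  have le: "hausdorff_premeasure \<Psi> \<eta> E \<le> ennreal e" if "0 < \<eta>" "0 < e" for \<eta> e
  proof -
    have "\<forall>\<^sub>F t in at_right 0. \<Psi> (2 * Rad * t) \<le> e * g t"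
      using Rad \<open>0 < e\<close> by (intro small) auto
    then obtain t0 where t0: "0 < t0" "\<And>t. 0 < t \<Longrightarrow> t < t0 \<Longrightarrow> \<Psi> (2 * Rad * t) \<le> e * g t"
      by (auto simp: eventually_at_right_field)
    have "\<forall>\<^sub>F N in sequentially. rmax ^ N < min t0 (\<eta> / (2 * Rad))"
      using rmax rmax_pos Rad \<open>0 < \<eta>\<close> t0(1)
      by (intro order_tendstoD(2)[OF LIMSEQ_power_zero]) auto
    then obtain N where N: "rmax ^ N < t0" "rmax ^ N < \<eta> / (2 * Rad)" by (auto simp: eventually_sequentially)
    have rwN: "rw w \<le> rmax ^ N" if "w \<in> W N" for w
    proof -
      have "rmax ^ length w \<le> rmax ^ N" using that rmax rmax_pos by (intro power_decreasing) (auto simp: W_def)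
      then show ?thesis using rw_le[of w] by linarith
    qed
    define U where "U i = cover_ball (from_nat i :: nat list)" for i
    have diam: "diameter (cover_ball w) = 2 * Rad * rw w" for w
      using mult_pos_pos[OF rw_pos[of w] Rad] by simp
    have "hausdorff_premeasure \<Psi> \<eta> E \<le> (\<Sum>\<^sub>\<infinity>i\<in>to_nat ` W N. ennreal (\<Psi> (diameter (U i))))"
      unfolding hausdorff_premeasure_def
    proof (rule Inf_lower, rule CollectI, intro exI[of _ "to_nat ` W N"] exI[of _ U] conjI ballI)
      show "(\<Sum>\<^sub>\<infinity>i\<in>to_nat ` W N. ennreal (\<Psi> (diameter (U i)))) =
          (\<Sum>\<^sub>\<infinity>i\<in>to_nat ` W N. ennreal (\<Psi> (diameter (U i))))" by (rule refl)
      show "E \<subseteq> (\<Union>i\<in>to_nat ` W N. U i)" unfolding E_def U_def by auto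
      fix i assume "i \<in> to_nat ` W N"
      then obtain w where w: "w \<in> W N" "i = to_nat w" by auto
      have Ui: "U i = cover_ball w" by (simp add: U_def w)
      show "bounded (U i)" by (simp add: Ui)
      show "0 < diameter (U i)" unfolding Ui diam using Rad rw_pos by simp
      have "2 * Rad * rw w \<le> 2 * Rad * rmax ^ N" using Rad rwN[OF w(1)] by simp
      also have "\<dots> \<le> \<eta>" using N(2) Rad by (simp add: field_simps)
      finally show "diameter (U i) \<le> \<eta>" unfolding Ui diam .
    qed
    also have "\<dots> = infsum ((\<lambda>i. ennreal (\<Psi> (diameter (U i)))) \<circ> to_nat) (W N)"
      by (rule infsum_reindex) (rule inj_on_subset[OF inj_to_nat subset_UNIV])
    also have "\<dots> = (\<Sum>\<^sub>\<infinity>w\<in>W N. ennreal (\<Psi> (2 * Rad * rw w)))"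
      by (rule infsum_cong) (simp only: comp_apply U_def from_nat_to_nat diam)
    also have "\<dots> \<le> ennreal e"
    proof (rule infsum_le_finite_sums)
      fix F assume F: "finite F" "F \<subseteq> W N"
      have "(\<Sum>w\<in>F. ennreal (\<Psi> (2 * Rad * rw w))) \<le> (\<Sum>w\<in>F. ennreal (e * word_weight (pmf Q) w))"
      proof (intro sum_mono ennreal_leI)
        fix w assume "w \<in> F"
        then have w: "w \<in> W N" using F by auto
        then have "\<Psi> (2 * Rad * rw w) \<le> e * g (rw w)"
          using rwN[OF w] N(1) rw_pos[of w] by (intro t0) auto
        also have "\<dots> \<le> e * word_weight (pmf Q) w"
          using w \<open>0 < e\<close> by (intro mult_left_mono) (auto simp: W_def good_def)
        finally show "\<Psi> (2 * Rad * rw w) \<le> e * word_weight (pmf Q) w" .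
      qed
      also have "\<dots> = ennreal (e * (\<Sum>w\<in>F. word_weight (pmf Q) w))"
        using \<open>0 < e\<close> prod_list_pmf_nonneg[of Q]
        by (subst sum_ennreal) (auto simp: word_weight_def sum_distrib_left)
      also have "\<dots> \<le> ennreal (e * 1)"
      proof (intro ennreal_leI mult_left_mono prefix_free_weights F)
        fix v w assume vw: "v \<in> F" "w \<in> F" "prefix v w"
        show "v = w"
        proof (rule ccontr)
          assume "v \<noteq> w"
          then have "length v < length w" using vw(3) by (metis prefix_length_less strict_prefixI)
          moreover have "take (length v) w = v" using vw(3) by (metis append_eq_conv_conj prefix_def)
          moreover have "v \<in> W N" "w \<in> W N" using vw F(2) by auto
          ultimately show False unfolding W_def by (metis (mono_tags, lifting) mem_Collect_eq)
        qed
      qed (use \<open>0 < e\<close> in auto)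
      finally show "(\<Sum>w\<in>F. ennreal (\<Psi> (2 * Rad * rw w))) \<le> ennreal e" by simp
    qed (simp add: nonneg_summable_on_complete)
    finally show ?thesis .
  qed
  then have "hausdorff_premeasure \<Psi> \<eta> E = 0" if "0 < \<eta>" for \<eta>
  proof -
    have "hausdorff_premeasure \<Psi> \<eta> E \<le> 0"
    proof (rule ennreal_le_epsilon)
      fix e :: real assume "0 < e"
      with \<open>0 < \<eta>\<close> show "hausdorff_premeasure \<Psi> \<eta> E \<le> 0 + ennreal e" using le by simp
    qed
    then show ?thesis by simp
  qed
  then have "hausdorff_measure \<Psi> E = 0"
    unfolding hausdorff_measure_eq_SUP by (intro antisym SUP_least) auto
  ultimately show ?thesis by blast
qed

end

section \<open>Bounded overlap and the mass distribution principle\<close>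

locale ifs_osc = ifs +
  assumes osc: "open_set_condition k S"
begin

text \<open>
  The words at which the contraction ratio first drops to \<open>\<rho>\<close>: their pieces have size comparable to \<open>\<rho>\<close>,
  by \<open>cut_rw_gt\<close>.
\<close>

definition cut :: "real \<Rightarrow> nat list set" where
  "cut \<rho> = {w \<in> lists {1..k}. w \<noteq> [] \<and> rw w \<le> \<rho> \<and> \<rho> < rw (butlast w)}"

lemma rw_append_le: "rw (v @ w) \<le> rw v"
  using rw_le_1[of w] rw_pos[of v] by (simp add: mult_left_le)

lemma cut_rw_gt: "w \<in> cut \<rho> \<Longrightarrow> rmin * \<rho> < rw w"
proof -
  assume w: "w \<in> cut \<rho>"
  have "rw w = rw (butlast w @ [last w])" using w by (simp add: cut_def del: word_weight_simps)
  then have "rw w = rw (butlast w) * r (last w)" by (simp only: word_weight_simps mult_1_right)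
  moreover have "\<rho> * rmin < rw (butlast w) * rmin" using w rmin by (simp add: cut_def)
  moreover have "rw (butlast w) * rmin \<le> rw (butlast w) * r (last w)"
    using r_bounds(1) rw_pos[of "butlast w"] by (intro mult_left_mono) auto
  ultimately show ?thesis by (simp add: mult.commute)
qed

lemma cut_stake:
  assumes "\<omega> \<in> streams {1..k}" "0 < \<rho>" "\<rho> < 1"
  obtains n where "stake n \<omega> \<in> cut \<rho>"
proof -
  have "\<forall>\<^sub>F n in sequentially. rw (stake n \<omega>) < \<rho>"
    using rw_stake_lim assms(2) by (rule order_tendstoD(2))
  then have ex: "\<exists>n. rw (stake n \<omega>) \<le> \<rho>" by (auto simp: eventually_sequentially intro: less_imp_le)
  define n where "n = (LEAST n. rw (stake n \<omega>) \<le> \<rho>)"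
  have n: "rw (stake n \<omega>) \<le> \<rho>" unfolding n_def using ex by (rule LeastI_ex)
  with assms(3) have "n \<noteq> 0" by (intro notI) simp
  then obtain m where m: "n = Suc m" by (cases n) auto
  then have "\<not> rw (stake m \<omega>) \<le> \<rho>" using not_less_Least[of m "\<lambda>n. rw (stake n \<omega>) \<le> \<rho>"] by (simp add: n_def)
  moreover have "butlast (stake n \<omega>) = stake m \<omega>" unfolding m stake_Suc by simp
  moreover have "stake n \<omega> \<in> lists {1..k}"
    using assms(1) by (auto simp: in_set_conv_nth streams_iff_snth)
  ultimately have "stake n \<omega> \<in> cut \<rho>" using n m by (simp add: cut_def)
  then show ?thesis by (rule that)
qed

lemma cut_antichain:
  assumes "v \<in> cut \<rho>" "w \<in> cut \<rho>" "v \<noteq> w"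
  shows "v \<parallel> w"
proof -
  have *: "\<not> strict_prefix v w" if vw: "v \<in> cut \<rho>" "w \<in> cut \<rho>" for v w
  proof
    assume "strict_prefix v w"
    then have "prefix v (butlast w)"
      by (metis append_butlast_last_id prefix_order.dual_order.strict_iff_order prefix_snoc strict_prefix_simps(1))
    then obtain u where "butlast w = v @ u" by (auto simp: prefix_def)
    then have "rw (butlast w) \<le> rw v" using rw_append_le by metis
    then show False using vw by (simp add: cut_def)
  qed
  show ?thesis using *[of v w] *[of w v] assms by (auto simp: parallel_def strict_prefix_def)
qed

text \<open>
  Fix a ball \<open>ball v0 a\<close> inside the open set \<open>V\<close>. For distinct words \<open>v\<close>, \<open>w\<close> of the cut the images of \<open>V\<close> are
  disjoint, hence \<open>Sw v v0\<close> is outside \<open>ball (Sw w v0) (rw w * a)\<close>: the points \<open>Sw w v0\<close> are separated by a multiple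
  of \<open>\<rho>\<close>. If the pieces meet \<open>U\<close>, these points also lie within a multiple of \<open>\<rho>\<close> from \<open>u\<close>. After rescaling by
  \<open>1 / \<rho>\<close>, total boundedness of one fixed ball bounds their number.
\<close>

theorem bounded_overlap:
  obtains M :: nat where
    "\<And>\<rho> u U. 0 < \<rho> \<Longrightarrow> u \<in> U \<Longrightarrow> (\<And>x y. x \<in> U \<Longrightarrow> y \<in> U \<Longrightarrow> dist x y \<le> \<rho>) \<Longrightarrow>
      finite {w \<in> cut \<rho>. Sw w ` K \<inter> U \<noteq> {}} \<and> card {w \<in> cut \<rho>. Sw w ` K \<inter> U \<noteq> {}} \<le> M"
proof -
  obtain V where V: "V \<noteq> {}" "open V" "\<And>i. i \<in> {1..k} \<Longrightarrow> S i ` V \<subseteq> V"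
    "\<And>i j. i \<in> {1..k} \<Longrightarrow> j \<in> {1..k} \<Longrightarrow> i \<noteq> j \<Longrightarrow> S i ` V \<inter> S j ` V = {}"
  proof -
    from osc obtain V where 1: "V \<noteq> {}" "open V" and V': "(\<Union>i\<in>{1..k}. S i ` V) \<subseteq> V"
      "\<forall>i\<in>{1..k}. \<forall>j\<in>{1..k}. i \<noteq> j \<longrightarrow> S i ` V \<inter> S j ` V = {}"
      unfolding open_set_condition_def by blast
    have 2: "S i ` V \<subseteq> V" if "i \<in> {1..k}" for i using V'(1) that by blast
    have 3: "S i ` V \<inter> S j ` V = {}" if "i \<in> {1..k}" "j \<in> {1..k}" "i \<noteq> j" for i j
      using V'(2) that by blast
    show ?thesis by (rule that[OF 1 2 3])
  qed
  obtain v0 where "v0 \<in> V" using V(1) by blast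
  obtain a where a: "0 < a" "ball v0 a \<subseteq> V" using V(2) \<open>v0 \<in> V\<close> by (auto simp: open_contains_ball)
  have SwV: "Sw w ` V \<subseteq> V" if "w \<in> lists {1..k}" for w
    using that
  proof (induction w)
    case (Cons i w)
    then have "S i ` (Sw w ` V) \<subseteq> S i ` V" "S i ` V \<subseteq> V" using V(3) by (auto simp del: atLeastAtMost_iff)
    then show ?case by (auto simp: image_comp)
  qed simp
  obtain D where D: "0 \<le> D" "\<And>y. y \<in> K \<Longrightarrow> dist v0 y \<le> D"
  proof -
    obtain D where "\<forall>y\<in>K. dist v0 y \<le> D"
      using compact_imp_bounded[OF compact_K] by (auto simp: bounded_any_center[where a=v0])
    then show ?thesis by (intro that[of "max 0 D"]) auto
  qed
  have sep: "rmin * \<rho> * a < dist (Sw w v0) (Sw v v0)" if vw: "v \<in> cut \<rho>" "w \<in> cut \<rho>" "v \<noteq> w" for v w \<rho>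
  proof -
    obtain u i v' j w' where dec: "i \<noteq> j" "v = u @ i # v'" "w = u @ j # w'"
      using parallel_decomp[OF cut_antichain[OF vw]] by blast
    have lists: "i \<in> {1..k}" "j \<in> {1..k}" "v' \<in> lists {1..k}" "w' \<in> lists {1..k}"
      using vw by (auto simp: cut_def dec)
    have "Sw v v0 \<notin> Sw w ` V"
    proof
      assume "Sw v v0 \<in> Sw w ` V"
      then obtain x where "x \<in> V" "Sw v v0 = Sw w x" by auto
      then have "S i (Sw v' v0) = S j (Sw w' x)"
        by (simp add: dec word_map_append inj_Sw)
      moreover have "Sw v' v0 \<in> V" "Sw w' x \<in> V" using SwV lists \<open>v0 \<in> V\<close> \<open>x \<in> V\<close> by blast+
      ultimately show False using V(4)[OF lists(1,2) dec(1)] by blast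
    qed
    moreover have "ball (Sw w v0) (rw w * a) \<subseteq> Sw w ` V"
      using similarity_ball_image[OF similarity_Sw rw_pos, of w v0 a] a(2) by blast
    ultimately have "rw w * a \<le> dist (Sw w v0) (Sw v v0)" by (auto simp: not_less)
    moreover have "rmin * \<rho> * a < rw w * a" using cut_rw_gt[OF vw(2)] a(1) by simp
    ultimately show ?thesis by linarith
  qed
  have "0 < rmin * a / 2" using rmin a by simp
  have "compact (cball (0::'a) (D + 1))" by simp
  then obtain Z where Z: "finite Z" "cball (0::'a) (D + 1) \<subseteq> (\<Union>z\<in>Z. ball z (rmin * a / 2))"
    using \<open>0 < rmin * a / 2\<close> unfolding compact_eq_totally_bounded by metis
  show ?thesis
  proof (rule that[of "card Z"])
    fix \<rho> and u :: 'a and U assume \<rho>: "0 < \<rho>" and u: "u \<in> U" and U: "\<And>x y. x \<in> U \<Longrightarrow> y \<in> U \<Longrightarrow> dist x y \<le> \<rho>"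
    define F where "F = {w \<in> cut \<rho>. Sw w ` K \<inter> U \<noteq> {}}"
    \<comment> \<open>each ball of the finite cover contains at most one rescaled point\<close>
    define h where "h w = (1 / \<rho>) *\<^sub>R (Sw w v0 - u)" for w
    have "\<exists>z\<in>Z. dist z (h w) < rmin * a / 2" if "w \<in> F" for w
    proof -
      obtain y where y: "y \<in> K" "Sw w y \<in> U" using \<open>w \<in> F\<close> by (auto simp: F_def)
      have "dist (Sw w v0) u \<le> dist (Sw w v0) (Sw w y) + dist (Sw w y) u" by (rule dist_triangle)
      also have "\<dots> \<le> \<rho> * D + \<rho>"
        using D y U[OF y(2) u] \<open>w \<in> F\<close> rw_pos[of w] unfolding dist_Sw
        by (intro add_mono mult_mono) (auto simp: F_def cut_def)
      finally have "dist (Sw w v0) u \<le> (D + 1) * \<rho>" by (simp add: algebra_simps)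
      moreover have "norm (h w) = dist (Sw w v0) u / \<rho>"
        using \<rho> by (simp add: h_def dist_norm)
      ultimately have "norm (h w) \<le> D + 1" using \<rho> by (simp add: divide_le_eq)
      then have "h w \<in> cball 0 (D + 1)" by simp
      then have "h w \<in> (\<Union>z\<in>Z. ball z (rmin * a / 2))" using Z(2) by blast
      then show ?thesis by auto
    qed
    then obtain z where z: "\<And>w. w \<in> F \<Longrightarrow> z w \<in> Z \<and> dist (z w) (h w) < rmin * a / 2" by metis
    have "inj_on z F"
    proof (rule inj_onI, rule ccontr)
      fix v w assume vw: "v \<in> F" "w \<in> F" "z v = z w" "v \<noteq> w"
      have "dist (h w) (h v) < rmin * a"
        using z[OF vw(1)] z[OF vw(2)] vw(3) dist_triangle2[of "h w" "h v" "z w"]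
        by (simp add: dist_commute)
      moreover have "dist (h w) (h v) = dist (Sw w v0) (Sw v v0) / \<rho>"
      proof -
        have "h w - h v = (1 / \<rho>) *\<^sub>R (Sw w v0 - Sw v v0)" unfolding h_def by (simp flip: scaleR_diff_right)
        then show ?thesis using \<rho> by (simp add: dist_norm)
      qed
      ultimately have "dist (Sw w v0) (Sw v v0) < rmin * \<rho> * a" using \<rho> by (simp add: field_simps)
      moreover have "rmin * \<rho> * a < dist (Sw w v0) (Sw v v0)" using vw by (intro sep) (auto simp: F_def)
      ultimately show False by linarith
    qed
    moreover have "z ` F \<subseteq> Z" using z by auto
    ultimately show "finite {w \<in> cut \<rho>. Sw w ` K \<inter> U \<noteq> {}} \<and> card {w \<in> cut \<rho>. Sw w ` K \<inter> U \<noteq> {}} \<le> card Z"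
      unfolding F_def[symmetric] using Z(1) by (meson card_inj_on_le inj_on_finite)
  qed
qed

text \<open>
  A set \<open>U\<close> of diameter \<open>\<rho>\<close> meets at most \<open>M\<close> pieces of the cut at \<open>\<rho>\<close>, and a cylinder that meets \<open>A\<close>
  has mass at most \<open>C * \<Psi> \<rho>\<close>. Thus the part of \<open>A\<close> coded into \<open>U\<close> has mass at most \<open>M * C * \<Psi> \<rho>\<close>, and
  summing over a cover of \<open>E\<close> gives a bound by its \<open>\<Psi>\<close>-sum. The sets of the cover need not be measurable,
  so each is replaced by the finite union \<open>B\<close> of cylinders.
\<close>

theorem mass_distribution:
  fixes g \<Psi> :: "real \<Rightarrow> real" and N :: nat
  assumes A: "A \<in> sets (Bern Q)" "A \<subseteq> streams {1..k}"
    and bound: "\<And>\<omega> n. \<omega> \<in> A \<Longrightarrow> N \<le> n \<Longrightarrow> word_weight (pmf Q) (stake n \<omega>) \<le> g (rw (stake n \<omega>))"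
    and "0 < \<rho>0" "0 < C"
    and comp: "\<And>\<rho> t. 0 < \<rho> \<Longrightarrow> \<rho> \<le> \<rho>0 \<Longrightarrow> rmin * \<rho> \<le> t \<Longrightarrow> t \<le> \<rho> \<Longrightarrow> g t \<le> C * \<Psi> \<rho>"
    and E: "E \<in> sets borel" "hausdorff_measure \<Psi> E = 0"
  shows "measure (Bern Q) (coding -` E \<inter> A) = 0"
proof -
  interpret prob_space "Bern Q" by (rule prob_space_Bern)
  obtain M :: nat where M: "\<And>\<rho> u U. 0 < \<rho> \<Longrightarrow> u \<in> U \<Longrightarrow> (\<And>x y. x \<in> U \<Longrightarrow> y \<in> U \<Longrightarrow> dist x y \<le> \<rho>) \<Longrightarrow>
      finite {w \<in> cut \<rho>. Sw w ` K \<inter> U \<noteq> {}} \<and> card {w \<in> cut \<rho>. Sw w ` K \<inter> U \<noteq> {}} \<le> M"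
    using bounded_overlap by blast
  \<comment> \<open>below \<open>rmin ^ N\<close>, so that words of the cut have length at least \<open>N\<close>\<close>
  define \<eta> where "\<eta> = min \<rho>0 (min (1 / 2) (rmin ^ N / 2))"
  have "0 < rmin ^ N" using rmin by simp
  then have \<eta>: "0 < \<eta>" "\<eta> \<le> \<rho>0" "\<eta> < 1" "\<eta> < rmin ^ N" using \<open>0 < \<rho>0\<close> by (auto simp: \<eta>_def)
  have piece: "\<exists>B\<in>events. coding -` U \<inter> A \<subseteq> B \<and> emeasure (Bern Q) B \<le> ennreal (M * C) * ennreal (\<Psi> (diameter U))"
    if U: "bounded U" "0 < diameter U" "diameter U \<le> \<eta>" for U
  proof -
    let ?\<rho> = "diameter U"
    have "U \<noteq> {}" using U(2) by auto
    then obtain u where "u \<in> U" by blast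
    define F where "F = {w \<in> cut ?\<rho>. Sw w ` K \<inter> U \<noteq> {}}"
    have F: "finite F" "card F \<le> M"
      using M[OF U(2) \<open>u \<in> U\<close> diameter_bounded_bound[OF U(1)]] unfolding F_def by auto
    define G where "G = {w \<in> F. \<exists>\<omega>\<in>A. stake (length w) \<omega> = w}"
    have G: "finite G" "card G \<le> M" using F card_mono[of F G] by (auto simp: G_def)
    define B where "B = (\<Union>w\<in>G. {\<omega>. stake (length w) \<omega> = w})"
    have "B \<in> events" unfolding B_def using G(1) by (intro sets.finite_UN) (auto intro: sets_Bern_stake)
    moreover have "coding -` U \<inter> A \<subseteq> B"
    proof
      fix \<omega> assume \<omega>: "\<omega> \<in> coding -` U \<inter> A"
      then obtain n where n: "stake n \<omega> \<in> cut ?\<rho>"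
        using cut_stake[of \<omega> ?\<rho>] A(2) U \<eta> by (metis IntD2 le_less_trans subsetD)
      have "coding \<omega> \<in> Sw (stake n \<omega>) ` K" using coding_sdrop[of \<omega> n] coding_K by blast
      then have "stake n \<omega> \<in> F" using n \<omega> by (auto simp: F_def)
      then have "stake n \<omega> \<in> G" using \<omega> by (auto simp: G_def)
      then show "\<omega> \<in> B" unfolding B_def by (intro UN_I[of "stake n \<omega>"]) simp_all
    qed
    moreover have "emeasure (Bern Q) B \<le> ennreal (M * C) * ennreal (\<Psi> ?\<rho>)"
    proof -
      have w: "word_weight (pmf Q) w \<le> C * \<Psi> ?\<rho>" if wG: "w \<in> G" for w
      proof -
        obtain \<omega> where \<omega>: "\<omega> \<in> A" "stake (length w) \<omega> = w" using wG by (auto simp: G_def)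
        have cut: "w \<in> cut ?\<rho>" using wG by (simp add: G_def F_def)
        have "rmin ^ length w < rmin ^ N"
          using rw_ge[of w] cut U \<eta> by (simp add: cut_def)
        then have "N \<le> length w" using rmin rmin_less_1 by (simp add: power_strict_decreasing_iff)
        then have "word_weight (pmf Q) w \<le> g (rw w)" using bound[OF \<omega>(1), of "length w"] \<omega>(2) by simp
        also have "\<dots> \<le> C * \<Psi> ?\<rho>"
          using cut cut_rw_gt[OF cut] U \<eta> by (intro comp) (auto simp: cut_def)
        finally show ?thesis .
      qed
      have nn: "0 \<le> word_weight (pmf Q) w" for w
        using prod_list_pmf_nonneg[of Q w] by (simp add: word_weight_def)
      show ?thesis
      proof (cases "G = {}")
        case False
        then have pos: "0 \<le> \<Psi> ?\<rho>" using w nn \<open>0 < C\<close> by (metis all_not_in_conv order_trans zero_le_mult_iff not_less)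
        have "emeasure (Bern Q) B \<le> (\<Sum>w\<in>G. emeasure (Bern Q) {\<omega>. stake (length w) \<omega> = w})"
          unfolding B_def using G(1) by (intro emeasure_subadditive_finite) (auto intro: sets_Bern_stake)
        also have "\<dots> = (\<Sum>w\<in>G. ennreal (word_weight (pmf Q) w))"
          by (simp add: emeasure_Bern_cylinder word_weight_def)
        also have "\<dots> \<le> (\<Sum>w\<in>G. ennreal (C * \<Psi> ?\<rho>))"
          using w by (intro sum_mono ennreal_leI)
        also have "\<dots> = ennreal (card G * (C * \<Psi> ?\<rho>))"
          using pos \<open>0 < C\<close> by (subst sum_ennreal) auto
        also have "\<dots> \<le> ennreal (M * (C * \<Psi> ?\<rho>))"
          using G(2) pos \<open>0 < C\<close> by (intro ennreal_leI mult_right_mono) auto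
        also have "\<dots> = ennreal (M * C) * ennreal (\<Psi> ?\<rho>)"
          using pos \<open>0 < C\<close> by (simp add: ennreal_mult[symmetric] mult.assoc)
        finally show ?thesis .
      qed (simp add: B_def)
    qed
    ultimately show ?thesis by blast
  qed
  have le: "emeasure (Bern Q) (coding -` E \<inter> A) \<le> ennreal (M * C) * ennreal e" if "0 < e" for e
  proof -
    have "hausdorff_premeasure \<Psi> \<eta> E < ennreal e"
      using hausdorff_premeasure_eq_0[OF E(2) \<eta>(1)] \<open>0 < e\<close> by simp
    then obtain I :: "nat set" and U where IU: "E \<subseteq> (\<Union>i\<in>I. U i)"
      "\<And>i. i \<in> I \<Longrightarrow> bounded (U i) \<and> 0 < diameter (U i) \<and> diameter (U i) \<le> \<eta>"
      "(\<Sum>\<^sub>\<infinity>i\<in>I. ennreal (\<Psi> (diameter (U i)))) < ennreal e"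
      unfolding hausdorff_premeasure_def Inf_less_iff by blast
    have "\<forall>i\<in>I. \<exists>B\<in>events. coding -` U i \<inter> A \<subseteq> B \<and> emeasure (Bern Q) B \<le> ennreal (M * C) * ennreal (\<Psi> (diameter (U i)))"
      using piece IU(2) by blast
    then obtain B where B: "\<And>i. i \<in> I \<Longrightarrow> B i \<in> events" "\<And>i. i \<in> I \<Longrightarrow> coding -` U i \<inter> A \<subseteq> B i"
      "\<And>i. i \<in> I \<Longrightarrow> emeasure (Bern Q) (B i) \<le> ennreal (M * C) * ennreal (\<Psi> (diameter (U i)))"
      by metis
    define B' where "B' i = (if i \<in> I then B i else {})" for i
    have B': "range B' \<subseteq> events" using B(1) by (auto simp: B'_def)
    have "coding -` E \<inter> A \<subseteq> (\<Union>i. B' i)"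
    proof
      fix \<omega> assume \<omega>: "\<omega> \<in> coding -` E \<inter> A"
      then obtain i where "i \<in> I" "coding \<omega> \<in> U i" using IU(1) by auto
      then have "\<omega> \<in> B' i" using B(2)[of i] \<omega> by (auto simp: B'_def)
      then show "\<omega> \<in> (\<Union>i. B' i)" by blast
    qed
    then have "emeasure (Bern Q) (coding -` E \<inter> A) \<le> emeasure (Bern Q) (\<Union>i. B' i)"
      using B' by (intro emeasure_mono) auto
    also have "\<dots> \<le> (\<Sum>i. emeasure (Bern Q) (B' i))"
      using B' by (rule emeasure_subadditive_countably)
    also have "\<dots> \<le> ennreal (M * C) * ennreal e"
    proof (rule suminf_le_const)
      fix n :: nat
      have "(\<Sum>i<n. emeasure (Bern Q) (B' i)) = (\<Sum>i\<in>{..<n} \<inter> I. emeasure (Bern Q) (B i))"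
        by (subst sum.inter_restrict) (auto simp: B'_def intro!: sum.cong)
      also have "\<dots> \<le> (\<Sum>i\<in>{..<n} \<inter> I. ennreal (M * C) * ennreal (\<Psi> (diameter (U i))))"
        using B(3) by (intro sum_mono) auto
      also have "\<dots> = ennreal (M * C) * (\<Sum>i\<in>{..<n} \<inter> I. ennreal (\<Psi> (diameter (U i))))"
        by (simp add: sum_distrib_left)
      also have "\<dots> \<le> ennreal (M * C) * (\<Sum>\<^sub>\<infinity>i\<in>I. ennreal (\<Psi> (diameter (U i))))"
        by (intro mult_left_mono sum_le_infsum_ennreal) auto
      also have "\<dots> \<le> ennreal (M * C) * ennreal e"
        using IU(3) by (intro mult_left_mono) auto
      finally show "(\<Sum>i<n. emeasure (Bern Q) (B' i)) \<le> ennreal (M * C) * ennreal e" .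
    qed simp
    finally show ?thesis .
  qed
  have "prob (coding -` E \<inter> A) \<le> 0 + e" if "0 < e" for e
  proof -
    have pos: "0 < M * C + 1" using \<open>0 < C\<close> by (simp add: add_nonneg_pos)
    have "emeasure (Bern Q) (coding -` E \<inter> A) \<le> ennreal (M * C) * ennreal (e / (M * C + 1))"
      using \<open>0 < e\<close> pos by (intro le) simp
    also have "\<dots> = ennreal (M * C * (e / (M * C + 1)))"
      using \<open>0 < e\<close> \<open>0 < C\<close> pos by (intro ennreal_mult[symmetric]) auto
    finally have "prob (coding -` E \<inter> A) \<le> M * C * (e / (M * C + 1))"
      using \<open>0 < e\<close> \<open>0 < C\<close> pos by (simp add: emeasure_eq_measure)
    also have "\<dots> \<le> (M * C + 1) * (e / (M * C + 1))"
      using \<open>0 < e\<close> pos by (intro mult_right_mono) auto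
    finally show ?thesis using pos by simp
  qed
  then have "prob (coding -` E \<inter> A) \<le> 0" by (rule field_le_epsilon)
  then show ?thesis using measure_nonneg[of "Bern Q" "coding -` E \<inter> A"] by linarith
qed

end

section \<open>The law of the iterated logarithm in the time scale of a second walk\<close>

text \<open>
  By the strong law the second walk \<open>Y\<close> is asymptotic to \<open>l * n\<close>, so \<open>lil_scale (walk Y n \<omega>)\<close> is asymptotic to
  \<open>sqrt l * lil_scale n\<close>. The intermediate constants leave room for \<open>lil_scale_dilate\<close>.
\<close>

lemma lil_upper_clock:
  fixes X Y :: "nat \<Rightarrow> real"
  assumes fin: "finite (set_pmf Q)"
    and mean: "measure_pmf.expectation Q X = 0"
    and Y: "measure_pmf.expectation Q Y = l" "0 < l"
    and c: "0 < c" "measure_pmf.expectation Q (\<lambda>i. (X i)\<^sup>2) < c\<^sup>2 * l"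
  shows "AE \<omega> in Bern Q. \<forall>\<^sub>F n in sequentially. walk X n \<omega> \<le> c * lil_scale (walk Y n \<omega>)"
proof -
  define v where "v = measure_pmf.expectation Q (\<lambda>i. (X i)\<^sup>2)"
  have "0 \<le> v" unfolding v_def by simp
  obtain u where u: "v < u" "u < c\<^sup>2 * l" using c(2) dense unfolding v_def by blast
  define b where "b = sqrt u"
  have b: "0 < b" "b\<^sup>2 = u" using u \<open>0 \<le> v\<close> by (auto simp: b_def)
  have "u / c\<^sup>2 < l" using u c(1) by (simp add: divide_less_eq mult.commute)
  then obtain l1 where l1: "u / c\<^sup>2 < l1" "l1 < l" using dense by blast
  have "0 < u / c\<^sup>2" using c(1) u \<open>0 \<le> v\<close> by simp
  then have "0 < l1" using l1 by linarith
  have "AE \<omega> in Bern Q. \<forall>\<^sub>F n in sequentially. walk X n \<omega> \<le> b * lil_scale (real n)"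
    using b u by (intro lil_upper fin mean) (auto simp: v_def)
  moreover have "AE \<omega> in Bern Q. (\<lambda>n. walk Y n \<omega> / n) \<longlonglongrightarrow> l"
    using strong_law[OF fin, of Y] by (simp add: Y)
  ultimately show ?thesis
  proof eventually_elim
    case (elim \<omega>)
    have "\<forall>\<^sub>F n in sequentially. l1 < walk Y n \<omega> / n"
      using elim(2) l1(2) by (rule order_tendstoD(1))
    then have Yn: "\<forall>\<^sub>F n in sequentially. real n \<le> 1 / l1 * walk Y n \<omega>"
      using eventually_gt_at_top[of 0]
    proof eventually_elim
      case (elim n)
      then show ?case using \<open>0 < l1\<close> by (simp add: field_simps)
    qed
    have "filterlim (\<lambda>n. l1 * real n) at_top sequentially"
      using \<open>0 < l1\<close> by real_asymp
    moreover have "\<forall>\<^sub>F n in sequentially. l1 * real n \<le> walk Y n \<omega>"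
      using Yn
    proof eventually_elim
      case (elim n)
      then show ?case using \<open>0 < l1\<close> by (simp add: field_simps)
    qed
    ultimately have Y_top: "filterlim (\<lambda>n. walk Y n \<omega>) at_top sequentially"
      by (rule filterlim_at_top_mono)
    have "b\<^sup>2 * (1 / l1) < c\<^sup>2"
      using l1(1) c(1) \<open>0 < l1\<close> by (simp add: b field_simps)
    then have "\<forall>\<^sub>F x in at_top. b * lil_scale (1 / l1 * x) \<le> c * lil_scale x"
      using b c \<open>0 < l1\<close> by (intro lil_scale_dilate) auto
    from eventually_compose_filterlim[OF this Y_top]
    have "\<forall>\<^sub>F n in sequentially. b * lil_scale (1 / l1 * walk Y n \<omega>) \<le> c * lil_scale (walk Y n \<omega>)" .
    moreover have "\<forall>\<^sub>F n in sequentially. exp 1 \<le> real n"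
      using filterlim_real_sequentially by (auto simp: filterlim_at_top)
    ultimately show ?case using elim(1) Yn
    proof eventually_elim
      case (elim n)
      have "b * lil_scale (real n) \<le> b * lil_scale (1 / l1 * walk Y n \<omega>)"
        using elim b(1) by (intro mult_left_mono lil_scale_mono) auto
      with elim show ?case by linarith
    qed
  qed
qed

lemma lil_lower_clock:
  fixes X Y :: "nat \<Rightarrow> real"
  assumes fin: "finite (set_pmf Q)"
    and mean: "measure_pmf.expectation Q X = 0"
    and Y: "measure_pmf.expectation Q Y = l" "0 < l"
    and c: "0 \<le> c" "c\<^sup>2 * l < measure_pmf.expectation Q (\<lambda>i. (X i)\<^sup>2)"
  shows "AE \<omega> in Bern Q. \<exists>\<^sub>F n in sequentially. c * lil_scale (walk Y n \<omega>) \<le> walk X n \<omega>"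
proof -
  define v where "v = measure_pmf.expectation Q (\<lambda>i. (X i)\<^sup>2)"
  obtain u where u: "c\<^sup>2 * l < u" "u < v" using c(2) dense unfolding v_def by blast
  have "0 \<le> c\<^sup>2 * l" using Y by simp
  then have "0 < u" "0 < v" using u by linarith+
  define b where "b = sqrt u"
  have b: "0 < b" "b\<^sup>2 = u" "b < sqrt v" using u \<open>0 < u\<close> by (auto simp: b_def)
  \<comment> \<open>slightly larger than \<open>l\<close>, with \<open>c\<^sup>2 * l2 < u\<close> also when \<open>c = 0\<close>\<close>
  define l2 where "l2 = l + (u - c\<^sup>2 * l) / (2 * (c\<^sup>2 + 1))"
  have "0 < c\<^sup>2 + 1" by (simp add: add_nonneg_pos)
  have "l < l2" using u \<open>0 < c\<^sup>2 + 1\<close> by (simp add: l2_def)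
  have l2: "c\<^sup>2 * l2 < b\<^sup>2"
  proof -
    have "c\<^sup>2 / (2 * (c\<^sup>2 + 1)) < 1" using \<open>0 < c\<^sup>2 + 1\<close> by (simp add: divide_less_eq)
    then have "c\<^sup>2 / (2 * (c\<^sup>2 + 1)) * (u - c\<^sup>2 * l) < 1 * (u - c\<^sup>2 * l)"
      using u by (intro mult_strict_right_mono) auto
    moreover have "c\<^sup>2 * l2 = c\<^sup>2 * l + c\<^sup>2 / (2 * (c\<^sup>2 + 1)) * (u - c\<^sup>2 * l)"
      by (simp add: l2_def distrib_left)
    ultimately show ?thesis by (simp add: b)
  qed
  have "AE \<omega> in Bern Q. \<exists>\<^sub>F n in sequentially. b * lil_scale (real n) \<le> walk X n \<omega>"
    using b \<open>0 < v\<close> by (intro lil_lower[where s = "sqrt v"] fin mean) (auto simp: v_def[symmetric])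
  moreover have "AE \<omega> in Bern Q. (\<lambda>n. walk Y n \<omega> / n) \<longlonglongrightarrow> l"
    using strong_law[OF fin, of Y] by (simp add: Y)
  ultimately show ?thesis
  proof eventually_elim
    case (elim \<omega>)
    have "\<forall>\<^sub>F n in sequentially. walk Y n \<omega> / n < l2"
      using elim(2) \<open>l < l2\<close> by (rule order_tendstoD(2))
    moreover have "\<forall>\<^sub>F n in sequentially. l / 2 < walk Y n \<omega> / n"
      using elim(2) Y(2) by (intro order_tendstoD(1)) auto
    moreover have "\<forall>\<^sub>F n in sequentially. exp 1 \<le> l / 2 * real n"
    proof -
      have "filterlim (\<lambda>n. l / 2 * real n) at_top sequentially" using Y(2) by real_asymp
      then show ?thesis by (auto simp: filterlim_at_top)
    qed
    moreover have "\<forall>\<^sub>F x in at_top. c * lil_scale (l2 * x) \<le> b * lil_scale x"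
      using b c l2 Y(2) \<open>l < l2\<close> by (intro lil_scale_dilate) auto
    then have "\<forall>\<^sub>F n in sequentially. c * lil_scale (l2 * real n) \<le> b * lil_scale (real n)"
      using filterlim_real_sequentially by (rule eventually_compose_filterlim)
    ultimately have "\<forall>\<^sub>F n in sequentially. b * lil_scale (real n) \<le> walk X n \<omega> \<longrightarrow> c * lil_scale (walk Y n \<omega>) \<le> walk X n \<omega>"
      using eventually_gt_at_top[of 0]
    proof eventually_elim
      case (elim n)
      have "exp 1 \<le> walk Y n \<omega>" "walk Y n \<omega> \<le> l2 * real n"
        using elim by (auto simp: field_simps)
      then have "c * lil_scale (walk Y n \<omega>) \<le> c * lil_scale (l2 * real n)"
        using c(1) by (intro mult_left_mono lil_scale_mono)
      with elim show ?case by linarith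
    qed
    then show ?case using elim(1) by (rule frequently_mp)
  qed
qed

section \<open>Gauge functions\<close>

text \<open>
  In the variable \<open>ln (1 / t)\<close> the logarithm of \<open>Theta\<close> is the scale of the law of the iterated logarithm.
\<close>

lemma Theta_eq: "Theta t = exp (lil_scale (ln (1 / t)))"
  by (simp add: Theta_def lil_scale_def)

lemma Theta_powr: "Theta t powr a = exp (a * lil_scale (ln (1 / t)))"
  by (simp add: Theta_eq powr_def)

lemma lil_scale_shift: "((\<lambda>x. lil_scale (x + b) - lil_scale x) \<longlongrightarrow> 0) at_top"
  unfolding lil_scale_def by real_asymp

lemma ln_inverse_at_top: "filterlim (\<lambda>t::real. ln (1 / t)) at_top (at_right 0)"
  by real_asymp

text \<open>
  Dilating \<open>t\<close> shifts \<open>ln (1 / t)\<close> by a constant, which changes \<open>lil_scale\<close> by \<open>o(1)\<close>, whereas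
  \<open>(a' - a) * lil_scale\<close> tends to infinity.
\<close>

lemma gauge_dilate_small:
  assumes "a < a'" "0 < c" "0 < e"
  shows "\<forall>\<^sub>F t in at_right 0. (c * t) powr d * Theta (c * t) powr a \<le> e * (t powr d * Theta t powr a')"
proof -
  let ?h = "\<lambda>x. a * (lil_scale (x + - ln c) - lil_scale x) - (a' - a) * lil_scale x"
  have "filterlim (\<lambda>x. (a' - a) * lil_scale x) at_top at_top"
    unfolding lil_scale_def using assms(1) by real_asymp
  then have "filterlim (\<lambda>x. - a * (lil_scale (x + - ln c) - lil_scale x) + (a' - a) * lil_scale x) at_top at_top"
  proof (rule filterlim_tendsto_add_at_top[rotated])
    show "((\<lambda>x. - a * (lil_scale (x + - ln c) - lil_scale x)) \<longlongrightarrow> - a * 0) at_top"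
      by (intro tendsto_mult tendsto_const lil_scale_shift)
  qed
  then have "\<forall>\<^sub>F x in at_top. - ln (e / c powr d) \<le> - a * (lil_scale (x + - ln c) - lil_scale x) + (a' - a) * lil_scale x"
    by (simp add: filterlim_at_top)
  then have "\<forall>\<^sub>F t in at_right 0. - ln (e / c powr d) \<le> - a * (lil_scale (ln (1 / t) + - ln c) - lil_scale (ln (1 / t))) + (a' - a) * lil_scale (ln (1 / t))"
    using ln_inverse_at_top by (rule eventually_compose_filterlim)
  moreover have "\<forall>\<^sub>F t::real in at_right 0. 0 < t" by (simp add: eventually_at_right_less)
  ultimately show ?thesis
  proof eventually_elim
    case (elim t)
    let ?x = "ln (1 / t)"
    have lnc: "ln (1 / (c * t)) = ?x + - ln c" using elim(2) assms(2) by (simp add: ln_div ln_mult)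
    have pos: "0 < e / c powr d" using assms by simp
    have "a * lil_scale (?x + - ln c) \<le> ln (e / c powr d) + a' * lil_scale ?x"
      using elim(1) by (simp add: algebra_simps)
    then have "exp (a * lil_scale (?x + - ln c)) \<le> exp (ln (e / c powr d) + a' * lil_scale ?x)" by simp
    also have "\<dots> = e / c powr d * exp (a' * lil_scale ?x)" using pos by (simp add: exp_add)
    finally have "c powr d * t powr d * exp (a * lil_scale (?x + - ln c)) \<le> c powr d * t powr d * (e / c powr d * exp (a' * lil_scale ?x))"
      by (intro mult_left_mono) auto
    then show ?case
      using assms(2) elim(2) by (simp add: Theta_powr lnc powr_mult mult_ac)
  qed
qed

text \<open>
  Between \<open>q * \<rho>\<close> and \<open>\<rho>\<close> the variable \<open>ln (1 / t)\<close> varies by at most \<open>- ln q\<close>, so for small \<open>\<rho>\<close> \<open>lil_scale\<close> varies by less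
  than \<open>1\<close> and \<open>Theta\<close> by less than a factor \<open>exp 1\<close>.
\<close>

lemma gauge_doubling:
  assumes "0 \<le> d" "0 \<le> a" "0 < q" "q < 1"
  obtains \<rho>0 C :: real where "0 < \<rho>0" "0 < C"
    "\<And>\<rho> t. 0 < \<rho> \<Longrightarrow> \<rho> \<le> \<rho>0 \<Longrightarrow> q * \<rho> \<le> t \<Longrightarrow> t \<le> \<rho> \<Longrightarrow>
       t powr d * Theta t powr a \<le> C * (\<rho> powr d * Theta \<rho> powr a)"
proof -
  have "\<forall>\<^sub>F x in at_top. lil_scale (x + - ln q) - lil_scale x < 1"
    using lil_scale_shift by (rule order_tendstoD(2)) simp
  then have "\<forall>\<^sub>F x in at_top. lil_scale (x + - ln q) - lil_scale x < 1 \<and> exp 1 \<le> x"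
    using eventually_ge_at_top by (rule eventually_conj)
  then have "\<forall>\<^sub>F t in at_right 0. lil_scale (ln (1 / t) + - ln q) - lil_scale (ln (1 / t)) < 1 \<and> exp 1 \<le> ln (1 / t)"
    using ln_inverse_at_top by (rule eventually_compose_filterlim)
  then obtain t0 where t0: "0 < t0" "\<And>t. 0 < t \<Longrightarrow> t < t0 \<Longrightarrow>
      lil_scale (ln (1 / t) + - ln q) - lil_scale (ln (1 / t)) < 1 \<and> exp 1 \<le> ln (1 / t)"
    by (auto simp: eventually_at_right_field)
  show ?thesis
  proof (rule that[of "t0 / 2" "exp a"])
    fix \<rho> t :: real
    assume h: "0 < \<rho>" "\<rho> \<le> t0 / 2" "q * \<rho> \<le> t" "t \<le> \<rho>"
    have "0 < q * \<rho>" using h assms by simp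
    then have "0 < t" using h by linarith
    have "exp 1 \<le> ln (1 / \<rho>)" "lil_scale (ln (1 / \<rho>) + - ln q) - lil_scale (ln (1 / \<rho>)) < 1"
      using t0(2)[of \<rho>] h t0(1) by auto
    moreover have "ln (1 / \<rho>) \<le> ln (1 / t)" using h \<open>0 < t\<close> by (simp add: ln_div)
    moreover have "ln (1 / t) \<le> ln (1 / \<rho>) + - ln q"
    proof -
      have "ln (q * \<rho>) \<le> ln t" using h(3) \<open>0 < q * \<rho>\<close> \<open>0 < t\<close> by (subst ln_le_cancel_iff)
      then show ?thesis using \<open>0 < t\<close> h(1) assms(3) by (simp add: ln_div ln_mult)
    qed
    ultimately have "lil_scale (ln (1 / t)) \<le> 1 + lil_scale (ln (1 / \<rho>))"
      using lil_scale_mono[of "ln (1 / t)" "ln (1 / \<rho>) + - ln q"] by linarith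
    then have "a * lil_scale (ln (1 / t)) \<le> a * (1 + lil_scale (ln (1 / \<rho>)))"
      using assms(2) by (rule mult_left_mono)
    then have "Theta t powr a \<le> exp a * Theta \<rho> powr a"
      unfolding Theta_powr by (simp add: distrib_left flip: exp_add)
    moreover have "t powr d \<le> \<rho> powr d" using h \<open>0 < t\<close> assms(1) by (intro powr_mono2) auto
    ultimately have "t powr d * Theta t powr a \<le> \<rho> powr d * (exp a * Theta \<rho> powr a)"
      by (intro mult_mono) auto
    then show "t powr d * Theta t powr a \<le> exp a * (\<rho> powr d * Theta \<rho> powr a)" by (simp add: mult_ac)
  qed (use t0 in auto)
qed

section \<open>Cylinder masses along a random word\<close>

lemma word_weight_stake:
  assumes "\<And>i. i \<in> I \<Longrightarrow> 0 < c i" "\<omega> \<in> streams I"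
  shows "word_weight c (stake n \<omega>) = exp (walk (\<lambda>i. ln (c i)) n \<omega>)"
  using assms(2)
proof (induction n arbitrary: \<omega>)
  case (Suc n)
  have "shd \<omega> \<in> I" "stl \<omega> \<in> streams I"
    using streams_shd[OF Suc.prems] streams_stl[OF Suc.prems] by simp_all
  then show ?case
    using Suc.IH[of "stl \<omega>"] assms(1) by (simp add: walk_stake exp_add)
qed simp

lemma UNIV_Bern [simp]: "UNIV \<in> sets (Bern Q)"
  using sets.top[of "Bern Q"] by simp

lemma AE_streams:
  assumes "set_pmf Q \<subseteq> I"
  shows "AE \<omega> in Bern Q. \<omega> \<in> streams I"
proof -
  have "AE i in measure_pmf Q. i \<in> I" using assms by (auto simp: AE_measure_pmf_iff)
  then have "AE \<omega> in Bern Q. stream_all (\<lambda>i. i \<in> I) \<omega>"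
    by (intro prob_space.AE_stream_all measure_pmf.prob_space_axioms) simp_all
  then show ?thesis by eventually_elim (simp add: streams_iff_snth stream_all_def)
qed

lemma streams_stake: "\<omega> \<in> streams I \<longleftrightarrow> (\<forall>n. set (stake n \<omega>) \<subseteq> I)"
proof
  assume "\<omega> \<in> streams I"
  then show "\<forall>n. set (stake n \<omega>) \<subseteq> I" by (auto simp: in_set_conv_nth streams_iff_snth)
next
  assume h: "\<forall>n. set (stake n \<omega>) \<subseteq> I"
  have "\<omega> !! n \<in> set (stake (Suc n) \<omega>)" for n by (simp only: stake_Suc set_append) simp
  with h have "\<omega> !! n \<in> I" for n by blast
  then show "\<omega> \<in> streams I" by (simp add: streams_iff_snth)
qed

context ifs
begin

text \<open>
  The logarithm of the mass of a cylinder, compared to \<open>d\<close> times that of its size, is a random walk; the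
  logarithm of the size is another one and serves as its clock.
\<close>

lemma cylinder_mass:
  assumes pos: "\<forall>i\<in>{1..k}. 0 < pmf Q i" and \<omega>: "\<omega> \<in> streams {1..k}"
  shows "word_weight (pmf Q) (stake n \<omega>) =
      rw (stake n \<omega>) powr d * exp (walk (\<lambda>i. ln (pmf Q i) - d * ln (r i)) n \<omega>)"
    and "ln (1 / rw (stake n \<omega>)) = walk (\<lambda>i. - ln (r i)) n \<omega>"
proof -
  have 1: "word_weight (pmf Q) (stake n \<omega>) = exp (walk (\<lambda>i. ln (pmf Q i)) n \<omega>)"
    by (rule word_weight_stake[OF _ \<omega>]) (use pos in blast)
  have 2: "rw (stake n \<omega>) = exp (walk (\<lambda>i. ln (r i)) n \<omega>)"
    by (rule word_weight_stake[OF _ \<omega>]) (rule r_pos)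
  have 3: "walk (\<lambda>i. ln (pmf Q i) - d * ln (r i)) n \<omega> = walk (\<lambda>i. ln (pmf Q i)) n \<omega> - d * walk (\<lambda>i. ln (r i)) n \<omega>"
    by (simp add: walk_def sum_subtractf sum_distrib_left)
  show "word_weight (pmf Q) (stake n \<omega>) = rw (stake n \<omega>) powr d * exp (walk (\<lambda>i. ln (pmf Q i) - d * ln (r i)) n \<omega>)"
    unfolding 1 2 3 by (simp add: powr_def flip: exp_add)
  show "ln (1 / rw (stake n \<omega>)) = walk (\<lambda>i. - ln (r i)) n \<omega>"
    unfolding walk_uminus by (simp add: 2 ln_div)
qed

lemma cylinder_mass_le_iff:
  assumes pos: "\<forall>i\<in>{1..k}. 0 < pmf Q i" and \<omega>: "\<omega> \<in> streams {1..k}"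
  shows "word_weight (pmf Q) (stake n \<omega>) \<le> rw (stake n \<omega>) powr d * Theta (rw (stake n \<omega>)) powr c \<longleftrightarrow>
      walk (\<lambda>i. ln (pmf Q i) - d * ln (r i)) n \<omega> \<le> c * lil_scale (walk (\<lambda>i. - ln (r i)) n \<omega>)"
    and "rw (stake n \<omega>) powr d * Theta (rw (stake n \<omega>)) powr c \<le> word_weight (pmf Q) (stake n \<omega>) \<longleftrightarrow>
      c * lil_scale (walk (\<lambda>i. - ln (r i)) n \<omega>) \<le> walk (\<lambda>i. ln (pmf Q i) - d * ln (r i)) n \<omega>"
proof -
  have "0 < rw (stake n \<omega>) powr d" using rw_pos[of "stake n \<omega>"] by simp
  note * = mult_le_cancel_left_pos[OF this] exp_le_cancel_iff
  show "word_weight (pmf Q) (stake n \<omega>) \<le> rw (stake n \<omega>) powr d * Theta (rw (stake n \<omega>)) powr c \<longleftrightarrow>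
      walk (\<lambda>i. ln (pmf Q i) - d * ln (r i)) n \<omega> \<le> c * lil_scale (walk (\<lambda>i. - ln (r i)) n \<omega>)"
    unfolding cylinder_mass(1)[OF assms, of n d] Theta_powr cylinder_mass(2)[OF assms] by (simp only: *)
  show "rw (stake n \<omega>) powr d * Theta (rw (stake n \<omega>)) powr c \<le> word_weight (pmf Q) (stake n \<omega>) \<longleftrightarrow>
      c * lil_scale (walk (\<lambda>i. - ln (r i)) n \<omega>) \<le> walk (\<lambda>i. ln (pmf Q i) - d * ln (r i)) n \<omega>"
    unfolding cylinder_mass(1)[OF assms, of n d] Theta_powr cylinder_mass(2)[OF assms] by (simp only: *)
qed

text \<open>
  By the lower half, almost every address passes infinitely often through cylinders of mass at least
  \<open>t powr d * Theta t powr c\<close>, where \<open>t\<close> is the size. Such points are covered economically for the smaller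
  exponent \<open>a\<close>.
\<close>

theorem singular_gauge:
  assumes Q: "set_pmf Q = {1..k}"
    and mean: "measure_pmf.expectation Q (\<lambda>i. ln (pmf Q i) - d * ln (r i)) = 0"
    and l: "measure_pmf.expectation Q (\<lambda>i. - ln (r i)) = l" "0 < l"
    and c: "0 \<le> c" "c\<^sup>2 * l < measure_pmf.expectation Q (\<lambda>i. (ln (pmf Q i) - d * ln (r i))\<^sup>2)" "a < c"
  shows "\<exists>E\<in>sets borel. measure (Bern Q) (coding -` E) = 1 \<and>
    hausdorff_measure (\<lambda>t. t powr d * Theta t powr a) E = 0"
proof -
  interpret prob_space "Bern Q" by (rule prob_space_Bern)
  have fin: "finite (set_pmf Q)" by (simp add: Q)
  have pos: "\<forall>i\<in>{1..k}. 0 < pmf Q i" using Q by (simp add: pmf_positive)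
  define g where "g t = t powr d * Theta t powr c" for t
  define A where "A = {\<omega> \<in> streams {1..k}. \<exists>\<^sub>F n in sequentially. g (rw (stake n \<omega>)) \<le> word_weight (pmf Q) (stake n \<omega>)}"
  have "AE \<omega> in Bern Q. \<omega> \<in> A"
    using AE_streams[OF Q[THEN equalityD1]] lil_lower_clock[OF fin mean l c(1,2)]
  proof eventually_elim
    case (elim \<omega>)
    then show ?case unfolding A_def g_def
      by (simp add: cylinder_mass_le_iff(2)[OF pos elim(1)])
  qed
  moreover obtain E where E: "E \<in> sets borel" "coding ` A \<subseteq> E" "hausdorff_measure (\<lambda>t. t powr d * Theta t powr a) E = 0"
    using economic_cover[of A g Q "\<lambda>t. t powr d * Theta t powr a"] gauge_dilate_small[OF c(3)]
    unfolding A_def g_def by blast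
  ultimately have "AE \<omega> in Bern Q. \<omega> \<in> coding -` E" by (auto elim!: eventually_mono)
  moreover have "coding -` E \<in> events" using measurable_sets[OF measurable_coding E(1), of Q] by simp
  ultimately have "prob (coding -` E) = 1" by (simp add: prob_eq_1)
  with E show ?thesis by blast
qed

end

context ifs_osc
begin

text \<open>
  By the upper half, almost every address lies in some \<open>A N\<close>, the set of addresses whose cylinders have mass
  at most \<open>g\<close> of their size from time \<open>N\<close> on. The mass distribution principle applies to each \<open>A N\<close>.
\<close>

theorem abs_cont_gauge:
  assumes Q: "set_pmf Q = {1..k}"
    and mean: "measure_pmf.expectation Q (\<lambda>i. ln (pmf Q i) - d * ln (r i)) = 0"
    and l: "measure_pmf.expectation Q (\<lambda>i. - ln (r i)) = l" "0 < l"
    and c: "0 < c" "measure_pmf.expectation Q (\<lambda>i. (ln (pmf Q i) - d * ln (r i))\<^sup>2) < c\<^sup>2 * l" and "0 \<le> d"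
    and E: "E \<in> sets borel" "hausdorff_measure (\<lambda>t. t powr d * Theta t powr c) E = 0"
  shows "measure (Bern Q) (coding -` E) = 0"
proof -
  interpret prob_space "Bern Q" by (rule prob_space_Bern)
  have fin: "finite (set_pmf Q)" by (simp add: Q)
  have pos: "\<forall>i\<in>{1..k}. 0 < pmf Q i" using Q by (simp add: pmf_positive)
  define g where "g t = t powr d * Theta t powr c" for t
  define A where "A N = {\<omega>. \<forall>n. set (stake n \<omega>) \<subseteq> {1..k} \<and>
      (N \<le> n \<longrightarrow> word_weight (pmf Q) (stake n \<omega>) \<le> g (rw (stake n \<omega>)))}" for N
  have A_sets: "A N \<in> events" for N
  proof -
    have "A N = (\<Inter>n. {\<omega>. set (stake n \<omega>) \<subseteq> {1..k} \<and>
      (N \<le> n \<longrightarrow> word_weight (pmf Q) (stake n \<omega>) \<le> g (rw (stake n \<omega>)))})"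
      unfolding A_def by blast
    also have "\<dots> \<in> events"
      using sets_Bern_stake[of "\<lambda>v. set v \<subseteq> {1..k} \<and> (N \<le> _ \<longrightarrow> word_weight (pmf Q) v \<le> g (rw v))"]
      by (intro sets.countable_INT'') auto
    finally show ?thesis .
  qed
  have A_streams: "A N \<subseteq> streams {1..k}" for N by (rule subsetI) (simp add: A_def streams_stake)
  have "AE \<omega> in Bern Q. \<exists>N. \<omega> \<in> A N"
    using AE_streams[OF Q[THEN equalityD1]] lil_upper_clock[OF fin mean l c]
  proof eventually_elim
    case (elim \<omega>)
    then have "\<forall>\<^sub>F n in sequentially. word_weight (pmf Q) (stake n \<omega>) \<le> g (rw (stake n \<omega>))"
      unfolding g_def by (simp add: cylinder_mass_le_iff(1)[OF pos elim(1)])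
    then obtain N where "\<forall>n\<ge>N. word_weight (pmf Q) (stake n \<omega>) \<le> g (rw (stake n \<omega>))"
      by (auto simp: eventually_sequentially)
    then have "\<omega> \<in> A N" using elim(1) by (simp add: A_def streams_stake)
    then show ?case by blast
  qed
  moreover have "AE \<omega> in Bern Q. \<omega> \<notin> coding -` E \<inter> A N" for N
  proof -
    obtain \<rho>0 C :: real where *: "0 < \<rho>0" "0 < C" "\<And>\<rho> t. 0 < \<rho> \<Longrightarrow> \<rho> \<le> \<rho>0 \<Longrightarrow> rmin * \<rho> \<le> t \<Longrightarrow> t \<le> \<rho> \<Longrightarrow>
       t powr d * Theta t powr c \<le> C * (\<rho> powr d * Theta \<rho> powr c)"
      using gauge_doubling[OF \<open>0 \<le> d\<close> less_imp_le[OF c(1)] rmin rmin_less_1] by blast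
    have "prob (coding -` E \<inter> A N) = 0"
      by (rule mass_distribution[OF A_sets A_streams _ *(1,2) _ E, where g = g and N = N])
         (use *(3) in \<open>auto simp: A_def g_def\<close>)
    moreover have "coding -` E \<inter> A N \<in> events"
      using measurable_sets[OF measurable_coding E(1), of Q] A_sets by auto
    ultimately show ?thesis by (intro AE_not_in) (auto simp: null_sets_def emeasure_eq_measure)
  qed
  then have "AE \<omega> in Bern Q. \<forall>N. \<omega> \<notin> coding -` E \<inter> A N" unfolding AE_all_countable by blast
  ultimately have "AE \<omega> in Bern Q. \<omega> \<notin> coding -` E" by eventually_elim auto
  moreover have "coding -` E \<in> events" using measurable_sets[OF measurable_coding E(1), of Q] by simp
  ultimately show ?thesis by (simp add: prob_eq_0)
qed

text \<open>
  For the weights \<open>r i powr \<delta>\<close> the mass of a cylinder is exactly the power \<open>\<delta>\<close> of its size. The economical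
  covers then show that the \<open>s\<close>-dimensional measure of \<open>K\<close> vanishes for \<open>s > \<delta>\<close>, and the mass distribution
  principle shows that it does not for \<open>s < \<delta>\<close>. The value \<open>\<delta> = 0\<close> belongs to the case of a single map, where \<open>K\<close>
  is a point.
\<close>

theorem hausdorff_dim_attractor:
  assumes Q: "set_pmf Q \<subseteq> {1..k}" and w: "\<And>i. i \<in> {1..k} \<Longrightarrow> pmf Q i = r i powr \<delta>" and "0 \<le> \<delta>"
  shows "hausdorff_dim K = \<delta>"
proof -
  interpret prob_space "Bern Q" by (rule prob_space_Bern)
  have weight: "word_weight (pmf Q) (stake n \<omega>) = rw (stake n \<omega>) powr \<delta>" if \<omega>: "\<omega> \<in> streams {1..k}" for n \<omega>
  proof -
    have "word_weight (pmf Q) v = rw v powr \<delta>" if "v \<in> lists {1..k}" for v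
      using that by (induction v) (use r_pos rw_pos w in \<open>auto simp: powr_mult less_imp_le\<close>)
    moreover have "stake n \<omega> \<in> lists {1..k}" using \<omega> by (auto simp: streams_stake)
    ultimately show ?thesis .
  qed
  let ?Z = "{s. 0 \<le> s \<and> hausdorff_measure (\<lambda>t. t powr s) K = 0}"
  have upper: "s \<in> ?Z" if "\<delta> < s" for s
  proof -
    have small: "\<forall>\<^sub>F t in at_right 0. (c * t) powr s \<le> e * t powr \<delta>" if "0 < c" "0 < e" for c e :: real
    proof -
      have "((\<lambda>t. c powr s * t powr (s - \<delta>)) \<longlongrightarrow> 0) (at_right 0)"
        using \<open>\<delta> < s\<close> by real_asymp
      then have "\<forall>\<^sub>F t in at_right 0. c powr s * t powr (s - \<delta>) < e"
        using \<open>0 < e\<close> by (rule order_tendstoD(2))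
      moreover have "\<forall>\<^sub>F t::real in at_right 0. 0 < t" by (simp add: eventually_at_right_less)
      ultimately show ?thesis
      proof eventually_elim
        case (elim t)
        have "(c * t) powr s = c powr s * t powr (s - \<delta>) * t powr \<delta>"
          using elim(2) \<open>0 < c\<close> by (simp add: powr_mult flip: powr_add)
        also have "\<dots> \<le> e * t powr \<delta>" using elim(1) by (intro mult_right_mono) auto
        finally show ?case .
      qed
    qed
    have "\<exists>E\<in>sets borel. coding ` streams {1..k} \<subseteq> E \<and> hausdorff_measure (\<lambda>t. t powr s) E = 0"
      by (rule economic_cover[where g = "\<lambda>t. t powr \<delta>" and Q = Q]) (use small weight in auto)
    then obtain E where "coding ` streams {1..k} \<subseteq> E" "hausdorff_measure (\<lambda>t. t powr s) E = 0" by blast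
    then have "hausdorff_measure (\<lambda>t. t powr s) K = 0"
      using hausdorff_measure_mono[of K E "\<lambda>t. t powr s"] coding_surj by auto
    with that \<open>0 \<le> \<delta>\<close> show ?thesis by simp
  qed
  have lower: "\<delta> \<le> s" if "s \<in> ?Z" for s
  proof (rule ccontr)
    assume "\<not> \<delta> \<le> s"
    have streams_sets: "streams {1..k} \<in> events"
    proof -
      have "streams {1..k} = (\<Inter>n. {\<omega>. set (stake n \<omega>) \<subseteq> {1..k}})"
        unfolding streams_stake set_eq_iff by blast
      also have "\<dots> \<in> events" using sets_Bern_stake by (intro sets.countable_INT'') auto
      finally show ?thesis .
    qed
    have "prob (coding -` K \<inter> streams {1..k}) = 0"
    proof (rule mass_distribution[OF streams_sets order_refl, where g = "\<lambda>t. t powr \<delta>" and N = 0 and C = 1])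
      show "t powr \<delta> \<le> 1 * \<rho> powr s" if "0 < \<rho>" "\<rho> \<le> 1" "rmin * \<rho> \<le> t" "t \<le> \<rho>" for \<rho> t :: real
      proof -
        have "0 < rmin * \<rho>" using rmin that by simp
        then have "0 < t" using that by linarith
        then have "t powr \<delta> \<le> \<rho> powr \<delta>" using that \<open>0 \<le> \<delta>\<close> by (intro powr_mono2) auto
        also have "\<dots> \<le> \<rho> powr s" using that \<open>\<not> \<delta> \<le> s\<close> by (intro powr_mono') auto
        finally show ?thesis by simp
      qed
      show "K \<in> sets borel" using compact_imp_closed[OF compact_K] by simp
    qed (use that weight in auto)
    moreover have "coding -` K \<inter> streams {1..k} = streams {1..k}" using coding_K by auto
    moreover have "prob (streams {1..k}) = 1"
      using AE_streams[OF Q] streams_sets by (simp add: prob_eq_1)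
    ultimately show False by simp
  qed
  have "bdd_below ?Z" by (rule bdd_belowI[of _ 0]) simp
  have "Inf ?Z \<le> \<delta> + e" if "0 < e" for e
    using upper[of "\<delta> + e"] that \<open>bdd_below ?Z\<close> by (intro cInf_lower) auto
  then have "Inf ?Z \<le> \<delta>" by (rule field_le_epsilon)
  moreover have "\<delta> \<le> Inf ?Z"
  proof (rule cInf_greatest)
    have "\<delta> + 1 \<in> ?Z" by (rule upper) simp
    then show "?Z \<noteq> {}" by blast
  qed (rule lower)
  ultimately show ?thesis unfolding hausdorff_dim_def by simp
qed

end

section \<open>Moran's equation and the equality case of Gibbs' inequality\<close>

lemma pmf_of_weights:
  fixes p :: "'i \<Rightarrow> real"
  assumes "finite A" and "\<And>i. i \<in> A \<Longrightarrow> 0 < p i" "(\<Sum>i\<in>A. p i) = 1"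
  obtains Q where "set_pmf Q = A" "\<And>i. i \<in> A \<Longrightarrow> pmf Q i = p i"
proof -
  define f where "f i = (if i \<in> A then p i else 0)" for i
  have f: "0 \<le> f i" for i using assms(2) by (auto simp: f_def less_imp_le)
  have "(\<integral>\<^sup>+i. ennreal (f i) \<partial>count_space UNIV) = (\<Sum>i\<in>A. ennreal (f i))"
    using \<open>finite A\<close> by (intro nn_integral_count_space') (auto simp: f_def)
  also have "\<dots> = ennreal (\<Sum>i\<in>A. f i)" using f by (intro sum_ennreal) auto
  also have "(\<Sum>i\<in>A. f i) = 1" using assms(3) by (simp add: f_def)
  finally have "(\<integral>\<^sup>+i. ennreal (f i) \<partial>count_space UNIV) = 1" by simp
  note Q = pmf_embed_pmf[of f, OF f this]
  show ?thesis
  proof (rule that[of "embed_pmf f"])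
    show "set_pmf (embed_pmf f) = A"
      unfolding set_pmf_iff set_eq_iff Q using assms(2) by (force simp: f_def)
    show "pmf (embed_pmf f) i = p i" if "i \<in> A" for i using that by (simp add: Q f_def)
  qed
qed

lemma moran_equation:
  fixes r :: "nat \<Rightarrow> real"
  assumes r: "\<And>i. i \<in> {1..k} \<Longrightarrow> 0 < r i \<and> r i < 1" and "1 \<le> k"
  obtains \<delta> where "0 \<le> \<delta>" "2 \<le> k \<Longrightarrow> 0 < \<delta>" "\<And>s. (\<Sum>i=1..k. r i powr s) = 1 \<longleftrightarrow> s = \<delta>"
proof -
  define f where "f s = (\<Sum>i=1..k. r i powr s)" for s
  have f0: "f 0 = real k"
  proof -
    have "f 0 = (\<Sum>i=1..k. 1)" unfolding f_def by (intro sum.cong refl) (use r in force)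
    then show ?thesis by simp
  qed
  have mono: "f t < f s" if "s < t" for s t
    unfolding f_def
  proof (rule sum_strict_mono)
    show "{1..k} \<noteq> {}" using \<open>1 \<le> k\<close> by simp
    show "r i powr t < r i powr s" if "i \<in> {1..k}" for i
      using r[OF that] \<open>s < t\<close> by (intro powr_less_mono') auto
  qed simp
  have "(f \<longlongrightarrow> (\<Sum>i=1..k. 0)) at_top"
    unfolding f_def
  proof (rule tendsto_sum)
    fix i assume "i \<in> {1..k}"
    with r have "0 < r i" "r i < 1" by auto
    then show "((\<lambda>s. r i powr s) \<longlongrightarrow> 0) at_top" by real_asymp
  qed
  then have "\<forall>\<^sub>F s in at_top. f s < 1" by (intro order_tendstoD(2)) auto
  then obtain s0 where s0: "\<And>s. s0 \<le> s \<Longrightarrow> f s < 1" by (auto simp: eventually_at_top_linorder)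
  have "continuous_on {0..max 0 s0} f"
    unfolding f_def by (intro continuous_intros) (use r in force)
  then obtain \<delta> where \<delta>: "0 \<le> \<delta>" "f \<delta> = 1"
    using IVT2'[of f "max 0 s0" 1 0] f0 s0[of "max 0 s0"] \<open>1 \<le> k\<close> by force
  show ?thesis
  proof (rule that[of \<delta>])
    show "0 < \<delta>" if "2 \<le> k"
    proof -
      have "\<delta> \<noteq> 0" using \<delta>(2) f0 that by (intro notI) simp
      then show ?thesis using \<delta>(1) by simp
    qed
    show "(\<Sum>i=1..k. r i powr s) = 1 \<longleftrightarrow> s = \<delta>" for s
      using mono[of s \<delta>] mono[of \<delta> s] \<delta>(2) unfolding f_def[symmetric]
      by (cases s \<delta> rule: linorder_cases) auto
  qed (rule \<delta>(1))
qed

text \<open>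
  The sum of \<open>p i * (z - 1 - ln z)\<close> with \<open>z = q i / p i\<close> vanishes, and its terms are nonnegative, with equality
  only for \<open>z = 1\<close>.
\<close>

lemma gibbs_equality:
  fixes p q :: "'i \<Rightarrow> real"
  assumes fin: "finite A"
    and p: "\<And>i. i \<in> A \<Longrightarrow> 0 < p i" "(\<Sum>i\<in>A. p i) = 1"
    and q: "\<And>i. i \<in> A \<Longrightarrow> 0 < q i" "(\<Sum>i\<in>A. q i) = 1"
    and eq: "(\<Sum>i\<in>A. p i * (ln (p i) - ln (q i))) = 0"
    and i: "i \<in> A"
  shows "p i = q i"
proof -
  let ?z = "\<lambda>i. q i / p i"
  have nonneg: "0 \<le> p i * (?z i - 1 - ln (?z i))" if "i \<in> A" for i
  proof -
    have "ln (?z i) \<le> ?z i - 1" using p(1)[OF that] q(1)[OF that] by (intro ln_le_minus_one) simp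
    then show ?thesis using p(1)[OF that] by simp
  qed
  have "(\<Sum>i\<in>A. p i * (?z i - 1 - ln (?z i))) = (\<Sum>i\<in>A. q i - p i + p i * (ln (p i) - ln (q i)))"
  proof (intro sum.cong refl)
    fix i assume "i \<in> A"
    then have "0 < p i" "0 < q i" using p q by auto
    then show "p i * (?z i - 1 - ln (?z i)) = q i - p i + p i * (ln (p i) - ln (q i))"
      by (simp add: ln_div field_simps)
  qed
  also have "\<dots> = 0" using p q eq by (simp add: sum.distrib sum_subtractf)
  finally have "\<forall>i\<in>A. p i * (?z i - 1 - ln (?z i)) = 0"
    using nonneg fin by (subst (asm) sum_nonneg_eq_0_iff) auto
  then have "ln (?z i) = ?z i - 1" using i p(1)[OF i] by force
  then have "?z i = 1" using i p(1) q(1) by (intro ln_eq_minus_one) auto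
  then show ?thesis using p(1)[OF i] by simp
qed

section \<open>Absolute continuity and singularity of the self-similar measure\<close>

theorem theorem3p1:
  fixes S :: "nat \<Rightarrow> 'a::euclidean_space \<Rightarrow> 'a"
    and k :: nat
    and r p :: "nat \<Rightarrow> real"
    and K :: "'a set"
    and m :: "'a measure"
    and \<delta> d \<sigma> :: real
  assumes ratio: "\<And>i. i \<in> {1..k} \<Longrightarrow> 0 < r i \<and> r i < 1"
    and sim: "\<And>i. i \<in> {1..k} \<Longrightarrow> similarity (r i) (S i)"
    and attr: "attractor k S K"
    and osc: "open_set_condition k S"
    and delta: "\<delta> = hausdorff_dim K"
    and p_pos: "\<And>i. i \<in> {1..k} \<Longrightarrow> 0 < p i"
    and p_sum: "(\<Sum>i=1..k. p i) = 1"
    and self_sim: "self_similar_measure k p S m"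
    and d: "d = (\<Sum>i=1..k. p i * ln (p i)) / (\<Sum>i=1..k. p i * ln (r i))"
    and sigma: "\<sigma> = sqrt ((\<Sum>i=1..k. p i * (ln (p i) - d * ln (r i))\<^sup>2) /
                            (- (\<Sum>i=1..k. p i * ln (r i))))"
  shows "(2 \<le> k \<longrightarrow> 0 < \<delta> \<and> (\<forall>s>0. (\<Sum>i=1..k. r i powr s) = 1 \<longleftrightarrow> s = \<delta>)) \<and>
         (d \<noteq> \<delta> \<longleftrightarrow> 0 < \<sigma>) \<and>
         (d \<noteq> \<delta> \<longrightarrow>
            (\<forall>\<epsilon>>0. abs_cont_hausdorff m (\<lambda>t. t powr d * Theta t powr (\<sigma> + \<epsilon>)) \<and>
                    singular_hausdorff m (\<lambda>t. t powr d * Theta t powr (\<sigma> - \<epsilon>))) \<and>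
            singular_hausdorff m (\<lambda>t. t powr d))"
proof -
  have "k \<noteq> 0" using p_sum by (intro notI) simp
  then have "1 \<le> k" by simp
  then have one: "1 \<in> {1..k}" by simp
  \<comment> \<open>the letters outside \<open>{1..k}\<close> receive copies of the first map\<close>
  define S' where "S' i = (if i \<in> {1..k} then S i else S 1)" for i
  define r' where "r' i = (if i \<in> {1..k} then r i else r 1)" for i
  define rmin rmax where "rmin = Min (r ` {1..k})" and "rmax = Max (r ` {1..k})"
  have r'_in: "r' i \<in> r ` {1..k}" for i using one by (auto simp: r'_def)
  have ne: "r ` {1..k} \<noteq> {}" using one by blast
  have SK: "S i ` K \<subseteq> K" if "i \<in> {1..k}" for i using attr that unfolding attractor_def by blast
  interpret ifs_osc k S' r' K rmin rmax
  proof
    show "similarity (r' i) (S' i)" for i using sim one by (simp add: S'_def r'_def)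
    show "0 < rmin" using ratio ne by (simp add: rmin_def)
    show "rmax < 1" using ratio ne by (simp add: rmax_def)
    show "rmin \<le> r' i" "r' i \<le> rmax" for i
      using r'_in[of i] by (simp_all only: rmin_def rmax_def Min_le Max_ge finite_imageI finite_atLeastAtMost)
    show "attractor k S' K" using attr by (simp add: attractor_def S'_def)
    show "S' i ` K \<subseteq> K" for i using SK SK[OF one] by (simp add: S'_def)
    have "(\<Union>i\<in>{1..k}. S' i ` U) = (\<Union>i\<in>{1..k}. S i ` U)" for U by (simp add: S'_def)
    moreover have "(\<forall>i\<in>{1..k}. \<forall>j\<in>{1..k}. i \<noteq> j \<longrightarrow> S' i ` U \<inter> S' j ` U = {}) \<longleftrightarrow>
        (\<forall>i\<in>{1..k}. \<forall>j\<in>{1..k}. i \<noteq> j \<longrightarrow> S i ` U \<inter> S j ` U = {})" for U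
      by (simp add: S'_def)
    ultimately show "open_set_condition k S'" using osc unfolding open_set_condition_def by presburger
  qed

  obtain \<delta>' where \<delta>': "0 \<le> \<delta>'" "2 \<le> k \<Longrightarrow> 0 < \<delta>'" "\<And>s. (\<Sum>i=1..k. r i powr s) = 1 \<longleftrightarrow> s = \<delta>'"
    using moran_equation[of k r, OF ratio \<open>1 \<le> k\<close>] by blast
  have "\<delta> = \<delta>'"
  proof -
    have pos: "0 < r i powr \<delta>'" if "i \<in> {1..k}" for i using ratio[OF that] by simp
    obtain Q where Q: "set_pmf Q = {1..k}" "\<And>i. i \<in> {1..k} \<Longrightarrow> pmf Q i = r i powr \<delta>'"
      using pmf_of_weights[of "{1..k}" "\<lambda>i. r i powr \<delta>'"] pos \<delta>'(3) by blast
    show ?thesis unfolding delta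
      by (rule hausdorff_dim_attractor[of Q]) (use Q \<delta>'(1) in \<open>simp_all add: r'_def\<close>)
  qed
  note \<delta> = \<delta>'[folded \<open>\<delta> = \<delta>'\<close>]

  \<comment> \<open>the mean of the clock and the variance of the walk; \<open>d\<close> is chosen to make the walk centred\<close>
  define l where "l = - (\<Sum>i=1..k. p i * ln (r i))"
  define v where "v = (\<Sum>i=1..k. p i * (ln (p i) - d * ln (r i))\<^sup>2)"
  have "0 < l"
  proof -
    have "0 < (\<Sum>i=1..k. - (p i * ln (r i)))"
      by (rule sum_pos) (use one p_pos ratio in \<open>auto simp: mult_less_0_iff\<close>)
    then show ?thesis by (simp add: l_def sum_negf)
  qed
  have "0 \<le> v" unfolding v_def using p_pos by (intro sum_nonneg mult_nonneg_nonneg) (auto simp: less_imp_le)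
  have \<sigma>: "\<sigma> = sqrt (v / l)" using sigma by (simp add: v_def l_def)
  then have "0 \<le> \<sigma>" "\<sigma>\<^sup>2 * l = v" using \<open>0 \<le> v\<close> \<open>0 < l\<close> by simp_all
  have dl: "d * (\<Sum>i=1..k. p i * ln (r i)) = (\<Sum>i=1..k. p i * ln (p i))"
    using \<open>0 < l\<close> d by (simp add: l_def)
  have mean: "(\<Sum>i=1..k. p i * (ln (p i) - d * ln (r i))) = 0"
  proof -
    have "(\<Sum>i=1..k. p i * (ln (p i) - d * ln (r i))) = (\<Sum>i=1..k. p i * ln (p i)) - d * (\<Sum>i=1..k. p i * ln (r i))"
      by (simp add: sum_subtractf sum_distrib_left algebra_simps)
    with dl show ?thesis by simp
  qed
  have "0 \<le> d"
  proof -
    have "p i \<le> 1" if "i \<in> {1..k}" for i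
      using member_le_sum[of i "{1..k}" p] that p_pos p_sum by (simp add: less_imp_le)
    then have "(\<Sum>i=1..k. p i * ln (p i)) \<le> 0"
      using p_pos by (intro sum_nonpos) (auto simp: mult_le_0_iff less_imp_le)
    then show ?thesis unfolding d using \<open>0 < l\<close> by (intro divide_nonpos_neg) (simp_all add: l_def)
  qed
  have "v = 0 \<longleftrightarrow> d = \<delta>"
  proof
    assume "v = 0"
    have zero: "\<forall>i\<in>{1..k}. p i * (ln (p i) - d * ln (r i))\<^sup>2 = 0"
      using \<open>v = 0\<close> p_pos unfolding v_def by (subst (asm) sum_nonneg_eq_0_iff) (auto simp: less_imp_le)
    have "r i powr d = p i" if "i \<in> {1..k}" for i
    proof -
      have "p i * (ln (p i) - d * ln (r i))\<^sup>2 = 0" using zero that by blast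
      then have "d * ln (r i) = ln (p i)" using p_pos[OF that] by simp
      then show ?thesis using p_pos[OF that] ratio[OF that] by (simp add: powr_def)
    qed
    then have "(\<Sum>i=1..k. r i powr d) = 1" using p_sum by simp
    then show "d = \<delta>" using \<delta>(3) by blast
  next
    assume "d = \<delta>"
    have "p i = r i powr d" if "i \<in> {1..k}" for i
    proof (rule gibbs_equality[OF finite_atLeastAtMost p_pos p_sum _ _ _ that])
      show "(\<Sum>i=1..k. r i powr d) = 1" using \<delta>(3) \<open>d = \<delta>\<close> by blast
      have "(\<Sum>i=1..k. p i * (ln (p i) - ln (r i powr d))) = (\<Sum>i=1..k. p i * (ln (p i) - d * ln (r i)))"
        by (intro sum.cong refl) (use ratio in \<open>auto simp: ln_powr\<close>)
      with mean show "(\<Sum>i=1..k. p i * (ln (p i) - ln (r i powr d))) = 0" by simp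
      show "0 < r i powr d" if "i \<in> {1..k}" for i using ratio[OF that] by simp
    qed auto
    then have "ln (p i) - d * ln (r i) = 0" if "i \<in> {1..k}" for i
      using that ratio[OF that] by (simp add: ln_powr)
    then show "v = 0" unfolding v_def by (intro sum.neutral) simp
  qed
  then have d_iff: "d \<noteq> \<delta> \<longleftrightarrow> 0 < \<sigma>"
    unfolding \<sigma> using \<open>0 \<le> v\<close> \<open>0 < l\<close> by (auto simp: zero_less_divide_iff)

  \<comment> \<open>\<open>m\<close> is the image of the Bernoulli measure of \<open>p\<close>\<close>
  obtain Q where Q: "set_pmf Q = {1..k}" "\<And>i. i \<in> {1..k} \<Longrightarrow> pmf Q i = p i"
    using pmf_of_weights[of "{1..k}" p] p_pos p_sum by blast
  have E: "measure_pmf.expectation Q f = (\<Sum>i=1..k. p i * f i)" for f :: "nat \<Rightarrow> real"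
    by (subst expectation_pmf_finite) (simp_all add: Q)
  have m: "m = distr (Bern Q) borel coding"
  proof (rule self_similar_measure_unique[where p = p])
    show "self_similar_measure k p S' m"
      using self_sim unfolding self_similar_measure_def by (simp add: S'_def)
    show "self_similar_measure k p S' (distr (Bern Q) borel coding)"
      using self_similar_coding[of Q] Q unfolding self_similar_measure_def by simp
  qed (use p_pos p_sum in \<open>auto simp: less_imp_le\<close>)
  have m_eq: "measure m B = measure (Bern Q) (coding -` B)" if "B \<in> sets borel" for B
    using measure_distr[OF measurable_coding that, of Q] by (simp add: m)
  have EX: "measure_pmf.expectation Q (\<lambda>i. ln (pmf Q i) - d * ln (r' i)) = 0"
    using mean by (simp add: E Q r'_def)
  have EY: "measure_pmf.expectation Q (\<lambda>i. - ln (r' i)) = l"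
    by (simp add: E r'_def l_def sum_negf)
  have EV: "measure_pmf.expectation Q (\<lambda>i. (ln (pmf Q i) - d * ln (r' i))\<^sup>2) = v"
    by (simp add: E Q r'_def v_def)

  have ac: "abs_cont_hausdorff m (\<lambda>t. t powr d * Theta t powr (\<sigma> + \<epsilon>))" if "0 < \<epsilon>" for \<epsilon>
  proof -
    have "\<sigma>\<^sup>2 < (\<sigma> + \<epsilon>)\<^sup>2" using that \<open>0 \<le> \<sigma>\<close> by (intro power_strict_mono) auto
    then have "v < (\<sigma> + \<epsilon>)\<^sup>2 * l" using \<open>\<sigma>\<^sup>2 * l = v\<close> \<open>0 < l\<close> by (metis mult_strict_right_mono)
    then show ?thesis
      using abs_cont_gauge[OF Q(1) EX EY \<open>0 < l\<close>, of "\<sigma> + \<epsilon>"] that \<open>0 \<le> \<sigma>\<close> \<open>0 \<le> d\<close>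
      unfolding abs_cont_hausdorff_def EV by (simp add: m_eq)
  qed
  have sing: "singular_hausdorff m (\<lambda>t. t powr d * Theta t powr (\<sigma> - \<epsilon>))" if "0 < \<epsilon>" "0 < \<sigma>" for \<epsilon>
  proof -
    define c where "c = max 0 (\<sigma> - \<epsilon> / 2)"
    have c: "0 \<le> c" "c < \<sigma>" "\<sigma> - \<epsilon> < c" using that by (auto simp: c_def)
    then have "c\<^sup>2 < \<sigma>\<^sup>2" by (intro power_strict_mono) auto
    then have "c\<^sup>2 * l < v" using \<open>\<sigma>\<^sup>2 * l = v\<close> \<open>0 < l\<close> by (metis mult_strict_right_mono)
    then have "\<exists>B\<in>sets borel. measure (Bern Q) (coding -` B) = 1 \<and>
        hausdorff_measure (\<lambda>t. t powr d * Theta t powr (\<sigma> - \<epsilon>)) B = 0"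
      using c by (intro singular_gauge[OF Q(1) EX EY \<open>0 < l\<close>]) (simp_all add: EV)
    then show ?thesis unfolding singular_hausdorff_def using m_eq by metis
  qed
  \<comment> \<open>for \<open>\<epsilon> = \<sigma>\<close> the factor \<open>Theta\<close> disappears from the gauge\<close>
  have "singular_hausdorff m (\<lambda>t. t powr d)" if "0 < \<sigma>"
    using sing[of \<sigma>] that by (simp add: Theta_eq)
  with ac sing d_iff \<delta> show ?thesis by blast
qed

end
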